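(* Let $X$ be a smooth projective toric variety over a field $\mathbb{K}$ with total coordinate ring $S$. Let $M$ be a finitely generated $\operatorname{Pic}(X)$-graded $S$-module that is faithful (i.e. $\operatorname{ann} M = 0$) and satisfies $\widetilde M\neq 0$. Suppose the degrees of all minimal generators of $M$ are contained in $\operatorname{Nef} X$. Then $\operatorname{reg} M \subseteq \operatorname{Nef} X$. In particular, $\operatorname{reg} M$ has finitely many minimal elements with respect to the partial order $\leq$ on $\operatorname{Pic} X$.
   Context: $X$ is a smooth projective toric variety over a field $\mathbb{K}$, determined by a fan $\Sigma$. Its total coordinate (Cox) ring $S$ is the polynomial ring over $\mathbb{K}$ with one variable $x_\rho$ for each ray $\rho$ of $\Sigma$, graded by $\operatorname{Pic} X$ with $\deg x_\rho$ the class of the torus-invariant prime divisor $D_\rho$. The irrelevant ideal is $B=\langle \prod_{\rho\not\subset\sigma}x_\rho : \sigma\in\Sigma\rangle\subset S$. For a graded $S$-module $M$, $\widetilde M$ is the associated quasi-coherent sheaf on $X$ (Cox's construction), and $H^i_B(M)$ is local cohomology with support in $B$. $\operatorname{Nef}X\subset\operatorname{Pic}X$ is the monoid of classes of numerically effective divisors, and $\mathbf C=(\mathbf c_1,\dots,\mathbf c_r)$ are its minimal monoid generators. For $\lambda\in\mathbb{Z}^r$ write $\lambda\cdot\mathbf C=\lambda_1\mathbf c_1+\dots+\lambda_r\mathbf c_r$ and $|\lambda|=\lambda_1+\dots+\lambda_r$. For $\mathbf a,\mathbf b\in\operatorname{Pic}X$, $\mathbf a\le\mathbf b$ means $\mathbf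 b-\mathbf a\in\operatorname{Nef}X$. $\mathbb{N}$ includes $0$. Multigraded regularity: for $\mathbf d\in\operatorname{Pic}X$, a graded $S$-module $M$ is $\mathbf d$-regular if (1) $H^i_B(M)_{\mathbf b}=0$ for all $i>0$ and all $\mathbf b\in\bigcup_{\lambda\in\mathbb{N}^r,\,|\lambda|=i-1}(\mathbf d-\lambda\cdot\mathbf C+\operatorname{Nef}X)$; and (2) $H^0_B(M)_{\mathbf b}=0$ for all $\mathbf b\in\bigcup_j(\mathbf d+\mathbf c_j+\operatorname{Nef}X)$. $\operatorname{reg}M\subseteq\operatorname{Pic}X$ is the set of $\mathbf d$ such that $M$ is $\mathbf d$-regular. *)

theory Defs
  imports
    "HOL-Analysis.Analysis"
    "HOL-Library.Poly_Mapping"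
    "HOL-Library.Extended_Nat"
    "HOL-Computational_Algebra.Fraction_Field"
begin

section \<open>Fans of smooth projective toric varieties\<close>

text \<open>
  The lattice is \<open>N = \<int>\<^sup>n\<close> with \<open>n = CARD('n)\<close>; its dual \<open>M\<close> is identified with
  \<open>\<int>\<^sup>n\<close> through the standard inner product.
\<close>

definition lattice :: "(real^'n) set"
  where "lattice = {v. \<forall>i. v $ i \<in> \<int>}"

definition lattice_basis :: "(real^'n) set \<Rightarrow> bool"
  where "lattice_basis b \<longleftrightarrow>
    independent b \<and> lattice = range (\<lambda>c :: real^'n \<Rightarrow> int. \<Sum>v\<in>b. of_int (c v) *\<^sub>R v)"

definition rational_polyhedral_cone :: "(real^'n) set \<Rightarrow> bool"
  where "rational_polyhedral_cone \<sigma> \<longleftrightarrow> (\<exists>A. finite A \<and> A \<subseteq> lattice \<and> \<sigma> = convex_cone hull A)"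

definition strongly_convex :: "(real^'n) set \<Rightarrow> bool"
  where "strongly_convex \<sigma> \<longleftrightarrow> (\<forall>v. v \<in> \<sigma> \<and> - v \<in> \<sigma> \<longrightarrow> v = 0)"

text \<open>
  The library counts the empty set as a face of every convex set; faces of cones and of
  polytopes are meant to be nonempty.
\<close>

definition is_fan :: "(real^'n) set set \<Rightarrow> bool"
  where "is_fan \<Sigma> \<longleftrightarrow>
    finite \<Sigma> \<and> \<Sigma> \<noteq> {} \<and>
    (\<forall>\<sigma>\<in>\<Sigma>. rational_polyhedral_cone \<sigma> \<and> strongly_convex \<sigma>) \<and>
    (\<forall>\<sigma>\<in>\<Sigma>. \<forall>\<tau>. \<tau> face_of \<sigma> \<and> \<tau> \<noteq> {} \<longrightarrow> \<tau> \<in> \<Sigma>) \<and>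
    (\<forall>\<sigma>\<in>\<Sigma>. \<forall>\<tau>\<in>\<Sigma>. (\<sigma> \<inter> \<tau>) face_of \<sigma> \<and> (\<sigma> \<inter> \<tau>) face_of \<tau>)"

definition rays :: "(real^'n) set set \<Rightarrow> (real^'n) set set"
  where "rays \<Sigma> = {\<rho> \<in> \<Sigma>. dim \<rho> = 1}"

text \<open>The primitive generator of \<open>\<rho>\<close>, i.e. the generator of the monoid \<open>\<rho> \<inter> N\<close>.\<close>

definition ray_generator :: "(real^'n) set \<Rightarrow> real^'n"
  where "ray_generator \<rho> = (THE v. \<rho> \<inter> lattice = range (\<lambda>k :: nat. of_nat k *\<^sub>R v))"

definition smooth_fan :: "(real^'n) set set \<Rightarrow> bool"
  where "smooth_fan \<Sigma> \<longleftrightarrow> (\<forall>\<sigma>\<in>\<Sigma>. \<exists>b A. lattice_basis b \<and> A \<subseteq> b \<and> \<sigma> = convex_cone hull A)"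

text \<open>
  The toric variety of a fan is projective iff the fan is the (inner) normal fan of a
  full-dimensional lattice polytope; such a fan is automatically complete.
\<close>

definition normal_fan :: "(real^'n) set \<Rightarrow> (real^'n) set set"
  where "normal_fan P = {{v. \<forall>x\<in>F. \<forall>y\<in>P. v \<bullet> x \<le> v \<bullet> y} | F. F face_of P \<and> F \<noteq> {}}"

definition projective_fan :: "(real^'n) set set \<Rightarrow> bool"
  where "projective_fan \<Sigma> \<longleftrightarrow>
    (\<exists>V. finite V \<and> V \<subseteq> lattice \<and> interior (convex hull V) \<noteq> {} \<and> \<Sigma> = normal_fan (convex hull V))"


section \<open>Toric varieties, their Picard groups and Cox rings\<close>

text \<open>
  A toric variety is recorded by its fan, a labelling of the rays by a type \<open>'r\<close>
  (so that the Cox ring is a polynomial ring in variables indexed by \<open>'r\<close>), and the class map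
  sending a torus-invariant divisor \<open>\<Sum>\<^sub>\<rho> D(\<rho>) D\<^sub>\<rho>\<close> to its class in \<open>Pic X\<close>.
  The linear order on \<open>'r\<close> is arbitrary and only serves to make the polynomial ring an
  instance of class \<open>idom\<close>.
\<close>

record ('n, 'r, 'p) toric =
  fan :: "(real^'n) set set"
  ray :: "'r \<Rightarrow> (real^'n) set"
  cls :: "('r \<Rightarrow> int) \<Rightarrow> 'p"

text \<open>
  \<open>Pic X\<close> is presented, as an arbitrary abelian group \<open>'p\<close>, by the exact sequence
  \<open>M \<rightarrow> \<int>\<^bsup>\<Sigma>(1)\<^esup> \<rightarrow> Pic X \<rightarrow> 0\<close> in which \<open>m\<close> is sent to
  \<open>div(\<chi>\<^sup>m) = \<Sum>\<^sub>\<rho> \<langle>m, u\<^sub>\<rho>\<rangle> D\<^sub>\<rho>\<close>; on a smooth toric variety every class is that of a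
  torus-invariant divisor, and every divisor is Cartier.
\<close>

definition smooth_projective_toric ::
    "('n::finite, 'r::{finite,linorder}, 'p::ab_group_add) toric \<Rightarrow> bool"
  where "smooth_projective_toric X \<longleftrightarrow>
    is_fan (fan X) \<and> smooth_fan (fan X) \<and> projective_fan (fan X) \<and>
    bij_betw (ray X) UNIV (rays (fan X)) \<and>
    (\<forall>D E. cls X (\<lambda>\<rho>. D \<rho> + E \<rho>) = cls X D + cls X E) \<and>
    surj (cls X) \<and>
    (\<forall>D. cls X D = 0 \<longleftrightarrow>
      (\<exists>m\<in>lattice. \<forall>\<rho>. real_of_int (D \<rho>) = m \<bullet> ray_generator (ray X \<rho>)))"

type_synonym ('r, 'k) cox = "('r \<Rightarrow>\<^sub>0 nat) \<Rightarrow>\<^sub>0 'k"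

definition monomial_degree :: "('n::finite, 'r::{finite,linorder}, 'p::ab_group_add) toric \<Rightarrow> ('r \<Rightarrow>\<^sub>0 nat) \<Rightarrow> 'p"
  where "monomial_degree X m = cls X (\<lambda>\<rho>. int (Poly_Mapping.lookup m \<rho>))"

definition cox_part ::
    "('n::finite, 'r::{finite,linorder}, 'p::ab_group_add) toric \<Rightarrow> 'p \<Rightarrow> ('r, 'k::field) cox set"
  where "cox_part X a = {p. \<forall>m\<in>Poly_Mapping.keys p. monomial_degree X m = a}"

definition cox_var :: "'r::{finite,linorder} \<Rightarrow> ('r, 'k::field) cox"
  where "cox_var \<rho> = Poly_Mapping.single (Poly_Mapping.single \<rho> 1) 1"

definition xhat ::
    "('n::finite, 'r::{finite,linorder}, 'p::ab_group_add) toric \<Rightarrow> (real^'n) set \<Rightarrow> ('r, 'k::field) cox"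
  where "xhat X \<sigma> = (\<Prod>\<rho> | \<not> ray X \<rho> \<subseteq> \<sigma>. cox_var \<rho>)"

text \<open>Ideals of a commutative ring are its subspaces as a module over itself.\<close>

definition irrelevant_ideal ::
    "('n::finite, 'r::{finite,linorder}, 'p::ab_group_add) toric \<Rightarrow> ('r, 'k::field) cox set"
  where "irrelevant_ideal X = module.span (*) (xhat X ` fan X)"


section \<open>Curves on X and the nef monoid\<close>

text \<open>
  By Cox's construction the points of the scheme \<open>X\<close>, equivalently its integral closed
  subschemes, are the homogeneous prime ideals of the Cox ring that do not contain the
  irrelevant ideal; specialization of points is inclusion of primes. All closed subschemes of
  \<open>X\<close> are complete.
\<close>

definition toric_points ::
    "('n::finite, 'r::{finite,linorder}, 'p::ab_group_add) toric \<Rightarrow> ('r, 'k::field) cox set set"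
  where "toric_points X = {P.
    module.subspace (*) P \<and> 1 \<notin> P \<and> (\<forall>p q. p * q \<in> P \<longrightarrow> p \<in> P \<or> q \<in> P) \<and>
    P = module.span (*) {p \<in> P. \<exists>a. p \<in> cox_part X a} \<and>
    \<not> irrelevant_ideal X \<subseteq> P}"

text \<open>Generic points of the integral closed subschemes of dimension one.\<close>

definition curves ::
    "('n::finite, 'r::{finite,linorder}, 'p::ab_group_add) toric \<Rightarrow> ('r, 'k::field) cox set set"
  where "curves X = {P \<in> toric_points X.
    (\<exists>Q\<in>toric_points X. P \<subset> Q) \<and>
    (\<forall>Q\<in>toric_points X. \<forall>Q'\<in>toric_points X. \<not> (P \<subset> Q \<and> Q \<subset> Q'))}"

text \<open>
  For homogeneous ideals \<open>I\<close> this is the degree-zero part of the localization of \<open>I\<close> at the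
  homogeneous elements outside \<open>Q\<close>, inside the field of fractions of the Cox ring. For
  \<open>I = UNIV\<close> it is the local ring of \<open>X\<close> at \<open>Q\<close>; in general it is the stalk at \<open>Q\<close> of the
  ideal sheaf of \<open>I\<close>.
\<close>

definition stalk ::
    "('n::finite, 'r::{finite,linorder}, 'p::ab_group_add) toric \<Rightarrow> ('r, 'k::field) cox set \<Rightarrow>
     ('r, 'k) cox set \<Rightarrow> ('r, 'k) cox fract set"
  where "stalk X Q I = {Fract p s | p s a. p \<in> I \<inter> cox_part X a \<and> s \<in> cox_part X a - Q}"

text \<open>
  The dimension over the ground field of a quotient \<open>A / J\<close> of subspaces: the supremum of the
  lengths of lists in \<open>A\<close> that are linearly independent modulo \<open>J\<close>.
\<close>

definition quotient_dim ::
    "('r::{finite,linorder}, 'k::field) cox fract set \<Rightarrow> ('r, 'k) cox fract set \<Rightarrow> enat"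
  where "quotient_dim A J = (SUP xs \<in> {xs. set xs \<subseteq> A \<and>
      (\<forall>c :: nat \<Rightarrow> 'k. (\<Sum>i<length xs. Fract (Poly_Mapping.single 0 (c i)) 1 * xs ! i) \<in> J \<longrightarrow>
        (\<forall>i<length xs. c i = 0))}. enat (length xs))"

text \<open>
  Let \<open>f\<close> be a homogeneous element of degree \<open>b\<close>, not vanishing identically on the curve
  \<open>C\<close> with generic point \<open>P\<close>, i.e. a nonzero section of the line bundle \<open>O(b)\<close> on \<open>C\<close>.
  The degree of its divisor of zeros is the sum, over the closed points \<open>Q\<close> of \<open>C\<close>, of
  \<open>dim\<^sub>K (O\<^bsub>C,Q\<^esub> / (f)) = ord\<^sub>Q(f) [\<kappa>(Q) : K]\<close>. Only finitely many summands are
  nonzero, and all are finite; the sum is written as a supremum of finite partial sums.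
\<close>

definition zeros_degree ::
    "('n::finite, 'r::{finite,linorder}, 'p::ab_group_add) toric \<Rightarrow> ('r, 'k::field) cox set \<Rightarrow>
     ('r, 'k) cox \<Rightarrow> enat"
  where "zeros_degree X P f = (SUP T \<in> {T. finite T \<and> T \<subseteq> {Q \<in> toric_points X. P \<subset> Q}}.
      \<Sum>Q\<in>T. quotient_dim (stalk X Q UNIV) (stalk X Q (module.span (*) (insert f P))))"

text \<open>
  The intersection number of \<open>a \<in> Pic X\<close> with \<open>C\<close> is the degree of the divisor of any nonzero
  rational section \<open>f/g\<close> of the restriction of \<open>O(a)\<close> to \<open>C\<close>, i.e.
  \<open>zeros_degree X P f - zeros_degree X P g\<close>. It does not depend on the choice of \<open>f/g\<close>, because
  principal divisors on a complete curve have degree 0.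
  The argument of type \<open>'k itself\<close> only names the ground field.
\<close>

definition nonneg_on_curve ::
    "('n::finite, 'r::{finite,linorder}, 'p::ab_group_add) toric \<Rightarrow> ('r, 'k::field) cox set \<Rightarrow> 'p \<Rightarrow> bool"
  where "nonneg_on_curve X P a \<longleftrightarrow>
    (\<exists>b. \<exists>f \<in> cox_part X (a + b) - P. \<exists>g \<in> cox_part X b - P.
      zeros_degree X P g \<le> zeros_degree X P f)"

definition nef ::
    "'k::field itself \<Rightarrow> ('n::finite, 'r::{finite,linorder}, 'p::ab_group_add) toric \<Rightarrow> 'p set"
  where "nef K X = {a. \<forall>P \<in> (curves X :: ('r, 'k) cox set set). nonneg_on_curve X P a}"

definition submonoid_generated :: "'p::ab_group_add set \<Rightarrow> 'p set"
  where "submonoid_generated G = (\<lambda>T. 0 \<in> T \<and> (\<forall>x\<in>T. \<forall>y\<in>T. x + y \<in> T)) hull G"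

text \<open>The minimal generating set, which exists and is unique for the pointed affine monoid \<open>Nef X\<close>.\<close>

definition nef_generators ::
    "'k::field itself \<Rightarrow> ('n::finite, 'r::{finite,linorder}, 'p::ab_group_add) toric \<Rightarrow> 'p set"
  where "nef_generators K X = (THE G. submonoid_generated G = nef K X \<and>
    (\<forall>G'. G' \<subset> G \<longrightarrow> submonoid_generated G' \<noteq> nef K X))"

definition nef_le ::
    "'k::field itself \<Rightarrow> ('n::finite, 'r::{finite,linorder}, 'p::ab_group_add) toric \<Rightarrow> 'p \<Rightarrow> 'p \<Rightarrow> bool"
  where "nef_le K X a b \<longleftrightarrow> b - a \<in> nef K X"

definition minimal_elements ::
    "'k::field itself \<Rightarrow> ('n::finite, 'r::{finite,linorder}, 'p::ab_group_add) toric \<Rightarrow> 'p set \<Rightarrow> 'p set"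
  where "minimal_elements K X A = {a \<in> A. \<forall>b\<in>A. nef_le K X b a \<longrightarrow> b = a}"


section \<open>Graded modules over the Cox ring\<close>

record ('s, 'p, 'm) graded_structure =
  act :: "'s \<Rightarrow> 'm \<Rightarrow> 'm"
  part :: "'p \<Rightarrow> 'm set"

type_synonym ('r, 'k, 'p, 'm) gmodule = "(('r, 'k) cox, 'p, 'm) graded_structure"

definition graded_module ::
    "('n::finite, 'r::{finite,linorder}, 'p::ab_group_add) toric \<Rightarrow>
     ('r, 'k::field, 'p, 'm::ab_group_add) gmodule \<Rightarrow> bool"
  where "graded_module X M \<longleftrightarrow>
    module (act M) \<and>
    (\<forall>a. 0 \<in> part M a \<and> (\<forall>x\<in>part M a. \<forall>y\<in>part M a. x - y \<in> part M a)) \<and>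
    (\<forall>a b. \<forall>p\<in>cox_part X a. \<forall>x\<in>part M b. act M p x \<in> part M (a + b)) \<and>
    (\<forall>x. \<exists>!c. finite {a. c a \<noteq> 0} \<and> (\<forall>a. c a \<in> part M a) \<and> x = (\<Sum>a | c a \<noteq> 0. c a))"

definition finitely_generated :: "('r::{finite,linorder}, 'k::field, 'p, 'm::ab_group_add) gmodule \<Rightarrow> bool"
  where "finitely_generated M \<longleftrightarrow> (\<exists>G. finite G \<and> module.span (act M) G = UNIV)"

definition annihilator :: "('r::{finite,linorder}, 'k::field, 'p, 'm::ab_group_add) gmodule \<Rightarrow> ('r, 'k) cox set"
  where "annihilator M = {p. \<forall>x. act M p x = 0}"

definition minimal_generating_set ::
    "('r::{finite,linorder}, 'k::field, 'p, 'm::ab_group_add) gmodule \<Rightarrow> 'm set \<Rightarrow> bool"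
  where "minimal_generating_set M G \<longleftrightarrow>
    (\<forall>g\<in>G. \<exists>a. g \<in> part M a) \<and> module.span (act M) G = UNIV \<and>
    (\<forall>G'. G' \<subset> G \<longrightarrow> module.span (act M) G' \<noteq> UNIV)"

definition minimal_generator ::
    "('r::{finite,linorder}, 'k::field, 'p, 'm::ab_group_add) gmodule \<Rightarrow> 'm \<Rightarrow> bool"
  where "minimal_generator M g \<longleftrightarrow> (\<exists>G. minimal_generating_set M G \<and> g \<in> G)"

text \<open>
  The fraction \<open>x / f\<^sup>k\<close> as an element of the localization \<open>M\<^sub>f\<close>, that is, an equivalence
  class of pairs.
\<close>

definition frac ::
    "('r::{finite,linorder}, 'k::field, 'p, 'm::ab_group_add) gmodule \<Rightarrow> ('r, 'k) cox \<Rightarrow> 'm \<Rightarrow> nat \<Rightarrow>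
     ('m \<times> nat) set"
  where "frac M f x k = {(y, l). \<exists>t. act M (f ^ t) (act M (f ^ l) x - act M (f ^ k) y) = 0}"

text \<open>The degree \<open>b\<close> part of \<open>M\<^sub>f\<close> for a nonzero homogeneous \<open>f\<close>.\<close>

definition frac_part ::
    "('n::finite, 'r::{finite,linorder}, 'p::ab_group_add) toric \<Rightarrow>
     ('r, 'k::field, 'p, 'm::ab_group_add) gmodule \<Rightarrow> ('r, 'k) cox \<Rightarrow> 'p \<Rightarrow> ('m \<times> nat) set set"
  where "frac_part X M f b = {frac M f x k | x k a. f ^ k \<in> cox_part X a \<and> x \<in> part M (b + a)}"

text \<open>
  On the affine chart of a cone \<open>\<sigma>\<close> the sheaf associated with \<open>M\<close> is given by the degree-zero
  part of the localization of \<open>M\<close> at \<open>xhat X \<sigma>\<close>.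
\<close>

definition sheaf_is_zero ::
    "('n::finite, 'r::{finite,linorder}, 'p::ab_group_add) toric \<Rightarrow>
     ('r, 'k::field, 'p, 'm::ab_group_add) gmodule \<Rightarrow> bool"
  where "sheaf_is_zero X M \<longleftrightarrow>
    (\<forall>\<sigma>\<in>fan X. frac_part X M (xhat X \<sigma>) 0 = {frac M (xhat X \<sigma>) 0 0})"


section \<open>Local cohomology and multigraded regularity\<close>

text \<open>
  Local cohomology with support in the irrelevant ideal is the cohomology of the graded
  (ordered, extended) Cech complex on its generators \<open>f\<^sub>0, \<dots>, f\<^bsub>s-1\<^esub>\<close>, the monomials
  \<open>xhat X \<sigma>\<close>, listed in some order. In cohomological degree \<open>i\<close> this complex is the product
  of the localizations of \<open>M\<close> at \<open>\<Prod>\<^bsub>j \<in> I\<^esub> f\<^sub>j\<close>, for \<open>I \<subseteq> {..<s}\<close> with \<open>i\<close> elements;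
  in particular it is \<open>M\<close> itself for \<open>i = 0\<close>.
\<close>

definition cone_list :: "('n::finite, 'r, 'p) toric \<Rightarrow> (real^'n) set list"
  where "cone_list X = (SOME cs. distinct cs \<and> set cs = fan X)"

definition cech_gen ::
    "('n::finite, 'r::{finite,linorder}, 'p::ab_group_add) toric \<Rightarrow> nat \<Rightarrow> ('r, 'k::field) cox"
  where "cech_gen X j = xhat X (cone_list X ! j)"

definition cech_index :: "('n::finite, 'r, 'p) toric \<Rightarrow> nat \<Rightarrow> nat set set"
  where "cech_index X i = {I. I \<subseteq> {..<length (cone_list X)} \<and> card I = i}"

definition cech_cochains ::
    "('n::finite, 'r::{finite,linorder}, 'p::ab_group_add) toric \<Rightarrow>
     ('r, 'k::field, 'p, 'm::ab_group_add) gmodule \<Rightarrow> nat \<Rightarrow> 'p \<Rightarrow> (nat set \<Rightarrow> ('m \<times> nat) set) set"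
  where "cech_cochains X M i b = (\<Pi>\<^sub>E I \<in> cech_index X i. frac_part X M (\<Prod>j\<in>I. cech_gen X j) b)"

definition cech_zero ::
    "('n::finite, 'r::{finite,linorder}, 'p::ab_group_add) toric \<Rightarrow>
     ('r, 'k::field, 'p, 'm::ab_group_add) gmodule \<Rightarrow> nat \<Rightarrow> nat set \<Rightarrow> ('m \<times> nat) set"
  where "cech_zero X M i = (\<lambda>I \<in> cech_index X i. frac M (\<Prod>j\<in>I. cech_gen X j) 0 0)"

text \<open>
  The value of the differential at \<open>J\<close> is the alternating sum over \<open>j \<in> J\<close> of the images in
  the localization at \<open>f\<^sub>J = \<Prod>\<^bsub>j \<in> J\<^esub> f\<^sub>j\<close> of the components of \<open>c\<close> at \<open>J - {j}\<close>. It is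
  computed by writing these components with a common exponent as \<open>x\<^sub>j / (f\<^bsub>J - {j}\<^esub>)\<^sup>k\<close>,
  whose image is \<open>(f\<^sub>j\<^sup>k x\<^sub>j) / f\<^sub>J\<^sup>k\<close>; the result does not depend on the representatives.
\<close>

definition cech_diff ::
    "('n::finite, 'r::{finite,linorder}, 'p::ab_group_add) toric \<Rightarrow>
     ('r, 'k::field, 'p, 'm::ab_group_add) gmodule \<Rightarrow> nat \<Rightarrow>
     (nat set \<Rightarrow> ('m \<times> nat) set) \<Rightarrow> nat set \<Rightarrow> ('m \<times> nat) set"
  where "cech_diff X M i c = (\<lambda>J \<in> cech_index X (Suc i).
    THE z. \<exists>x k.
      (\<forall>j\<in>J. c (J - {j}) = frac M (\<Prod>l\<in>J - {j}. cech_gen X l) (x j) k) \<and>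
      z = frac M (\<Prod>l\<in>J. cech_gen X l)
            (\<Sum>j\<in>J. act M ((-1) ^ card {l \<in> J. l < j} * cech_gen X j ^ k) (x j)) k)"

definition cech_cocycles ::
    "('n::finite, 'r::{finite,linorder}, 'p::ab_group_add) toric \<Rightarrow>
     ('r, 'k::field, 'p, 'm::ab_group_add) gmodule \<Rightarrow> nat \<Rightarrow> 'p \<Rightarrow> (nat set \<Rightarrow> ('m \<times> nat) set) set"
  where "cech_cocycles X M i b =
    {c \<in> cech_cochains X M i b. cech_diff X M i c = cech_zero X M (Suc i)}"

definition cech_coboundaries ::
    "('n::finite, 'r::{finite,linorder}, 'p::ab_group_add) toric \<Rightarrow>
     ('r, 'k::field, 'p, 'm::ab_group_add) gmodule \<Rightarrow> nat \<Rightarrow> 'p \<Rightarrow> (nat set \<Rightarrow> ('m \<times> nat) set) set"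
  where "cech_coboundaries X M i b =
    (case i of 0 \<Rightarrow> {cech_zero X M 0} | Suc h \<Rightarrow> cech_diff X M h ` cech_cochains X M h b)"

text \<open>The degree \<open>b\<close> part of the \<open>i\<close>-th local cohomology module is zero.\<close>

definition local_cohomology_vanishes ::
    "('n::finite, 'r::{finite,linorder}, 'p::ab_group_add) toric \<Rightarrow>
     ('r, 'k::field, 'p, 'm::ab_group_add) gmodule \<Rightarrow> nat \<Rightarrow> 'p \<Rightarrow> bool"
  where "local_cohomology_vanishes X M i b \<longleftrightarrow> cech_cocycles X M i b \<subseteq> cech_coboundaries X M i b"

text \<open>
  Since \<open>nef_generators\<close> is a finite set, the vectors in \<open>\<nat>\<^sup>r\<close> are
  functions \<open>\<mu>\<close> on it, and \<open>lincomb C \<mu>\<close> is \<open>\<mu> \<cdot> C\<close>.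
\<close>

definition lincomb :: "'p::ab_group_add set \<Rightarrow> ('p \<Rightarrow> nat) \<Rightarrow> 'p"
  where "lincomb C \<mu> = (\<Sum>c\<in>C. \<Sum>k<\<mu> c. c)"

definition is_regular ::
    "('n::finite, 'r::{finite,linorder}, 'p::ab_group_add) toric \<Rightarrow>
     ('r, 'k::field, 'p, 'm::ab_group_add) gmodule \<Rightarrow> 'p \<Rightarrow> bool"
  where "is_regular X M d \<longleftrightarrow>
    (let C = nef_generators TYPE('k) X; N = nef TYPE('k) X in
      (\<forall>i>0. \<forall>\<mu>. (\<Sum>c\<in>C. \<mu> c) = i - 1 \<longrightarrow>
        (\<forall>n\<in>N. local_cohomology_vanishes X M i (d - lincomb C \<mu> + n))) \<and>
      (\<forall>c\<in>C. \<forall>n\<in>N. local_cohomology_vanishes X M 0 (d + c + n)))"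

definition reg ::
    "('n::finite, 'r::{finite,linorder}, 'p::ab_group_add) toric \<Rightarrow>
     ('r, 'k::field, 'p, 'm::ab_group_add) gmodule \<Rightarrow> 'p set"
  where "reg X M = {d. is_regular X M d}"

end

theory Submission
  imports Defs "HOL-Computational_Algebra.Polynomial"
begin

text \<open>
  If \<open>M\<close> is \<open>d\<close>-regular and \<open>c\<close> is a minimal generator of \<open>Nef X\<close>, then the vanishing of
  \<open>H\<^sub>B\<^sup>i(M)\<close> in the degrees \<open>d - (i - 1) c\<close> for \<open>i > 0\<close> and \<open>d + c\<close> for \<open>i = 0\<close> lets one descend
  along the Koszul complex of monomial sections of \<open>c\<close>, one for each chart, and so
  \<open>M\<^bsub>d+c\<^esub> \<subseteq> S M\<^sub>d\<close>; hence \<open>M\<^sub>d\<close> generates \<open>M\<close> in all degrees \<open>d + Nef X\<close>. On the toric curve of a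
  wall the degree formula on the projective line reads off the intersection number from local
  equations, which shows that a class is nef iff it is basepoint free; thus \<open>Nef X\<close> is cut out by
  finitely many integral linear inequalities and Dickson's lemma applies to it.

  If a regular degree \<open>d\<close> were not nef, it would be negative on some curve with prime ideal \<open>P\<close>.
  Since the generators of \<open>M\<close> have nef degrees, their coefficients in elements of \<open>M\<^sub>d\<close> would lie in
  \<open>P\<close>, that is \<open>M\<^sub>d \<subseteq> P M\<close>. But \<open>M\<^sub>d\<close> generates the localization \<open>M\<^sub>P\<close>, so \<open>M\<^sub>P = 0\<close> by Nakayama's
  lemma, against the faithfulness of \<open>M\<close>.
\<close>

section \<open>Cech cohomology and the Koszul complex\<close>

text \<open>Nefness is defined by all curves of \<open>X\<close>, given as homogeneous primes, with
  zeros counted by dimensions of quotients of stalks. Exact degrees are computed on the curves of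
  walls. On an arbitrary curve the proof rests on two comparisons: \<open>1\<close> has no zeros,
  and \<open>p * f\<close> has at least the zeros of \<open>f\<close>. By the first, a class with a
  nonvanishing monomial section on every chart is nef; by the second, if \<open>a\<close> is nef and
  some section of \<open>d - a\<close> does not vanish on the curve, then \<open>d\<close> is
  nonnegative there.

  The computations with classes go through the integers \<open>rep A a \<rho>\<close>, the exponents
  of the monomial that trivializes \<open>a\<close> on the chart of a maximal cone \<open>A\<close>.
  They are additive in \<open>a\<close>, they are intersection numbers when \<open>\<rho>\<close>
  lies across a wall of \<open>A\<close>, and their nonnegativity cuts out the nef monoid.

  The Koszul complex has one section for each listed cone, so its length may exceed the dimension of
  \<open>X\<close>; regularity gives a vanishing in every cohomological degree. That
  \<open>M_d\<close> generates locally comes from an ample class \<open>H\<close>: adding a large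
  multiple of \<open>H\<close> moves any degree into \<open>d + Nef X\<close>, at the cost of a
  monomial factor outside \<open>P\<close>.\<close>

definition nmul :: "nat \<Rightarrow> 'p::ab_group_add \<Rightarrow> 'p"
  where "nmul k a = (\<Sum>i<k. a)"

lemma nmul_0 [simp]: "nmul 0 a = 0"
  and nmul_Suc [simp]: "nmul (Suc k) a = nmul k a + a"
  by (simp_all add: nmul_def)

lemma nmul_add: "nmul (k + l) a = nmul k a + nmul l a"
  by (induction l) (simp_all add: algebra_simps)

lemma nmul_zero_right [simp]: "nmul k 0 = 0"
  by (simp add: nmul_def)

text \<open>Concentrating the multiplicities on one generator \<open>c\<close> turns the degree
  \<open>d - lincomb C \<mu>\<close> of the regularity condition into \<open>d - nmul k c\<close>,
  the degree met in the Koszul descent.\<close>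

lemma lincomb_single:
  assumes "finite C" "c \<in> C"
  shows "lincomb C (\<lambda>c'. if c' = c then k else 0) = nmul k c"
proof -
  have "lincomb C (\<lambda>c'. if c' = c then k else 0) = (\<Sum>c'\<in>C. if c' = c then nmul k c else 0)"
    unfolding lincomb_def nmul_def by (rule sum.cong) auto
  then show ?thesis using assms by simp
qed

section \<open>Homogeneous elements of the Cox ring\<close>

locale cls_additive =
  fixes X :: "('n::finite, 'r::{finite,linorder}, 'p::ab_group_add) toric"
  assumes cls_add: "cls X (\<lambda>\<rho>. D \<rho> + E \<rho>) = cls X D + cls X E"
begin

lemma cls_zero: "cls X (\<lambda>\<rho>. 0) = 0"
  using cls_add[of "\<lambda>\<rho>. 0" "\<lambda>\<rho>. 0"] by simp

lemma monomial_degree_add: "monomial_degree X (m + m') = monomial_degree X m + monomial_degree X m'"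
  unfolding monomial_degree_def by (simp add: lookup_add cls_add)

lemma monomial_degree_zero: "monomial_degree X 0 = 0"
  by (simp add: monomial_degree_def cls_zero)

lemma cox_part_zero [simp]: "0 \<in> cox_part X a"
  by (simp add: cox_part_def)

lemma cox_part_one: "1 \<in> cox_part X 0"
  by (simp add: cox_part_def monomial_degree_zero)

lemma cox_part_add: "p \<in> cox_part X a \<Longrightarrow> q \<in> cox_part X a \<Longrightarrow> p + q \<in> cox_part X a"
  unfolding cox_part_def using Poly_Mapping.keys_add[of p q] by blast

lemma cox_part_uminus: "p \<in> cox_part X a \<Longrightarrow> - p \<in> cox_part X a"
  by (simp add: cox_part_def in_keys_iff)

lemma cox_part_diff: "p \<in> cox_part X a \<Longrightarrow> q \<in> cox_part X a \<Longrightarrow> p - q \<in> cox_part X a"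
  using cox_part_add[of p a "- q"] cox_part_uminus[of q a] by simp

lemma cox_part_sum: "(\<And>i. i \<in> I \<Longrightarrow> p i \<in> cox_part X a) \<Longrightarrow> sum p I \<in> cox_part X a"
  by (induction I rule: infinite_finite_induct) (auto intro: cox_part_add)

lemma cox_part_mult: "p \<in> cox_part X a \<Longrightarrow> q \<in> cox_part X b \<Longrightarrow> p * q \<in> cox_part X (a + b)"
  unfolding cox_part_def using Poly_Mapping.keys_mult[of p q] monomial_degree_add by fastforce

lemma cox_part_power: "p \<in> cox_part X a \<Longrightarrow> p ^ k \<in> cox_part X (nmul k a)"
proof (induction k)
  case (Suc k)
  then show ?case using cox_part_mult[of "p^k" "nmul k a" p a] by (simp add: algebra_simps)
qed (simp add: cox_part_one)

lemma cox_part_prod: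
  "finite I \<Longrightarrow> (\<And>i. i \<in> I \<Longrightarrow> p i \<in> cox_part X (a i)) \<Longrightarrow> prod p I \<in> cox_part X (sum a I)"
  by (induction I rule: finite_induct) (auto intro: cox_part_mult cox_part_one)

lemma cox_part_sign: "(-1) ^ k \<in> cox_part X 0"
  using cox_part_power[OF cox_part_uminus[OF cox_part_one], of k] by simp

text \<open>Any key of a nonzero element determines its degree. This recovers the degree of a
  denominator \<open>f ^ k\<close>, which \<open>frac_part\<close> hides behind an existential
  quantifier.\<close>

lemma cox_part_unique: "p \<in> cox_part X a \<Longrightarrow> p \<in> cox_part X b \<Longrightarrow> p \<noteq> 0 \<Longrightarrow> a = b"
  unfolding cox_part_def by (metis (mono_tags, lifting) keys_eq_empty ex_in_conv mem_Collect_eq)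

lemma cox_var_in_cox_part: "cox_var \<rho> \<in> cox_part X (cls X (\<lambda>\<rho>'. if \<rho>' = \<rho> then 1 else 0))"
  unfolding cox_part_def cox_var_def monomial_degree_def
  by (auto simp: lookup_single when_def cong: if_cong intro!: arg_cong[where f = "cls X"])

lemma cls_sum: "finite I \<Longrightarrow> cls X (\<lambda>\<rho>. \<Sum>i\<in>I. D i \<rho>) = (\<Sum>i\<in>I. cls X (D i))"
  by (induction I rule: finite_induct) (auto simp: cls_zero cls_add)

lemma xhat_in_cox_part: "xhat X \<sigma> \<in> cox_part X (cls X (\<lambda>\<rho>. if ray X \<rho> \<subseteq> \<sigma> then 0 else 1))"
proof -
  have "xhat X \<sigma> \<in> cox_part X (\<Sum>\<rho>' | \<not> ray X \<rho>' \<subseteq> \<sigma>. cls X (\<lambda>\<rho>. if \<rho> = \<rho>' then 1 else 0))"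
    unfolding xhat_def by (intro cox_part_prod cox_var_in_cox_part) auto
  also have "(\<Sum>\<rho>' | \<not> ray X \<rho>' \<subseteq> \<sigma>. cls X (\<lambda>\<rho>. if \<rho> = \<rho>' then 1 else 0))
      = cls X (\<lambda>\<rho>. \<Sum>\<rho>' | \<not> ray X \<rho>' \<subseteq> \<sigma>. if \<rho> = \<rho>' then 1 else 0)"
    by (rule cls_sum[symmetric]) simp
  also have "(\<lambda>\<rho>. \<Sum>\<rho>' | \<not> ray X \<rho>' \<subseteq> \<sigma>. if \<rho> = \<rho>' then 1 else 0) = (\<lambda>\<rho>. if ray X \<rho> \<subseteq> \<sigma> then 0 else 1)"
    by (auto simp: fun_eq_iff)
  finally show ?thesis .
qed

end

section \<open>Graded modules and their fractions\<close>

locale cox_module = cls_additive X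
  for X :: "('n::finite, 'r::{finite,linorder}, 'p::ab_group_add) toric" +
  fixes M :: "('r, 'k::field, 'p, 'm::ab_group_add) gmodule"
  assumes graded: "graded_module X M"
begin

sublocale module "act M"
  using graded by (simp add: graded_module_def)

abbreviation smul (infixr \<open>*m\<close> 75) where "smul \<equiv> act M"

lemma part_zero [simp]: "0 \<in> part M a"
  and part_diff: "x \<in> part M a \<Longrightarrow> y \<in> part M a \<Longrightarrow> x - y \<in> part M a"
  and part_act: "p \<in> cox_part X a \<Longrightarrow> x \<in> part M b \<Longrightarrow> p *m x \<in> part M (a + b)"
  using graded by (simp_all add: graded_module_def)

lemma part_uminus: "x \<in> part M a \<Longrightarrow> - x \<in> part M a"
  using part_diff[of 0 a x] by simp

lemma part_add: "x \<in> part M a \<Longrightarrow> y \<in> part M a \<Longrightarrow> x + y \<in> part M a"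
  using part_diff[of x a "- y"] part_uminus[of y a] by simp

lemma part_sum: "(\<And>i. i \<in> I \<Longrightarrow> x i \<in> part M a) \<Longrightarrow> sum x I \<in> part M a"
  by (induction I rule: infinite_finite_induct) (auto intro: part_add)

lemma frac_mem: "(y, l) \<in> frac M f x k \<longleftrightarrow> (\<exists>t. f ^ (t + l) *m x = f ^ (t + k) *m y)"
  by (simp add: frac_def scale_right_diff_distrib power_add)

lemma frac_eq_iff: "frac M f x k = frac M f y l \<longleftrightarrow> (\<exists>t. f ^ (t + l) *m x = f ^ (t + k) *m y)"
proof
  assume "frac M f x k = frac M f y l"
  moreover have "(y, l) \<in> frac M f y l" by (simp add: frac_mem)
  ultimately show "\<exists>t. f ^ (t + l) *m x = f ^ (t + k) *m y" by (metis frac_mem)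
next
  \<comment> \<open>Transitivity of the equality of fractions: the equations with witnesses
    \<open>t\<close> and \<open>s\<close> combine to one with witness \<open>t + s + k\<close>,
    where the extra \<open>k\<close> clears the denominator of the middle fraction.\<close>
  have sub: "frac M f x k \<subseteq> frac M f y l"
    if t: "f ^ (t + l) *m x = f ^ (t + k) *m y" for t x k y l
  proof (rule subrelI)
    fix z q assume "(z, q) \<in> frac M f x k"
    then obtain s where s: "f ^ (s + q) *m x = f ^ (s + k) *m z" by (auto simp: frac_mem)
    have "f ^ (t + s + k + q) *m y = f ^ (s + q) *m (f ^ (t + k) *m y)"
      by (simp add: power_add[symmetric] algebra_simps)
    also have "\<dots> = f ^ (t + l) *m (f ^ (s + q) *m x)"
      unfolding t[symmetric] by (rule scale_left_commute)
    also have "\<dots> = f ^ (t + s + k + l) *m z"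
      unfolding s by (simp add: power_add[symmetric] algebra_simps)
    finally have "f ^ ((t + s + k) + q) *m y = f ^ ((t + s + k) + l) *m z" .
    then show "(z, q) \<in> frac M f y l" unfolding frac_mem by blast
  qed
  assume "\<exists>t. f ^ (t + l) *m x = f ^ (t + k) *m y"
  then obtain t where t: "f ^ (t + l) *m x = f ^ (t + k) *m y" by blast
  show "frac M f x k = frac M f y l" using sub[OF t] sub[OF t[symmetric]] by blast
qed

lemma frac_raise: "frac M f (f ^ r *m x) (k + r) = frac M f x k"
  unfolding frac_eq_iff by (auto intro!: exI[of _ 0] simp: power_add mult.commute)

text \<open>\<open>frac_raise\<close> expands every fraction to the exponent \<open>K\<close>, the
  sum of the finitely many exponents. Since the denominators are nonzero,
  \<open>cox_part_unique\<close> forces the degree of each numerator.\<close>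

lemma frac_common_exponent:
  assumes "finite S"
    and hom: "\<And>I. I \<in> S \<Longrightarrow> f I \<in> cox_part X (a I)" "\<And>I. I \<in> S \<Longrightarrow> f I \<noteq> 0"
    and c: "\<And>I. I \<in> S \<Longrightarrow> c I \<in> frac_part X M (f I) b"
  shows "\<exists>k x. \<forall>I\<in>S. c I = frac M (f I) (x I) k \<and> x I \<in> part M (b + nmul k (a I))"
proof -
  have "\<exists>k x. c I = frac M (f I) x k \<and> x \<in> part M (b + nmul k (a I))" if "I \<in> S" for I
  proof -
    obtain x k d where *: "c I = frac M (f I) x k" "f I ^ k \<in> cox_part X d" "x \<in> part M (b + d)"
      using c[OF \<open>I \<in> S\<close>] unfolding frac_part_def by auto
    have "d = nmul k (a I)"
      using cox_part_unique[OF *(2) cox_part_power[OF hom(1)[OF \<open>I \<in> S\<close>]]] hom(2)[OF \<open>I \<in> S\<close>] by simp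
    with * show ?thesis by auto
  qed
  then obtain k x where kx: "\<And>I. I \<in> S \<Longrightarrow> c I = frac M (f I) (x I) (k I)"
      "\<And>I. I \<in> S \<Longrightarrow> x I \<in> part M (b + nmul (k I) (a I))"
    by metis
  define K where "K = (\<Sum>I\<in>S. k I)"
  have K: "K = k I + (K - k I)" if "I \<in> S" for I
    unfolding K_def using member_le_sum[of I S k] that \<open>finite S\<close> by simp
  show ?thesis
  proof (intro exI ballI conjI)
    fix I assume I: "I \<in> S"
    show "c I = frac M (f I) (f I ^ (K - k I) *m x I) K"
      using frac_raise[of "f I" "K - k I" "x I" "k I"] K[OF I] kx(1)[OF I] by simp
    have "f I ^ (K - k I) *m x I \<in> part M (nmul (K - k I) (a I) + (b + nmul (k I) (a I)))"
      by (intro part_act cox_part_power hom I kx)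
    also have "nmul (K - k I) (a I) + (b + nmul (k I) (a I)) = b + nmul K (a I)"
      by (subst (2) K[OF I]) (simp add: nmul_add algebra_simps)
    finally show "f I ^ (K - k I) *m x I \<in> part M (b + nmul K (a I))" .
  qed
qed

section \<open>The Cech complex on numerators\<close>

abbreviation cech_sign :: "nat set \<Rightarrow> nat \<Rightarrow> ('r, 'k) cox"
  where "cech_sign J j \<equiv> (-1) ^ card {l \<in> J. l < j}"

definition cech_den :: "nat set \<Rightarrow> ('r, 'k) cox"
  where "cech_den I = (\<Prod>j\<in>I. cech_gen X j)"

text \<open>The Cech differential with all components over one exponent \<open>k\<close>: for
  \<open>J = insert j I\<close>, the image of \<open>x_I / f_I^k\<close> in the localization at
  \<open>f_J\<close> is \<open>f_j^k x_I / f_J^k\<close>. This is a formula in \<open>M\<close>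
  itself, so equalities of fractions become equations up to powers of
  \<open>cech_den J\<close>.\<close>

definition cech_numerator :: "nat \<Rightarrow> (nat set \<Rightarrow> 'm) \<Rightarrow> nat set \<Rightarrow> 'm"
  where "cech_numerator k x J = (\<Sum>j\<in>J. (cech_sign J j * cech_gen X j ^ k) *m x (J - {j}))"

definition cech_degree :: "nat set \<Rightarrow> 'p"
  where "cech_degree I = (\<Sum>j\<in>I. cls X (\<lambda>\<rho>. if ray X \<rho> \<subseteq> cone_list X ! j then 0 else 1))"

lemma cech_den_remove:
  assumes "finite J" "j \<in> J"
  shows "cech_den J = cech_gen X j * cech_den (J - {j})"
  unfolding cech_den_def using assms by (simp add: prod.remove)

lemma cech_index_finite: "J \<in> cech_index X i \<Longrightarrow> finite J"
  unfolding cech_index_def using finite_subset by auto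

lemma finite_cech_index: "finite (cech_index X i)"
  unfolding cech_index_def by (rule finite_subset[of _ "Pow {..<length (cone_list X)}"]) auto

lemma cech_index_empty:
  assumes "length (cone_list X) < i"
  shows "cech_index X i = {}"
proof -
  have "card I \<noteq> i" if "I \<subseteq> {..<length (cone_list X)}" for I
    using card_mono[OF _ that] assms by simp
  then show ?thesis by (simp add: cech_index_def)
qed

lemma cech_index_remove: "J \<in> cech_index X (Suc i) \<Longrightarrow> j \<in> J \<Longrightarrow> J - {j} \<in> cech_index X i"
  unfolding cech_index_def using finite_subset[of J "{..<length (cone_list X)}"] by auto

lemma cech_den_in_cox_part: "finite I \<Longrightarrow> cech_den I \<in> cox_part X (cech_degree I)"
  unfolding cech_den_def cech_degree_def cech_gen_def by (intro cox_part_prod xhat_in_cox_part)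

lemma cox_var_nonzero: "(cox_var \<rho> :: ('r, 'k) cox) \<noteq> 0"
  by (metis cox_var_def lookup_single_eq lookup_zero zero_neq_one)

lemma cech_den_nonzero: "cech_den I \<noteq> 0"
proof -
  have "xhat X \<sigma> \<noteq> (0 :: ('r, 'k) cox)" for \<sigma>
    unfolding xhat_def by (simp add: cox_var_nonzero)
  then show ?thesis
    unfolding cech_den_def cech_gen_def by (cases "finite I") auto
qed

text \<open>The definite description in \<open>cech_diff\<close> is single-valued: two presentations
  of the faces agree after multiplication by a power of each \<open>cech_den (J - {j})\<close>; as
  these divide \<open>cech_den J\<close>, a power of the latter identifies the alternating
  sums.\<close>

lemma cech_diff_eq:
  assumes J: "J \<in> cech_index X (Suc i)"
    and c: "\<And>I. I \<in> cech_index X i \<Longrightarrow> c I = frac M (cech_den I) (x I) k"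
  shows "cech_diff X M i c J = frac M (cech_den J) (cech_numerator k x J) k"
proof -
  have fin: "finite J" using J by (rule cech_index_finite)
  let ?P = "\<lambda>z x' k'. (\<forall>j\<in>J. c (J - {j}) = frac M (\<Prod>l\<in>J - {j}. cech_gen X l) (x' j) k') \<and>
      z = frac M (\<Prod>l\<in>J. cech_gen X l)
            (\<Sum>j\<in>J. (cech_sign J j * cech_gen X j ^ k') *m x' j) k'"
  have unique: "z = frac M (cech_den J) (cech_numerator k x J) k" if P: "?P z x' k'" for z x' k'
  proof -
    have "\<exists>t. cech_den (J - {j}) ^ (t + k') *m x (J - {j}) = cech_den (J - {j}) ^ (t + k) *m x' j"
      if "j \<in> J" for j
      using P that c[OF cech_index_remove[OF J that]] by (simp add: frac_eq_iff[symmetric] cech_den_def)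
    then obtain t where t: "\<And>j. j \<in> J \<Longrightarrow>
        cech_den (J - {j}) ^ (t j + k') *m x (J - {j}) = cech_den (J - {j}) ^ (t j + k) *m x' j"
      by metis
    \<comment> \<open>One exponent that serves all faces; a sum of naturals bounds each
      summand.\<close>
    define T where "T = sum t J"
    have T: "cech_den (J - {j}) ^ (T + k') *m x (J - {j}) = cech_den (J - {j}) ^ (T + k) *m x' j"
      if "j \<in> J" for j
    proof -
      have "t j \<le> T" unfolding T_def using fin that by (simp add: member_le_sum)
      then obtain r where "T = t j + r" using le_Suc_ex by blast
      then have *: "T + n = r + (t j + n)" for n by simp
      show ?thesis
        unfolding * using arg_cong[OF t[OF that], of "\<lambda>y. cech_den (J - {j}) ^ r *m y"]
        by (simp add: power_add)
    qed
    have "cech_den J ^ (T + k') *m cech_numerator k x J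
        = (\<Sum>j\<in>J. (cech_sign J j * cech_gen X j ^ (T + k' + k)) *m (cech_den (J - {j}) ^ (T + k') *m x (J - {j})))"
      unfolding cech_numerator_def scale_sum_right
      by (intro sum.cong refl) (simp add: cech_den_remove[OF fin] power_mult_distrib power_add algebra_simps)
    also have "\<dots> = (\<Sum>j\<in>J. (cech_sign J j * cech_gen X j ^ (T + k' + k)) *m (cech_den (J - {j}) ^ (T + k) *m x' j))"
      using T by (intro sum.cong refl) simp
    also have "\<dots> = cech_den J ^ (T + k) *m (\<Sum>j\<in>J. (cech_sign J j * cech_gen X j ^ k') *m x' j)"
      unfolding scale_sum_right
      by (intro sum.cong refl) (simp add: cech_den_remove[OF fin] power_mult_distrib power_add algebra_simps)
    finally have "frac M (cech_den J) (cech_numerator k x J) k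
        = frac M (cech_den J) (\<Sum>j\<in>J. (cech_sign J j * cech_gen X j ^ k') *m x' j) k'"
      unfolding frac_eq_iff by blast
    then show ?thesis using P by (simp add: cech_den_def)
  qed
  have "?P (frac M (cech_den J) (cech_numerator k x J) k) (\<lambda>j. x (J - {j})) k"
    using c[OF cech_index_remove[OF J]] by (simp add: cech_den_def cech_numerator_def)
  then have "(THE z. \<exists>x' k'. ?P z x' k') = frac M (cech_den J) (cech_numerator k x J) k"
    using unique by (intro the_equality) (rule exI, rule exI, assumption, elim exE)
  then show ?thesis unfolding cech_diff_def using J by simp
qed

lemma cech_numerator_raise:
  assumes "finite J"
  shows "cech_numerator (k + r) (\<lambda>I. cech_den I ^ r *m x I) J = cech_den J ^ r *m cech_numerator k x J"
  unfolding cech_numerator_def scale_sum_right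
  by (intro sum.cong refl) (simp add: cech_den_remove[OF assms] power_mult_distrib power_add algebra_simps)

lemma frac_zero_exponent: "frac M f 0 k = frac M f 0 l"
  unfolding frac_eq_iff by simp

lemma cocycle_mem:
  assumes x: "\<And>I. I \<in> cech_index X i \<Longrightarrow> x I \<in> part M (b + nmul k (cech_degree I))"
    and cyc: "\<And>J. J \<in> cech_index X (Suc i) \<Longrightarrow> cech_numerator k x J = 0"
  shows "(\<lambda>I\<in>cech_index X i. frac M (cech_den I) (x I) k) \<in> cech_cocycles X M i b" (is "?c \<in> _")
proof -
  have "?c \<in> cech_cochains X M i b"
    unfolding cech_cochains_def frac_part_def cech_den_def[symmetric]
    using x cech_den_in_cox_part cox_part_power cech_index_finite by (auto simp: PiE_def) blast
  moreover have "cech_diff X M i ?c = cech_zero X M (Suc i)"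
  proof (rule extensionalityI[where A = "cech_index X (Suc i)"])
    fix J assume J: "J \<in> cech_index X (Suc i)"
    have "cech_diff X M i ?c J = frac M (cech_den J) (cech_numerator k x J) k"
      by (rule cech_diff_eq[OF J]) simp
    also have "\<dots> = cech_zero X M (Suc i) J"
      using J cyc[OF J] by (simp add: cech_zero_def cech_den_def frac_zero_exponent[of _ k 0])
    finally show "cech_diff X M i ?c J = cech_zero X M (Suc i) J" .
  qed (simp_all add: cech_diff_def cech_zero_def)
  ultimately show ?thesis by (simp add: cech_cocycles_def)
qed

text \<open>The only index of size 0 is the empty set, with denominator 1. So an element killed by a
  power of every generator of the irrelevant ideal is a cocycle, and to be a coboundary it must be
  0.\<close>

lemma cohomology_vanishes_0:
  assumes van: "local_cohomology_vanishes X M 0 b"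
    and x: "x \<in> part M b"
    and cyc: "\<And>j. j < length (cone_list X) \<Longrightarrow> cech_gen X j ^ k *m x = 0"
  shows "x = 0"
proof -
  have ix: "cech_index X 0 = {{}}" unfolding cech_index_def by (auto simp: finite_subset)
  let ?c = "\<lambda>I\<in>cech_index X 0. frac M (cech_den I) x k"
  have "?c \<in> cech_cocycles X M 0 b"
  proof (rule cocycle_mem)
    fix J assume J: "J \<in> cech_index X (Suc 0)"
    then obtain j where "J = {j}" "j < length (cone_list X)"
      unfolding cech_index_def by (auto simp: card_1_singleton_iff)
    then show "cech_numerator k (\<lambda>I. x) J = 0"
      using cyc[of j] by (simp add: cech_numerator_def flip: scale_scale)
  qed (use x ix in \<open>auto simp: cech_degree_def\<close>)
  then have "?c = cech_zero X M 0"
    using van unfolding local_cohomology_vanishes_def cech_coboundaries_def by auto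
  from fun_cong[OF this, of "{}"] have "frac M 1 x k = frac M 1 0 0"
    by (simp add: ix cech_zero_def cech_den_def)
  then show ?thesis unfolding frac_eq_iff by simp
qed

text \<open>The primitive comes with an exponent of its own, and its differential equals the cocycle
  only up to a power of the denominator. Both are absorbed into \<open>N\<close>, which leaves an
  exact equation in \<open>M\<close>.\<close>

lemma cohomology_vanishes_Suc:
  assumes van: "local_cohomology_vanishes X M (Suc i) b"
    and x: "\<And>I. I \<in> cech_index X (Suc i) \<Longrightarrow> x I \<in> part M (b + nmul k (cech_degree I))"
    and cyc: "\<And>J. J \<in> cech_index X (Suc (Suc i)) \<Longrightarrow> cech_numerator k x J = 0"
  shows "\<exists>N y. (\<forall>I\<in>cech_index X (Suc i). cech_den I ^ N *m x I = cech_numerator (k + N) y I) \<and>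
    (\<forall>I\<in>cech_index X i. y I \<in> part M (b + nmul (k + N) (cech_degree I)))"
proof -
  let ?c = "\<lambda>I\<in>cech_index X (Suc i). frac M (cech_den I) (x I) k"
  have "?c \<in> cech_cocycles X M (Suc i) b" by (rule cocycle_mem[OF x cyc])
  then obtain c' where c': "c' \<in> cech_cochains X M i b" "?c = cech_diff X M i c'"
    using van unfolding local_cohomology_vanishes_def cech_coboundaries_def by auto
  have "\<exists>l y. \<forall>I\<in>cech_index X i. c' I = frac M (cech_den I) (y I) l \<and> y I \<in> part M (b + nmul l (cech_degree I))"
    using c'(1) by (intro frac_common_exponent finite_cech_index cech_den_in_cox_part cech_den_nonzero)
      (auto simp: cech_cochains_def cech_den_def dest: cech_index_finite)
  then obtain l y where y: "\<And>I. I \<in> cech_index X i \<Longrightarrow> c' I = frac M (cech_den I) (y I) l"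
      "\<And>I. I \<in> cech_index X i \<Longrightarrow> y I \<in> part M (b + nmul l (cech_degree I))" by blast
  have "\<exists>t. cech_den J ^ (t + l) *m x J = cech_den J ^ (t + k) *m cech_numerator l y J"
    if J: "J \<in> cech_index X (Suc i)" for J
    using fun_cong[OF c'(2), of J] cech_diff_eq[OF J y(1)] J by (simp add: frac_eq_iff)
  then obtain t where t: "\<And>J. J \<in> cech_index X (Suc i) \<Longrightarrow>
      cech_den J ^ (t J + l) *m x J = cech_den J ^ (t J + k) *m cech_numerator l y J" by metis
  define T where "T = sum t (cech_index X (Suc i))"
  \<comment> \<open>Expansion by \<open>T + k\<close> brings the exponent \<open>l\<close> of
    \<open>y\<close> to \<open>k + (T + l)\<close>, the value \<open>k + N\<close> of the
    conclusion.\<close>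
  define y' where "y' = (\<lambda>I. cech_den I ^ (T + k) *m y I)"
  show ?thesis
  proof (intro exI[of _ "T + l"] exI[of _ y'] conjI ballI)
    fix J assume J: "J \<in> cech_index X (Suc i)"
    have fin: "finite J" using J by (rule cech_index_finite)
    have "t J \<le> T" unfolding T_def using J by (simp add: member_le_sum finite_cech_index)
    then obtain r where "T = t J + r" using le_Suc_ex by blast
    then have *: "T + n = r + (t J + n)" for n by simp
    have "cech_den J ^ (T + l) *m x J = cech_den J ^ (T + k) *m cech_numerator l y J"
      unfolding * using arg_cong[OF t[OF J], of "\<lambda>y. cech_den J ^ r *m y"]
      by (simp add: power_add)
    also have "\<dots> = cech_numerator (k + (T + l)) y' J"
      unfolding cech_numerator_def scale_sum_right y'_def
      by (intro sum.cong refl) (simp add: cech_den_remove[OF fin] power_mult_distrib power_add algebra_simps)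
    finally show "cech_den J ^ (T + l) *m x J = cech_numerator (k + (T + l)) y' J" .
  next
    fix I assume I: "I \<in> cech_index X i"
    have "y' I \<in> part M (nmul (T + k) (cech_degree I) + (b + nmul l (cech_degree I)))"
      unfolding y'_def by (intro part_act cox_part_power cech_den_in_cox_part cech_index_finite[OF I] y I)
    also have "nmul (T + k) (cech_degree I) + (b + nmul l (cech_degree I)) = b + nmul (k + (T + l)) (cech_degree I)"
      by (simp add: nmul_add algebra_simps)
    finally show "y' I \<in> part M (b + nmul (k + (T + l)) (cech_degree I))" .
  qed
qed

end

text \<open>
  The section \<open>m j\<close> of \<open>c\<close> vanishes nowhere on the chart \<open>j\<close>, which is the equation \<open>m_m'\<close>.
\<close>

locale koszul_cech = cox_module X M
  for X :: "('n::finite, 'r::{finite,linorder}, 'p::ab_group_add) toric"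
    and M :: "('r, 'k::field, 'p, 'm::ab_group_add) gmodule" +
  fixes m m' :: "nat \<Rightarrow> ('r, 'k) cox" and N\<^sub>0 :: nat and c d :: 'p and z :: 'm
  assumes m: "j < length (cone_list X) \<Longrightarrow> m j \<in> cox_part X c"
    and m': "j < length (cone_list X) \<Longrightarrow> m' j \<in> cox_part X (nmul N\<^sub>0 (cech_degree {j}) - c)"
    and m_m': "j < length (cone_list X) \<Longrightarrow> m j * m' j = cech_gen X j ^ N\<^sub>0"
    and z: "z \<in> part M (d + c)"
    and vanishing_Suc: "local_cohomology_vanishes X M (Suc q) (d - nmul q c)"
    and vanishing_0: "local_cohomology_vanishes X M 0 (d + c)"
begin

text \<open>The Koszul boundary of the sequence of sections \<open>m j\<close>, from families on
  subsets of size \<open>q + 1\<close> to families on subsets of size \<open>q\<close>; it raises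
  the degree by \<open>c\<close>.\<close>

definition koszul :: "(nat set \<Rightarrow> 'm) \<Rightarrow> nat set \<Rightarrow> 'm"
  where "koszul u B = (\<Sum>j\<in>{..<length (cone_list X)} - B. (cech_sign B j * m j) *m u (insert j B))"

text \<open>The numerators, for the exponent \<open>k\<close>, of the Koszul cochain \<open>z / m\<^sub>I \<cdot> e\<^sub>I\<close>.\<close>

definition kernel_cochain :: "nat \<Rightarrow> nat set \<Rightarrow> nat set \<Rightarrow> 'm"
  where "kernel_cochain k I A =
    (if I = A then (cech_den I ^ (k - N\<^sub>0) * (\<Prod>j\<in>I. m' j)) *m z else 0)"

lemma cech_index_insert:
  assumes "A \<in> cech_index X q" "j \<in> {..<length (cone_list X)} - A"
  shows "insert j A \<in> cech_index X (Suc q)"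
  using assms cech_index_finite[OF assms(1)] unfolding cech_index_def by auto

lemma koszul_scale: "koszul (\<lambda>A. p *m u A) B = p *m koszul u B"
  unfolding koszul_def scale_sum_right by (intro sum.cong refl) (simp add: mult_ac)

lemma koszul_diff: "koszul (\<lambda>A. u A - v A) B = koszul u B - koszul v B"
  unfolding koszul_def by (simp add: scale_right_diff_distrib sum_subtractf)

lemma cech_numerator_diff:
  "cech_numerator k (\<lambda>I. x I - y I) J = cech_numerator k x J - cech_numerator k y J"
  unfolding cech_numerator_def by (simp add: scale_right_diff_distrib sum_subtractf)

text \<open>Adding \<open>j\<close> and \<open>l\<close> to \<open>B\<close> in the two orders gives
  the same term with opposite signs: the smaller index is counted before the larger one in exactly
  one of the orders.\<close>

lemma koszul_koszul:
  assumes B: "finite B"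
  shows "koszul (koszul u) B = 0"
proof -
  let ?S = "{..<length (cone_list X)} - B"
  define T where "T j l = (cech_sign B j * m j * (cech_sign (insert j B) l * m l)) *m u (insert l (insert j B))" for j l
  have count: "card {i \<in> insert j B. i < l} = (if j < l then Suc (card {i \<in> B. i < l}) else card {i \<in> B. i < l})"
    if "j \<notin> B" for j l
  proof -
    have "{i \<in> insert j B. i < l} = (if j < l then insert j {i \<in> B. i < l} else {i \<in> B. i < l})" by auto
    then show ?thesis using that B by auto
  qed
  have anti: "T l j = - T j l" if "j \<in> ?S" "l \<in> ?S" "j < l" for j l
  proof -
    have "\<not> l < j" "l \<notin> B" "j \<notin> B" using that by auto
    then have sgn: "cech_sign (insert l B) j = cech_sign B j" "cech_sign (insert j B) l = - cech_sign B l"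
      using that by (simp_all only: count if_True if_False power_Suc mult_minus_left mult_1_left simp_thms)
    have "insert l (insert j B) = insert j (insert l B)" by auto
    then show ?thesis
      unfolding T_def sgn by (simp add: mult_ac flip: scale_minus_left)
  qed
  have "koszul (koszul u) B = (\<Sum>j\<in>?S. \<Sum>l\<in>?S - {j}. T j l)"
    unfolding koszul_def[of "koszul u"] koszul_def[of u] scale_sum_right T_def
    by (intro sum.cong refl) auto
  also have "\<dots> = (\<Sum>j\<in>?S. (\<Sum>l\<in>{l\<in>?S. j < l}. T j l) + (\<Sum>l\<in>{l\<in>?S. l < j}. T j l))"
  proof (intro sum.cong refl)
    fix j assume "j \<in> ?S"
    have eq: "?S - {j} = {l\<in>?S. j < l} \<union> {l\<in>?S. l < j}" by auto
    show "(\<Sum>l\<in>?S - {j}. T j l) = (\<Sum>l\<in>{l\<in>?S. j < l}. T j l) + (\<Sum>l\<in>{l\<in>?S. l < j}. T j l)"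
      unfolding eq by (rule sum.union_disjoint) auto
  qed
  also have "\<dots> = (\<Sum>j\<in>?S. \<Sum>l\<in>{l\<in>?S. j < l}. T j l) + (\<Sum>j\<in>?S. \<Sum>l\<in>{l\<in>?S. l < j}. T j l)"
    by (rule sum.distrib)
  also have "(\<Sum>j\<in>?S. \<Sum>l\<in>{l\<in>?S. l < j}. T j l) = (\<Sum>l\<in>?S. \<Sum>j\<in>{j\<in>?S. l < j}. T j l)"
    by (rule sum.swap_restrict) auto
  also have "\<dots> = (\<Sum>l\<in>?S. \<Sum>j\<in>{j\<in>?S. l < j}. - T l j)"
    using anti by (intro sum.cong refl) auto
  finally show ?thesis by (simp add: sum_negf)
qed

text \<open>In the double family \<open>v I A\<close> the Cech differential acts on \<open>I\<close>
  and the Koszul boundary on \<open>A\<close>, so they commute without a sign.\<close>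

lemma cech_koszul_commute:
  "cech_numerator k (\<lambda>I. koszul (v I) A) J = koszul (\<lambda>A'. cech_numerator k (\<lambda>I. v I A') J) A"
  unfolding cech_numerator_def koszul_def scale_sum_right
  by (subst sum.swap) (intro sum.cong refl, simp add: mult_ac)

lemma kernel_cochain_raise:
  assumes "N\<^sub>0 \<le> k"
  shows "kernel_cochain (k + r) I A = cech_den I ^ r *m kernel_cochain k I A"
proof -
  have "k + r - N\<^sub>0 = r + (k - N\<^sub>0)" using assms by simp
  then show ?thesis by (simp add: kernel_cochain_def power_add mult_ac)
qed

text \<open>Both sides vanish unless \<open>J\<close> is \<open>A\<close> with one index
  \<open>j\<close> added. Then the claim is \<open>z / m_A = m_j (z / m_J)\<close> with cleared
  denominators, where \<open>m_m'\<close> trades a power of the chart equation for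
  \<open>m j * m' j\<close>.\<close>

lemma cech_kernel_cochain:
  assumes k: "N\<^sub>0 \<le> k" and J: "J \<in> cech_index X (Suc q)" and A: "A \<in> cech_index X q"
  shows "cech_numerator k (\<lambda>I. kernel_cochain k I A) J = koszul (kernel_cochain k J) A"
proof -
  have fin: "finite J" "finite A" using J A cech_index_finite by auto
  have sub: "J \<subseteq> {..<length (cone_list X)}" "card J = Suc q" "card A = q"
    using J A by (auto simp: cech_index_def)
  show ?thesis
  proof (cases "A \<subseteq> J")
    case False
    then show ?thesis
      unfolding cech_numerator_def koszul_def kernel_cochain_def
      by (intro trans[OF sum.neutral sum.neutral[symmetric]]) auto
  next
    case True
    then have "card (J - A) = 1" using sub fin by (simp add: card_Diff_subset)
    then obtain j where j: "J - A = {j}" by (auto simp: card_1_singleton_iff)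
    then have J_eq: "J = insert j A" and jA: "j \<notin> A" using True by auto
    have jl: "j < length (cone_list X)" using sub J_eq by auto
    have "cech_numerator k (\<lambda>I. kernel_cochain k I A) J = (\<Sum>i\<in>{j}. (cech_sign J i * cech_gen X i ^ k) *m kernel_cochain k (J - {i}) A)"
      unfolding cech_numerator_def using fin J_eq jA
      by (intro sum.mono_neutral_right) (auto simp: kernel_cochain_def)
    also have "\<dots> = (cech_sign J j * cech_gen X j ^ k) *m kernel_cochain k A A"
      using J_eq jA by simp
    also have "cech_sign J j = cech_sign A j"
      unfolding J_eq by (rule arg_cong[where f = "\<lambda>S. (-1) ^ card S"]) auto
    also have "(cech_sign A j * cech_gen X j ^ k) *m kernel_cochain k A A = (cech_sign A j * m j) *m kernel_cochain k J J"
    proof -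
      have "cech_gen X j ^ k = cech_gen X j ^ (k - N\<^sub>0) * (m j * m' j)"
        unfolding m_m'[OF jl] power_add[symmetric] using k by simp
      moreover have "cech_den J = cech_gen X j * cech_den A"
        unfolding J_eq cech_den_def using fin jA by simp
      moreover have "(\<Prod>i\<in>J. m' i) = m' j * (\<Prod>i\<in>A. m' i)"
        unfolding J_eq using fin jA by simp
      ultimately show ?thesis
        unfolding kernel_cochain_def by (simp add: power_mult_distrib mult_ac)
    qed
    also have "\<dots> = (\<Sum>i\<in>{j}. (cech_sign A i * m i) *m kernel_cochain k J (insert i A))"
      using J_eq by simp
    also have "\<dots> = koszul (kernel_cochain k J) A"
      unfolding koszul_def using jl jA J_eq
      by (intro sum.mono_neutral_left) (auto simp: kernel_cochain_def)
    finally show ?thesis .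
  qed
qed

text \<open>Dividing by the \<open>q\<close> sections \<open>m j\<close> lowers the degree by
  \<open>q\<close> times \<open>c\<close>; the remaining summand is the degree of the
  denominator.\<close>

lemma kernel_cochain_part:
  assumes k: "N\<^sub>0 \<le> k" and I: "I \<in> cech_index X q"
  shows "kernel_cochain k I A \<in> part M (d + c - nmul q c + nmul k (cech_degree I))"
proof (cases "I = A")
  case True
  have fin: "finite I" using I by (rule cech_index_finite)
  have sub: "I \<subseteq> {..<length (cone_list X)}" "card I = q" using I by (auto simp: cech_index_def)
  have "(\<Prod>j\<in>I. m' j) \<in> cox_part X (\<Sum>j\<in>I. nmul N\<^sub>0 (cech_degree {j}) - c)"
    using fin sub by (intro cox_part_prod m') auto
  also have "(\<Sum>j\<in>I. nmul N\<^sub>0 (cech_degree {j}) - c) = nmul N\<^sub>0 (cech_degree I) - nmul q c"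
  proof -
    have "(\<Sum>j\<in>I. c) = nmul (card I) c"
      using fin by (induction I rule: finite_induct) (simp_all add: add.commute)
    moreover have "(\<Sum>j\<in>I. nmul N\<^sub>0 (cech_degree {j})) = nmul N\<^sub>0 (cech_degree I)"
      unfolding nmul_def cech_degree_def by (subst sum.swap) simp
    ultimately show ?thesis using sub by (simp add: sum_subtractf)
  qed
  finally have "(cech_den I ^ (k - N\<^sub>0) * (\<Prod>j\<in>I. m' j)) *m z
      \<in> part M (nmul (k - N\<^sub>0) (cech_degree I) + (nmul N\<^sub>0 (cech_degree I) - nmul q c) + (d + c))"
    using fin z by (intro part_act cox_part_mult cox_part_power cech_den_in_cox_part)
  also have "nmul (k - N\<^sub>0) (cech_degree I) + (nmul N\<^sub>0 (cech_degree I) - nmul q c) + (d + c)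
      = d + c - nmul q c + nmul k (cech_degree I)"
    using nmul_add[of "k - N\<^sub>0" N\<^sub>0 "cech_degree I"] k by (simp add: algebra_simps)
  finally show ?thesis using True by (simp add: kernel_cochain_def)
qed (simp add: kernel_cochain_def)

lemma koszul_part:
  assumes "B \<in> cech_index X q" "\<And>A. A \<in> cech_index X (Suc q) \<Longrightarrow> u A \<in> part M a"
  shows "koszul u B \<in> part M (c + a)"
  unfolding koszul_def
proof (intro part_sum part_act)
  fix j assume "j \<in> {..<length (cone_list X)} - B"
  then show "cech_sign B j * m j \<in> cox_part X c" "u (insert j B) \<in> part M a"
    using cox_part_mult[OF cox_part_sign m, of j] assms(2)[OF cech_index_insert[OF assms(1)]] by auto
qed

text \<open>
  Descending induction on \<open>q\<close>: correcting the cochain \<open>z / m\<^sub>I \<cdot> e\<^sub>I\<close> by a Koszul boundary makes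
  it a Cech cocycle, which by the vanishing of the local cohomology is a Cech coboundary; its
  primitive is the correction needed in degree \<open>q - 1\<close>.
\<close>

lemma corrected_cocycle:
  assumes "q \<le> Suc (length (cone_list X))"
  shows "\<exists>k\<ge>N\<^sub>0. \<exists>v.
    (\<forall>I\<in>cech_index X q. \<forall>A\<in>cech_index X (Suc q). v I A \<in> part M (d - nmul q c + nmul k (cech_degree I))) \<and>
    (\<forall>J\<in>cech_index X (Suc q). \<forall>A\<in>cech_index X q.
      cech_numerator k (\<lambda>I. kernel_cochain k I A - koszul (v I) A) J = 0)"
  using assms
proof (induction rule: inc_induct)
  case base
  have "cech_index X (Suc (length (cone_list X))) = {}" "cech_index X (Suc (Suc (length (cone_list X)))) = {}"
    by (simp_all add: cech_index_empty)
  then show ?case by auto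
next
  case (step q)
  from step.IH obtain k v where k: "N\<^sub>0 \<le> k"
    and v: "\<forall>I\<in>cech_index X (Suc q). \<forall>A\<in>cech_index X (Suc (Suc q)).
        v I A \<in> part M (d - nmul (Suc q) c + nmul k (cech_degree I))"
    and cyc: "\<forall>J\<in>cech_index X (Suc (Suc q)). \<forall>A\<in>cech_index X (Suc q).
      cech_numerator k (\<lambda>I. kernel_cochain k I A - koszul (v I) A) J = 0"
    by (elim exE conjE)
  \<comment> \<open>The Koszul boundary raises the degree by \<open>c\<close> and so cancels one of
    the \<open>Suc q\<close> copies of \<open>c\<close> subtracted in the degree of
    \<open>v\<close>. Thus \<open>u\<close> lies in the degree \<open>d - nmul q c\<close>, in which
    \<open>vanishing_Suc\<close> applies to Cech cocycles of size \<open>Suc q\<close>.\<close>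
  define u where "u I A = kernel_cochain k I A - koszul (v I) A" for I A
  have u: "u I A \<in> part M (d - nmul q c + nmul k (cech_degree I))"
    if "I \<in> cech_index X (Suc q)" "A \<in> cech_index X (Suc q)" for I A
  proof -
    have "koszul (v I) A \<in> part M (c + (d - nmul (Suc q) c + nmul k (cech_degree I)))"
      by (rule koszul_part[OF that(2)]) (use v that in blast)
    then show ?thesis
      unfolding u_def using kernel_cochain_part[OF k that(1), of A]
      by (intro part_diff) (auto simp: algebra_simps)
  qed
  have "\<exists>N y. (\<forall>I\<in>cech_index X (Suc q). cech_den I ^ N *m u I A = cech_numerator (k + N) y I) \<and>
      (\<forall>I\<in>cech_index X q. y I \<in> part M (d - nmul q c + nmul (k + N) (cech_degree I)))"
    if "A \<in> cech_index X (Suc q)" for A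
    using cyc that u by (intro cohomology_vanishes_Suc vanishing_Suc) (auto simp: u_def)
  then obtain N y where
    Ny: "\<And>A I. A \<in> cech_index X (Suc q) \<Longrightarrow> I \<in> cech_index X (Suc q) \<Longrightarrow>
        cech_den I ^ N A *m u I A = cech_numerator (k + N A) (y A) I"
    and y: "\<And>A I. A \<in> cech_index X (Suc q) \<Longrightarrow> I \<in> cech_index X q \<Longrightarrow>
        y A I \<in> part M (d - nmul q c + nmul (k + N A) (cech_degree I))"
    by metis
  \<comment> \<open>The primitives for the various \<open>A\<close> have different exponents;
    \<open>L\<close> bounds them all and \<open>w\<close> expands each to
    \<open>k + L\<close>.\<close>
  define L where "L = sum N (cech_index X (Suc q))"
  have L: "N A \<le> L" if "A \<in> cech_index X (Suc q)" for A
    unfolding L_def using that by (simp add: member_le_sum finite_cech_index)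
  define w where "w I A = cech_den I ^ (L - N A) *m y A I" for I A
  have Lw: "cech_den J ^ L *m u J A = cech_numerator (k + L) (\<lambda>I. w I A) J"
    if "A \<in> cech_index X (Suc q)" "J \<in> cech_index X (Suc q)" for A J
  proof -
    have "cech_numerator (k + L) (\<lambda>I. w I A) J = cech_numerator (k + N A + (L - N A)) (\<lambda>I. w I A) J"
      using L[OF that(1)] by simp
    also have "\<dots> = cech_den J ^ (L - N A) *m cech_numerator (k + N A) (y A) J"
      unfolding w_def using cech_index_finite[OF that(2)] by (rule cech_numerator_raise)
    also have "\<dots> = cech_den J ^ L *m u J A"
      unfolding Ny[OF that, symmetric] using L[OF that(1)] by (simp flip: power_add)
    finally show ?thesis by simp
  qed
  show ?case
  proof (intro exI[of _ "k + L"] exI[of _ w] conjI ballI)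
    show "N\<^sub>0 \<le> k + L" using k by simp
  next
    fix I A assume IA: "I \<in> cech_index X q" "A \<in> cech_index X (Suc q)"
    have "w I A \<in> part M (nmul (L - N A) (cech_degree I) + (d - nmul q c + nmul (k + N A) (cech_degree I)))"
      unfolding w_def using IA by (intro part_act cox_part_power cech_den_in_cox_part cech_index_finite[of I] y)
    also have "nmul (L - N A) (cech_degree I) + (d - nmul q c + nmul (k + N A) (cech_degree I))
        = d - nmul q c + nmul (k + L) (cech_degree I)"
      using nmul_add[of "L - N A" "N A" "cech_degree I"] L[OF IA(2)] by (simp add: nmul_add algebra_simps)
    finally show "w I A \<in> part M (d - nmul q c + nmul (k + L) (cech_degree I))" .
  next
    fix J A assume JA: "J \<in> cech_index X (Suc q)" "A \<in> cech_index X q"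
    \<comment> \<open>The Cech differential of \<open>w\<close> is \<open>u\<close>, up to the power
      of the denominator. Taking the Koszul boundary kills the correction
      \<open>koszul (v J)\<close> in \<open>u\<close>, and what remains is the value demanded by
      \<open>cech_kernel_cochain\<close>.\<close>
    have "cech_numerator (k + L) (\<lambda>I. koszul (w I) A) J = koszul (\<lambda>A'. cech_numerator (k + L) (\<lambda>I. w I A') J) A"
      by (rule cech_koszul_commute)
    also have "\<dots> = koszul (\<lambda>A'. cech_den J ^ L *m u J A') A"
      unfolding koszul_def using Lw[OF _ JA(1)] cech_index_insert[OF JA(2)] by (intro sum.cong refl) auto
    also have "\<dots> = cech_den J ^ L *m (koszul (kernel_cochain k J) A - koszul (koszul (v J)) A)"
      unfolding u_def by (simp only: koszul_scale koszul_diff)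
    also have "\<dots> = koszul (kernel_cochain (k + L) J) A"
      unfolding koszul_koszul[OF cech_index_finite[OF JA(2)]] kernel_cochain_raise[OF k, abs_def]
      by (simp add: koszul_scale)
    finally show "cech_numerator (k + L) (\<lambda>I. kernel_cochain (k + L) I A - koszul (w I) A) J = 0"
      using k cech_kernel_cochain[OF _ JA, of "k + L"] by (simp add: cech_numerator_diff)
  qed
qed

text \<open>For \<open>q = 0\<close> both indices are empty and the kernel cochain is
  \<open>z\<close> itself. The corrected cocycle is then \<open>z\<close> minus a combination of the
  \<open>m j\<close>, killed by powers of all chart equations, so it is 0 by the vanishing in degree
  \<open>d + c\<close>. The coefficients are the components of \<open>v\<close> at
  singletons.\<close>

lemma decomposition: "\<exists>y. (\<forall>j<length (cone_list X). y j \<in> part M d) \<and> z = (\<Sum>j<length (cone_list X). m j *m y j)"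
proof -
  obtain k v where k: "N\<^sub>0 \<le> k"
    and v: "\<And>I A. I \<in> cech_index X 0 \<Longrightarrow> A \<in> cech_index X (Suc 0) \<Longrightarrow>
        v I A \<in> part M (d - nmul 0 c + nmul k (cech_degree I))"
    and cyc: "\<And>J A. J \<in> cech_index X (Suc 0) \<Longrightarrow> A \<in> cech_index X 0 \<Longrightarrow>
      cech_numerator k (\<lambda>I. kernel_cochain k I A - koszul (v I) A) J = 0"
    using corrected_cocycle[OF le0] by blast
  have ix: "{} \<in> cech_index X 0" by (simp add: cech_index_def)
  have ix1: "{j} \<in> cech_index X (Suc 0)" if "j < length (cone_list X)" for j
    using that by (simp add: cech_index_def)
  let ?y = "\<lambda>j. v {} {j}"
  have y: "?y j \<in> part M d" if "j < length (cone_list X)" for j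
    using v[OF ix ix1[OF that]] by (simp add: cech_degree_def)
  have zero: "z - (\<Sum>j<length (cone_list X). m j *m ?y j) = 0"
  proof (rule cohomology_vanishes_0[OF vanishing_0, where k = k])
    show "z - (\<Sum>j<length (cone_list X). m j *m ?y j) \<in> part M (d + c)"
      using m y z by (intro part_diff part_sum) (auto simp: add.commute[of d] intro!: part_act)
  next
    fix j assume j: "j < length (cone_list X)"
    have empty: "{l. l = j \<and> l < j} = {}" by auto
    have "0 = cech_numerator k (\<lambda>I. kernel_cochain k I {} - koszul (v I) {}) {j}"
      using cyc[OF ix1[OF j] ix] by simp
    also have "\<dots> = cech_gen X j ^ k *m (z - (\<Sum>j<length (cone_list X). m j *m ?y j))"
      by (simp add: empty cech_numerator_def kernel_cochain_def koszul_def cech_den_def flip: scale_scale)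
    finally show "cech_gen X j ^ k *m (z - (\<Sum>j<length (cone_list X). m j *m ?y j)) = 0" by simp
  qed
  then show ?thesis using y by (intro exI[of _ ?y]) simp
qed

end

section \<open>Dickson's lemma and atoms of saturated monoids\<close>

text \<open>A decreasing sequence of naturals is constant from the place where its minimum is
  attained, hence nondecreasing after a shift.\<close>

lemma nat_mono_subsequence:
  fixes s :: "nat \<Rightarrow> nat"
  obtains r :: "nat \<Rightarrow> nat" where "strict_mono r" "mono (\<lambda>n. s (r n))"
proof -
  obtain f where f: "strict_mono f" "monoseq (\<lambda>n. s (f n))"
    using seq_monosub[of s] by blast
  show thesis
  proof (cases "incseq (\<lambda>n. s (f n))")
    case True
    then show thesis using f that by blast
  next
    case False
    then have dec: "decseq (\<lambda>n. s (f n))" using f(2) monoseq_iff by blast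
    obtain m where m: "\<And>n. s (f m) \<le> s (f n)"
      using ex_has_least_nat[of "\<lambda>_. True" 0 "\<lambda>n. s (f n)"] by auto
    have "s (f (n + m)) = s (f m)" for n
      using m[of "n + m"] decseqD[OF dec, of m "n + m"] by simp
    moreover have "strict_mono (\<lambda>n. f (n + m))"
      using f(1) by (simp add: strict_mono_def)
    ultimately show thesis by (intro that[of "\<lambda>n. f (n + m)"]) (simp_all add: mono_def)
  qed
qed

text \<open>Coordinates are treated one at a time: passing to a further subsequence keeps those
  already monotone.\<close>

lemma dickson_subsequence:
  fixes s :: "nat \<Rightarrow> 'i \<Rightarrow> nat"
  assumes "finite I"
  shows "\<exists>r :: nat \<Rightarrow> nat. strict_mono r \<and> (\<forall>i\<in>I. mono (\<lambda>n. s (r n) i))"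
  using assms
proof (induction I rule: finite_induct)
  case empty
  show ?case by (rule exI[of _ "\<lambda>n. n"]) (simp add: strict_mono_def)
next
  case (insert j I)
  then obtain r :: "nat \<Rightarrow> nat" where r: "strict_mono r" "\<forall>i\<in>I. mono (\<lambda>n. s (r n) i)" by blast
  obtain q :: "nat \<Rightarrow> nat" where q: "strict_mono q" "mono (\<lambda>n. s (r (q n)) j)"
    by (rule nat_mono_subsequence[of "\<lambda>n. s (r n) j"])
  have "strict_mono (\<lambda>n. r (q n))"
    by (intro strict_monoI strict_monoD[OF r(1)] strict_monoD[OF q(1)])
  moreover have "mono (\<lambda>n. s (r (q n)) i)" if "i \<in> I" for i
  proof (rule monoI)
    fix m n :: nat assume "m \<le> n"
    then have "q m \<le> q n" by (simp add: strict_mono_less_eq[OF q(1)])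
    then show "s (r (q m)) i \<le> s (r (q n)) i" using r(2) that monoD by fast
  qed
  ultimately show ?case using q(2) by (intro exI[of _ "\<lambda>n. r (q n)"]) auto
qed

lemma finite_antichain:
  fixes \<phi> :: "'a \<Rightarrow> 'i \<Rightarrow> nat"
  assumes "finite I"
    and anti: "\<And>x y. x \<in> A \<Longrightarrow> y \<in> A \<Longrightarrow> (\<forall>i\<in>I. \<phi> x i \<le> \<phi> y i) \<Longrightarrow> x = y"
  shows "finite A"
proof (rule ccontr)
  assume "infinite A"
  then obtain f :: "nat \<Rightarrow> 'a" where f: "inj f" "range f \<subseteq> A"
    using infinite_countable_subset by blast
  obtain r :: "nat \<Rightarrow> nat" where r: "strict_mono r" "\<forall>i\<in>I. mono (\<lambda>n. \<phi> (f (r n)) i)"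
    using dickson_subsequence[OF \<open>finite I\<close>, of "\<lambda>n. \<phi> (f n)"] by blast
  have "f (r 0) = f (r 1)"
    using f(2) r(2) by (intro anti) (auto simp: mono_def)
  then have "r 0 = r 1" using f(1) by (simp add: inj_eq)
  moreover have "r 0 < r 1" using r(1) by (simp add: strict_mono_def)
  ultimately show False by simp
qed

lemma submonoid_generated_closed:
  "0 \<in> submonoid_generated G"
  "x \<in> submonoid_generated G \<Longrightarrow> y \<in> submonoid_generated G \<Longrightarrow> x + y \<in> submonoid_generated G"
  "x \<in> G \<Longrightarrow> x \<in> submonoid_generated G"
  unfolding submonoid_generated_def hull_def by blast+

lemma submonoid_generated_minimal:
  assumes "G \<subseteq> T" "0 \<in> T" "\<And>x y. x \<in> T \<Longrightarrow> y \<in> T \<Longrightarrow> x + y \<in> T"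
  shows "submonoid_generated G \<subseteq> T"
  unfolding submonoid_generated_def using assms by (intro hull_minimal) auto

text \<open>Integral functionals that separate points. Injectivity makes the monoid pointed: an
  element on which all of them vanish is 0, so their sum is a positive size on nonzero
  elements.\<close>

locale saturated_monoid =
  fixes \<phi> :: "'p::ab_group_add \<Rightarrow> 'i \<Rightarrow> int" and I :: "'i set"
  assumes fin: "finite I"
    and \<phi>_add: "\<phi> (a + b) i = \<phi> a i + \<phi> b i"
    and \<phi>_inj: "(\<And>i. i \<in> I \<Longrightarrow> \<phi> a i = 0) \<Longrightarrow> a = 0"
begin

definition monoid :: "'p set"
  where "monoid = {a. \<forall>i\<in>I. 0 \<le> \<phi> a i}"

text \<open>The Hilbert basis of the monoid.\<close>

definition atoms :: "'p set"
  where "atoms = {a \<in> monoid. a \<noteq> 0 \<and> (\<forall>b\<in>monoid. \<forall>c\<in>monoid. a = b + c \<longrightarrow> b = 0 \<or> c = 0)}"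

lemma \<phi>_zero: "\<phi> 0 i = 0"
  using \<phi>_add[of 0 0 i] by simp

lemma \<phi>_diff: "\<phi> (a - b) i = \<phi> a i - \<phi> b i"
  using \<phi>_add[of "a - b" b i] by simp

lemma monoid_zero: "0 \<in> monoid"
  and monoid_add: "a \<in> monoid \<Longrightarrow> b \<in> monoid \<Longrightarrow> a + b \<in> monoid"
  by (simp_all add: monoid_def \<phi>_zero \<phi>_add)

lemma finite_antichain_monoid:
  assumes "A \<subseteq> monoid" and "\<And>a b. a \<in> A \<Longrightarrow> b \<in> A \<Longrightarrow> b - a \<in> monoid \<Longrightarrow> a = b"
  shows "finite A"
proof (rule finite_antichain[OF fin])
  fix a b assume ab: "a \<in> A" "b \<in> A" "\<forall>i\<in>I. nat (\<phi> a i) \<le> nat (\<phi> b i)"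
  then have "b - a \<in> monoid"
    using assms(1) unfolding monoid_def by (force simp: \<phi>_diff nat_le_iff)
  then show "a = b" using assms(2) ab by blast
qed

lemma finite_atoms: "finite atoms"
proof (rule finite_antichain_monoid)
  fix a b assume ab: "a \<in> atoms" "b \<in> atoms" "b - a \<in> monoid"
  have "b = a + (b - a)" "a \<in> monoid" "a \<noteq> 0" using ab by (auto simp: atoms_def)
  then have "b - a = 0" using ab unfolding atoms_def by blast
  then show "a = b" by simp
qed (auto simp: atoms_def)

text \<open>The sum \<open>\<mu>\<close> of the functionals is additive and positive on nonzero
  elements, so splitting a non-atom into nonzero summands strictly decreases it.\<close>

lemma atoms_generate: "submonoid_generated atoms = monoid"
proof
  show "submonoid_generated atoms \<subseteq> monoid"
    by (rule submonoid_generated_minimal) (auto simp: atoms_def monoid_zero monoid_add)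
  define \<mu> where "\<mu> a = (\<Sum>i\<in>I. nat (\<phi> a i))" for a
  have \<mu>_add: "\<mu> (a + b) = \<mu> a + \<mu> b" if "a \<in> monoid" "b \<in> monoid" for a b
    unfolding \<mu>_def sum.distrib[symmetric] using that
    by (intro sum.cong) (auto simp: monoid_def \<phi>_add nat_add_distrib)
  have \<mu>_pos: "0 < \<mu> a" if "a \<in> monoid" "a \<noteq> 0" for a
  proof (rule ccontr)
    assume "\<not> 0 < \<mu> a"
    then have "\<forall>i\<in>I. nat (\<phi> a i) = 0" using fin by (simp add: \<mu>_def)
    then have "a = 0" using that(1) by (intro \<phi>_inj) (force simp: monoid_def)
    with that show False by simp
  qed
  have "a \<in> submonoid_generated atoms" if "a \<in> monoid" for a
    using that
  proof (induction "\<mu> a" arbitrary: a rule: less_induct)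
    case less
    show ?case
    proof (cases "a = 0 \<or> a \<in> atoms")
      case True
      then show ?thesis by (auto intro: submonoid_generated_closed)
    next
      case False
      then obtain b c where bc: "b \<in> monoid" "c \<in> monoid" "a = b + c" "b \<noteq> 0" "c \<noteq> 0"
        using less.prems by (auto simp: atoms_def)
      then have "b \<in> submonoid_generated atoms" "c \<in> submonoid_generated atoms"
        using \<mu>_add[OF bc(1,2)] \<mu>_pos[OF bc(1,4)] \<mu>_pos[OF bc(2,5)] by (auto intro!: less.hyps)
      then show ?thesis using bc(3) submonoid_generated_closed(2) by blast
    qed
  qed
  then show "monoid \<subseteq> submonoid_generated atoms" by blast
qed

text \<open>The elements that are either not atoms or in \<open>G\<close> form a submonoid, because
  a sum can be an atom only if one summand is 0. It contains \<open>G\<close>, hence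
  everything.\<close>

lemma atoms_subset_generators:
  assumes "submonoid_generated G = monoid"
  shows "atoms \<subseteq> G"
proof -
  have "G \<subseteq> monoid" using assms submonoid_generated_closed(3) by blast
  then have "submonoid_generated G \<subseteq> {x \<in> monoid. x \<in> atoms \<longrightarrow> x \<in> G}"
  proof (intro submonoid_generated_minimal)
    fix x y assume *: "x \<in> {x \<in> monoid. x \<in> atoms \<longrightarrow> x \<in> G}" "y \<in> {x \<in> monoid. x \<in> atoms \<longrightarrow> x \<in> G}"
    have "x = 0 \<or> y = 0" if "x + y \<in> atoms" using * that unfolding atoms_def by blast
    then show "x + y \<in> {x \<in> monoid. x \<in> atoms \<longrightarrow> x \<in> G}" using * by (auto simp: monoid_add)
  qed (auto simp: monoid_zero, auto simp: atoms_def)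
  then show ?thesis using assms by (auto simp: atoms_def)
qed

lemma minimal_generators_eq_atoms:
  "(THE G. submonoid_generated G = monoid \<and> (\<forall>G'. G' \<subset> G \<longrightarrow> submonoid_generated G' \<noteq> monoid)) = atoms"
  using atoms_generate atoms_subset_generators by (intro the_equality) blast+

end

section \<open>Smooth normal fans\<close>

lemma lattice_inner: "x \<in> lattice \<Longrightarrow> y \<in> lattice \<Longrightarrow> x \<bullet> y \<in> \<int>"
  by (auto simp: lattice_def inner_vec_def intro!: Ints_sum Ints_mult)

lemma lattice_basis_subset:
  assumes "lattice_basis b" "v \<in> b"
  shows "v \<in> lattice"
proof -
  have fin: "finite b" using assms(1) by (simp add: lattice_basis_def finiteI_independent)
  have "(\<Sum>x\<in>b. real_of_int (if x = v then 1 else 0) *\<^sub>R x) = (\<Sum>x\<in>b. if x = v then x else 0)"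
    by (intro sum.cong) auto
  also have "\<dots> = v" using fin assms(2) by simp
  finally have "v \<in> range (\<lambda>c. \<Sum>x\<in>b. real_of_int (c x) *\<^sub>R x)"
    by (intro range_eqI[of _ _ "\<lambda>x. if x = v then 1 else 0"]) simp
  then show ?thesis using assms(1) by (simp only: lattice_basis_def)
qed

lemma axis_in_lattice: "axis i 1 \<in> lattice"
  by (auto simp: lattice_def axis_def)

lemma lattice_basis_span:
  assumes "lattice_basis b"
  shows "span b = (UNIV :: (real^'n::finite) set)"
proof -
  have "range (\<lambda>c. \<Sum>v\<in>b. real_of_int (c v) *\<^sub>R v) \<subseteq> span b"
    by clarify (rule span_sum, rule span_scale, rule span_base)
  then have "lattice \<subseteq> span b"
    using assms by (simp only: lattice_basis_def)
  then have "Basis \<subseteq> span b"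
    using axis_in_lattice by (auto simp: Basis_vec_def)
  then have "span (Basis :: (real^'n) set) \<subseteq> span b"
    by (rule span_minimal) (rule subspace_span)
  then show ?thesis by (simp add: span_Basis top.extremum_unique)
qed

lemma lattice_basis_expand:
  assumes "lattice_basis b"
  obtains c where "x = (\<Sum>v\<in>b. c v *\<^sub>R v)"
proof -
  have "finite b" using assms by (simp add: lattice_basis_def finiteI_independent)
  then have "x \<in> (\<lambda>c. \<Sum>v\<in>b. c v *\<^sub>R v) ` UNIV"
    using lattice_basis_span[OF assms] span_finite[of b] by auto
  then show thesis using that by blast
qed

lemma lattice_basis_card:
  assumes "lattice_basis (b :: (real^'n::finite) set)"
  shows "card b = CARD('n)"
proof -
  have "card b = dim (UNIV :: (real^'n) set)"
    using assms lattice_basis_span[OF assms] by (intro basis_card_eq_dim) (simp_all add: lattice_basis_def)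
  then show ?thesis by simp
qed

lemma lattice_basis_orthogonal:
  assumes "lattice_basis b" "\<And>v. v \<in> b \<Longrightarrow> m \<bullet> v = 0"
  shows "m = 0"
proof -
  obtain c where c: "m = (\<Sum>v\<in>b. c v *\<^sub>R v)" using lattice_basis_expand[OF assms(1)] .
  have "m \<bullet> m = (\<Sum>v\<in>b. c v * (m \<bullet> v))"
    by (subst (2) c) (simp add: inner_sum_right)
  then show ?thesis using assms(2) by simp
qed

text \<open>The functional with the prescribed values on the basis is integral on the unit vectors,
  since these are integral combinations of the basis.\<close>

lemma lattice_basis_dual:
  assumes b: "lattice_basis b"
  obtains m where "m \<in> lattice" "\<And>v. v \<in> b \<Longrightarrow> m \<bullet> v = of_int (g v)"
proof -
  have "independent b" using b by (simp add: lattice_basis_def)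
  then obtain f where f: "linear f" "\<forall>v\<in>b. f v = real_of_int (g v)"
    using linear_independent_extend[of b "\<lambda>v. real_of_int (g v)"] by blast
  define m where "m = adjoint f 1"
  have m: "m \<bullet> x = f x" for x
    using adjoint_works[OF f(1), of x 1] by (simp add: m_def inner_commute)
  have "m $ i \<in> \<int>" for i
  proof -
    have "axis i 1 \<in> range (\<lambda>c. \<Sum>v\<in>b. real_of_int (c v) *\<^sub>R v)"
      using axis_in_lattice b by (simp add: lattice_basis_def)
    then obtain c where c: "axis i 1 = (\<Sum>v\<in>b. real_of_int (c v) *\<^sub>R v)" by auto
    have "m $ i = m \<bullet> axis i 1" by (simp add: inner_axis)
    also have "\<dots> = (\<Sum>v\<in>b. real_of_int (c v * g v))"
      unfolding c inner_sum_right using f(2) m by (intro sum.cong) auto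
    also have "\<dots> = real_of_int (\<Sum>v\<in>b. c v * g v)" by simp
    finally show ?thesis by (simp only: Ints_of_int)
  qed
  then have "m \<in> lattice" by (simp add: lattice_def)
  then show thesis by (rule that) (simp add: m f(2))
qed

lemma convex_cone_hull_finite:
  fixes A :: "'a::real_vector set"
  assumes "finite A"
  shows "convex_cone hull A = {\<Sum>v\<in>A. c v *\<^sub>R v | c. \<forall>v\<in>A. 0 \<le> c v}" (is "_ = ?S")
proof
  have "convex_cone ?S"
    unfolding convex_cone_iff
  proof (intro conjI ballI allI impI)
    show "0 \<in> ?S" by (auto intro!: exI[of _ "\<lambda>_. 0"])
    fix x y assume "x \<in> ?S" "y \<in> ?S"
    then obtain c d where "x = (\<Sum>v\<in>A. c v *\<^sub>R v)" "\<forall>v\<in>A. 0 \<le> c v" "y = (\<Sum>v\<in>A. d v *\<^sub>R v)" "\<forall>v\<in>A. 0 \<le> d v"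
      by auto
    then show "x + y \<in> ?S"
      by (auto intro!: exI[of _ "\<lambda>v. c v + d v"] simp: scaleR_add_left sum.distrib)
  next
    fix x and t :: real assume "x \<in> ?S" "0 \<le> t"
    then obtain c where "x = (\<Sum>v\<in>A. c v *\<^sub>R v)" "\<forall>v\<in>A. 0 \<le> c v" by auto
    with \<open>0 \<le> t\<close> show "t *\<^sub>R x \<in> ?S"
      by (auto intro!: exI[of _ "\<lambda>v. t * c v"] simp: scaleR_sum_right)
  qed
  moreover have "A \<subseteq> ?S"
  proof
    fix a assume "a \<in> A"
    have "(\<Sum>v\<in>A. (if v = a then 1 else 0) *\<^sub>R v) = (\<Sum>v\<in>A. if v = a then v else 0)"
      by (intro sum.cong) auto
    also have "\<dots> = a" using \<open>a \<in> A\<close> assms by simp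
    finally show "a \<in> ?S" by (auto intro!: exI[of _ "\<lambda>v. if v = a then 1 else 0"])
  qed
  ultimately show "convex_cone hull A \<subseteq> ?S" by (simp add: hull_minimal)
next
  show "?S \<subseteq> convex_cone hull A"
  proof clarify
    fix c :: "'a \<Rightarrow> real" assume c: "\<forall>v\<in>A. 0 \<le> c v"
    have "(\<Sum>v\<in>B. c v *\<^sub>R v) \<in> convex_cone hull A" if "finite B" "B \<subseteq> A" for B
      using that
    proof (induction B rule: finite_induct)
      case empty
      then show ?case by (simp add: convex_cone_hull_contains_0)
    next
      case (insert v B)
      then have "c v *\<^sub>R v \<in> convex_cone hull A"
        using c by (intro convex_cone_hull_mul hull_inc) auto
      with insert show ?case by (simp add: convex_cone_hull_add)
    qed
    then show "(\<Sum>v\<in>A. c v *\<^sub>R v) \<in> convex_cone hull A" using assms by simp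
  qed
qed

lemma convex_cone_hull_singleton: "convex_cone hull {v} = {t *\<^sub>R v | t. 0 \<le> t}"
  by (auto simp: convex_cone_hull_finite)

lemma convex_cone_hull_subset_span: "finite A \<Longrightarrow> convex_cone hull A \<subseteq> span A"
  by (simp add: convex_cone_hull_finite) (clarify, rule span_sum, rule span_scale, rule span_base)

text \<open>A member of a lattice basis is primitive: pairing with the dual vector \<open>m\<close>,
  where \<open>m \<bullet> v = 1\<close>, shows that a lattice point \<open>t *\<^sub>R v\<close>
  has integral \<open>t\<close>.\<close>

lemma ray_generator_eq:
  assumes b: "lattice_basis b" and v: "v \<in> b"
  shows "ray_generator (convex_cone hull {v}) = v"
proof -
  have v_nonzero: "v \<noteq> 0" using b v dependent_zero by (auto simp: lattice_basis_def)
  have lattice_v: "v \<in> lattice" by (rule lattice_basis_subset[OF b v])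
  obtain m where m: "m \<in> lattice" "\<And>x. x \<in> b \<Longrightarrow> m \<bullet> x = of_int (if x = v then 1 else 0)"
    using lattice_basis_dual[OF b, of "\<lambda>x. if x = v then 1 else 0"] by auto
  have ray: "convex_cone hull {v} \<inter> lattice = range (\<lambda>k :: nat. of_nat k *\<^sub>R v)"
  proof (intro equalityI subsetI)
    fix x assume "x \<in> convex_cone hull {v} \<inter> lattice"
    then obtain t where t: "x = t *\<^sub>R v" "0 \<le> t" "x \<in> lattice"
      by (auto simp: convex_cone_hull_singleton)
    have "m \<bullet> x = t" using m(2)[OF v] t(1) by simp
    then have "t \<in> \<int>" using lattice_inner[OF m(1) t(3)] by simp
    then obtain k where "t = of_nat k"
      using t(2) by (metis Ints_cases of_int_0_le_iff of_int_of_nat_eq zero_le_imp_eq_int)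
    then show "x \<in> range (\<lambda>k :: nat. of_nat k *\<^sub>R v)" using t(1) by auto
  next
    fix x assume "x \<in> range (\<lambda>k :: nat. of_nat k *\<^sub>R v)"
    then obtain k :: nat where "x = of_nat k *\<^sub>R v" by auto
    then show "x \<in> convex_cone hull {v} \<inter> lattice"
      using lattice_v by (auto simp: convex_cone_hull_singleton lattice_def)
  qed
  show ?thesis
    unfolding ray_generator_def
  proof (rule the_equality)
    fix w assume "convex_cone hull {v} \<inter> lattice = range (\<lambda>k :: nat. of_nat k *\<^sub>R w)"
    then have eq: "range (\<lambda>k :: nat. of_nat k *\<^sub>R w) = range (\<lambda>k :: nat. of_nat k *\<^sub>R v)"
      using ray by simp
    have "w \<in> range (\<lambda>k :: nat. of_nat k *\<^sub>R w)" "v \<in> range (\<lambda>k :: nat. of_nat k *\<^sub>R v)"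
      by (auto intro!: image_eqI[of _ _ 1])
    then have "w \<in> range (\<lambda>k :: nat. of_nat k *\<^sub>R v)" "v \<in> range (\<lambda>k :: nat. of_nat k *\<^sub>R w)"
      by (simp_all only: eq)
    then obtain k l :: nat where kl: "w = of_nat k *\<^sub>R v" "v = of_nat l *\<^sub>R w"
      by (elim rangeE)
    have "real (l * k) *\<^sub>R v = 1 *\<^sub>R v" unfolding of_nat_mult scaleR_scaleR[symmetric] kl(1)[symmetric] kl(2)[symmetric] by simp
    then have "real (l * k) = 1" using v_nonzero by (simp only: scaleR_cancel_right) simp
    then have "l * k = 1" by linarith
    then show "w = v" using kl(1) by simp
  qed (rule ray)
qed

text \<open>Finitely many strict inequalities survive a small perturbation. It is used to move a
  vector inside the cone of a vertex.\<close>

lemma pos_scale_bound: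
  fixes f g :: "'a \<Rightarrow> real"
  assumes "finite S" "\<And>y. y \<in> S \<Longrightarrow> 0 < f y"
  shows "\<exists>\<epsilon>>0. \<forall>y\<in>S. \<epsilon> * g y \<le> f y"
  using assms
proof (induction S rule: finite_induct)
  case empty
  then show ?case by (auto intro: exI[of _ 1])
next
  case (insert x S)
  then obtain \<epsilon> where \<epsilon>: "\<epsilon> > 0" "\<forall>y\<in>S. \<epsilon> * g y \<le> f y" by auto
  define \<delta> where "\<delta> = min \<epsilon> (f x / (\<bar>g x\<bar> + 1))"
  have \<delta>: "0 < \<delta>" "\<delta> \<le> \<epsilon>" "\<delta> \<le> f x / (\<bar>g x\<bar> + 1)"
    unfolding \<delta>_def using \<epsilon>(1) insert.prems[of x] by auto
  have "\<delta> * g x \<le> \<delta> * (\<bar>g x\<bar> + 1)" using \<delta>(1) by (intro mult_left_mono) auto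
  also have "\<dots> \<le> f x" using \<delta>(3) by (simp add: pos_le_divide_eq)
  finally have "\<delta> * g x \<le> f x" .
  moreover have "\<delta> * g y \<le> f y" if "y \<in> S" for y
  proof (cases "0 \<le> g y")
    case True
    then have "\<delta> * g y \<le> \<epsilon> * g y" using \<delta>(2) by (intro mult_right_mono)
    then show ?thesis using \<epsilon>(2) that by force
  next
    case False
    then have "\<delta> * g y \<le> 0" using \<delta>(1) by (simp add: mult_le_0_iff)
    then show ?thesis using insert.prems[of y] that by force
  qed
  ultimately show ?case using \<delta>(1) by auto
qed

section \<open>Vertices of the polytope and maximal cones\<close>

locale smooth_normal_fan =
  fixes X :: "('n::finite, 'r::{finite,linorder}, 'p::ab_group_add) toric" and V :: "(real^'n) set"
  assumes smooth_projective: "smooth_projective_toric X"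
    and finite_V: "finite V"
    and V_lattice: "V \<subseteq> lattice"
    and interior_polytope: "interior (convex hull V) \<noteq> {}"
    and fan_eq: "fan X = normal_fan (convex hull V)"
begin

abbreviation u :: "'r \<Rightarrow> real^'n" where "u \<rho> \<equiv> ray_generator (ray X \<rho>)"

text \<open>
  The vertices of the polytope, the maximal cones of its inner normal fan, and the rays of these.
\<close>

definition W :: "(real^'n) set" where "W = {w. w extreme_point_of (convex hull V)}"

definition \<sigma> :: "real^'n \<Rightarrow> (real^'n) set"
  where "\<sigma> w = {v. \<forall>y\<in>convex hull V. v \<bullet> w \<le> v \<bullet> y}"

definition R :: "real^'n \<Rightarrow> 'r set" where "R w = {\<rho>. ray X \<rho> \<subseteq> \<sigma> w}"

lemma fan_facts:
  shows fan_cone: "\<kappa> \<in> fan X \<Longrightarrow> \<exists>b A. lattice_basis b \<and> A \<subseteq> b \<and> \<kappa> = convex_cone hull A"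
    and fan_face: "\<kappa> \<in> fan X \<Longrightarrow> \<tau> face_of \<kappa> \<Longrightarrow> \<tau> \<noteq> {} \<Longrightarrow> \<tau> \<in> fan X"
    and fan_inter: "\<kappa> \<in> fan X \<Longrightarrow> \<tau> \<in> fan X \<Longrightarrow> (\<kappa> \<inter> \<tau>) face_of \<kappa>"
    and ray_bij: "bij_betw (ray X) UNIV (rays (fan X))"
    and cls_add: "cls X (\<lambda>\<rho>. D \<rho> + E \<rho>) = cls X D + cls X E"
    and cls_surj: "surj (cls X)"
    and cls_zero_iff: "cls X D = 0 \<longleftrightarrow> (\<exists>m\<in>lattice. \<forall>\<rho>. real_of_int (D \<rho>) = m \<bullet> u \<rho>)"
proof -
  have *: "is_fan (fan X)" "smooth_fan (fan X)" "bij_betw (ray X) UNIV (rays (fan X))"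
    "\<And>D E. cls X (\<lambda>\<rho>. D \<rho> + E \<rho>) = cls X D + cls X E" "surj (cls X)"
    "\<And>D. cls X D = 0 \<longleftrightarrow> (\<exists>m\<in>lattice. \<forall>\<rho>. real_of_int (D \<rho>) = m \<bullet> u \<rho>)"
    using smooth_projective by (simp_all add: smooth_projective_toric_def)
  show "bij_betw (ray X) UNIV (rays (fan X))" "surj (cls X)"
    "cls X (\<lambda>\<rho>. D \<rho> + E \<rho>) = cls X D + cls X E"
    "cls X D = 0 \<longleftrightarrow> (\<exists>m\<in>lattice. \<forall>\<rho>. real_of_int (D \<rho>) = m \<bullet> u \<rho>)"
    by (fact *)+
  show "\<kappa> \<in> fan X \<Longrightarrow> \<exists>b A. lattice_basis b \<and> A \<subseteq> b \<and> \<kappa> = convex_cone hull A"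
    using *(2) by (simp add: smooth_fan_def)
  show "\<kappa> \<in> fan X \<Longrightarrow> \<tau> face_of \<kappa> \<Longrightarrow> \<tau> \<noteq> {} \<Longrightarrow> \<tau> \<in> fan X"
    "\<kappa> \<in> fan X \<Longrightarrow> \<tau> \<in> fan X \<Longrightarrow> (\<kappa> \<inter> \<tau>) face_of \<kappa>"
    using *(1) by (simp_all add: is_fan_def)
qed

lemma W_subset: "W \<subseteq> V"
  unfolding W_def using extreme_point_of_convex_hull by blast

lemma finite_W: "finite W"
  using W_subset finite_V finite_subset by blast

lemma hull_W: "convex hull W = convex hull V"
  unfolding W_def using Krein_Milman_polytope[OF finite_V] by simp

lemma W_nonempty: "W \<noteq> {}"
proof -
  have "convex hull V \<noteq> {}" using interior_polytope by force
  then show ?thesis using hull_W by (metis convex_hull_eq_empty)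
qed

lemma W_lattice: "w \<in> W \<Longrightarrow> w \<in> lattice"
  using W_subset V_lattice by blast

lemma \<sigma>_iff: "v \<in> \<sigma> w \<longleftrightarrow> (\<forall>y\<in>W. v \<bullet> w \<le> v \<bullet> y)"
proof
  assume "v \<in> \<sigma> w"
  then show "\<forall>y\<in>W. v \<bullet> w \<le> v \<bullet> y"
    using hull_W hull_subset[of W convex] by (auto simp: \<sigma>_def)
next
  assume "\<forall>y\<in>W. v \<bullet> w \<le> v \<bullet> y"
  then have "W \<subseteq> {y. v \<bullet> y \<ge> v \<bullet> w}" by blast
  then have "convex hull W \<subseteq> {y. v \<bullet> y \<ge> v \<bullet> w}"
    by (rule hull_minimal) (rule convex_halfspace_ge)
  then show "v \<in> \<sigma> w" by (auto simp: \<sigma>_def hull_W)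
qed

lemma \<sigma>_in_fan:
  assumes "w \<in> W"
  shows "\<sigma> w \<in> fan X"
proof -
  have "{w} face_of convex hull V" using assms by (simp add: W_def face_of_singleton)
  then show ?thesis unfolding fan_eq normal_fan_def \<sigma>_def by (auto intro!: exI[of _ "{w}"])
qed

text \<open>A nonempty face has an extreme point, which is a vertex of the polytope; a functional
  minimal on the whole face is minimal at that vertex.\<close>

lemma cone_subset_\<sigma>:
  assumes "\<kappa> \<in> fan X"
  obtains w where "w \<in> W" "\<kappa> \<subseteq> \<sigma> w"
proof -
  obtain F where F: "F face_of convex hull V" "F \<noteq> {}"
      "\<kappa> = {v. \<forall>x\<in>F. \<forall>y\<in>convex hull V. v \<bullet> x \<le> v \<bullet> y}"
    using assms unfolding fan_eq normal_fan_def by auto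
  have "compact (convex hull V)" using finite_V by (simp add: finite_imp_compact_convex_hull)
  then have "compact F" "convex F"
    using F(1) face_of_imp_compact[OF convex_convex_hull] face_of_imp_convex by blast+
  then obtain w where w: "w extreme_point_of F"
    using F(2) extreme_point_exists_convex by blast
  then have "w \<in> W" using extreme_point_of_face[OF F(1)] by (simp add: W_def)
  moreover have "w \<in> F" using w by (simp add: extreme_point_of_def)
  ultimately show thesis using that F(3) by (force simp: \<sigma>_def)
qed

lemma exposed_vertex:
  assumes "w \<in> W"
  obtains v where "\<And>y. y \<in> W \<Longrightarrow> y \<noteq> w \<Longrightarrow> v \<bullet> w < v \<bullet> y"
proof -
  have "polyhedron (convex hull V)"
    using finite_V by (simp add: polytope_convex_hull polytope_imp_polyhedron)
  moreover have "{w} face_of convex hull V" using assms by (simp add: W_def face_of_singleton)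
  ultimately have "{w} exposed_face_of convex hull V" by (simp add: exposed_face_of_polyhedron)
  then obtain a b where ab: "convex hull V \<subseteq> {x. a \<bullet> x \<le> b}" "{w} = convex hull V \<inter> {x. a \<bullet> x = b}"
    unfolding exposed_face_of_def by blast
  have "(- a) \<bullet> w < (- a) \<bullet> y" if "y \<in> W" "y \<noteq> w" for y
  proof -
    have y: "y \<in> convex hull V" using that(1) by (simp add: W_def extreme_point_of_def)
    then have "a \<bullet> y \<le> b" "a \<bullet> y \<noteq> b" "a \<bullet> w = b" using ab that(2) by blast+
    then show ?thesis by simp
  qed
  then show thesis by (rule that)
qed

text \<open>The cone of a vertex is full-dimensional. If the basis vector \<open>v\<^sub>0\<close>
  were missing among its generators, its dual vector \<open>m\<close> would vanish on the cone. But
  a functional strictly minimal at \<open>w\<close> stays in the cone after adding a small multiple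
  of \<open>m\<close>, which forces \<open>m = 0\<close>.\<close>

lemma \<sigma>_basis:
  assumes w: "w \<in> W"
  obtains b where "lattice_basis b" "\<sigma> w = convex_cone hull b"
proof -
  obtain b A where b: "lattice_basis b" "A \<subseteq> b" "\<sigma> w = convex_cone hull A"
    using fan_cone[OF \<sigma>_in_fan[OF w]] by blast
  have finb: "finite b" using b(1) by (simp add: lattice_basis_def finiteI_independent)
  have "b \<subseteq> A"
  proof (rule ccontr)
    assume "\<not> b \<subseteq> A"
    then obtain v\<^sub>0 where v0: "v\<^sub>0 \<in> b" "v\<^sub>0 \<notin> A" by blast
    obtain m where m: "\<And>x. x \<in> b \<Longrightarrow> m \<bullet> x = of_int (if x = v\<^sub>0 then 1 else 0)"
      using lattice_basis_dual[OF b(1), of "\<lambda>x. if x = v\<^sub>0 then 1 else 0"] by auto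
    have perp: "m \<bullet> x = 0" if x: "x \<in> \<sigma> w" for x
    proof -
      have "finite A" using b(2) finb finite_subset by blast
      then obtain c where "x = (\<Sum>v\<in>A. c v *\<^sub>R v)"
        using x unfolding b(3) by (auto simp: convex_cone_hull_finite)
      moreover have "m \<bullet> v = 0" if "v \<in> A" for v using m[of v] b(2) v0(2) that by auto
      ultimately show ?thesis by (simp add: inner_sum_right)
    qed
    obtain v where v: "\<And>y. y \<in> W \<Longrightarrow> y \<noteq> w \<Longrightarrow> v \<bullet> w < v \<bullet> y" using exposed_vertex[OF w] by blast
    obtain \<epsilon> where \<epsilon>: "\<epsilon> > 0" "\<forall>y\<in>W - {w}. \<epsilon> * (m \<bullet> w - m \<bullet> y) \<le> v \<bullet> y - v \<bullet> w"
      using pos_scale_bound[of "W - {w}" "\<lambda>y. v \<bullet> y - v \<bullet> w" "\<lambda>y. m \<bullet> w - m \<bullet> y"] finite_W v by auto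
    have "v \<in> \<sigma> w" unfolding \<sigma>_iff using v by force
    moreover have "v + \<epsilon> *\<^sub>R m \<in> \<sigma> w"
      unfolding \<sigma>_iff
    proof
      fix y assume "y \<in> W"
      then show "(v + \<epsilon> *\<^sub>R m) \<bullet> w \<le> (v + \<epsilon> *\<^sub>R m) \<bullet> y"
        using \<epsilon>(2) by (cases "y = w") (auto simp: inner_add_left algebra_simps)
    qed
    ultimately have "m \<bullet> v = 0" "m \<bullet> (v + \<epsilon> *\<^sub>R m) = 0" by (auto intro: perp)
    then have "m = 0" using \<epsilon>(1) by (simp add: inner_add_right)
    then show False using m[OF v0(1)] by simp
  qed
  then have "A = b" using b(2) by blast
  then show thesis using b that by blast
qed

lemma ray_facts:
  shows ray_eq: "ray X \<rho> = convex_cone hull {u \<rho>}"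
    and u_lattice: "u \<rho> \<in> lattice"
    and u_nonzero: "u \<rho> \<noteq> 0"
proof -
  have "ray X \<rho> \<in> rays (fan X)" using ray_bij by (auto simp: bij_betw_def)
  then have r: "ray X \<rho> \<in> fan X" "dim (ray X \<rho>) = 1" by (auto simp: rays_def)
  obtain b A where b: "lattice_basis b" "A \<subseteq> b" "ray X \<rho> = convex_cone hull A"
    using fan_cone[OF r(1)] by blast
  have ind: "independent A" using b(1,2) independent_mono by (auto simp: lattice_basis_def)
  then have fin: "finite A" by (rule finiteI_independent)
  have "span (convex_cone hull A) = span A"
  proof
    show "span (convex_cone hull A) \<subseteq> span A"
      by (rule span_minimal[OF convex_cone_hull_subset_span[OF fin] subspace_span])
    show "span A \<subseteq> span (convex_cone hull A)" by (rule span_mono) (rule hull_subset)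
  qed
  then have "dim (convex_cone hull A) = dim A" by (metis dim_span)
  then have "card A = 1" using r(2) b(3) dim_eq_card_independent[OF ind] by simp
  then obtain v where v: "A = {v}" by (auto simp: card_1_singleton_iff)
  then have "u \<rho> = v" "v \<in> b" using ray_generator_eq[OF b(1)] b by auto
  then show "ray X \<rho> = convex_cone hull {u \<rho>}" "u \<rho> \<in> lattice" "u \<rho> \<noteq> 0"
    using b v lattice_basis_subset dependent_zero by (auto simp: lattice_basis_def)
qed

lemma inj_u: "inj u"
proof (rule injI)
  fix \<rho> \<rho>' assume "u \<rho> = u \<rho>'"
  then have "ray X \<rho> = ray X \<rho>'" using ray_eq[of \<rho>] ray_eq[of \<rho>'] by simp
  then show "\<rho> = \<rho>'" using ray_bij by (auto simp: bij_betw_def inj_eq)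
qed

lemma mem_R_iff: "\<rho> \<in> R w \<longleftrightarrow> (\<forall>y\<in>W. u \<rho> \<bullet> w \<le> u \<rho> \<bullet> y)"
proof -
  have "ray X \<rho> \<subseteq> \<sigma> w \<longleftrightarrow> u \<rho> \<in> \<sigma> w"
  proof
    show "ray X \<rho> \<subseteq> \<sigma> w \<Longrightarrow> u \<rho> \<in> \<sigma> w"
      using ray_eq[of \<rho>] hull_inc[of "u \<rho>" "{u \<rho>}" convex_cone] by auto
    show "u \<rho> \<in> \<sigma> w \<Longrightarrow> ray X \<rho> \<subseteq> \<sigma> w"
      by (subst ray_eq) (auto simp: convex_cone_hull_singleton \<sigma>_def mult_left_mono)
  qed
  then show ?thesis by (simp add: R_def \<sigma>_iff)
qed

text \<open>Smoothness gives some lattice basis that generates the cone; it consists of the ray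
  generators because its members span exactly the rays of the fan inside the cone. One direction
  exhibits each such span as a face, the other uses that a ray of the fan inside the cone is a face
  of it.\<close>

lemma R_basis:
  assumes w: "w \<in> W"
  shows "lattice_basis (u ` R w)" and "\<sigma> w = convex_cone hull (u ` R w)"
proof -
  obtain b where b: "lattice_basis b" "\<sigma> w = convex_cone hull b" using \<sigma>_basis[OF w] .
  have finb: "finite b" using b(1) by (simp add: lattice_basis_def finiteI_independent)
  have "b \<subseteq> u ` R w"
  proof
    fix v assume v: "v \<in> b"
    \<comment> \<open>\<open>m\<close> is the sum of the dual vectors of the other basis members:
      nonnegative on the cone, zero there exactly on the ray of \<open>v\<close>.\<close>
    obtain m where m: "\<And>x. x \<in> b \<Longrightarrow> m \<bullet> x = of_int (if x = v then 0 else 1)"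
      using lattice_basis_dual[OF b(1), of "\<lambda>x. if x = v then 0 else 1"] by auto
    have nonneg: "0 \<le> m \<bullet> x" if x: "x \<in> \<sigma> w" for x
    proof -
      obtain c where c: "x = (\<Sum>v\<in>b. c v *\<^sub>R v)" "\<forall>v\<in>b. 0 \<le> c v"
        using x unfolding b(2) by (auto simp: convex_cone_hull_finite[OF finb])
      show ?thesis unfolding c(1) inner_sum_right using c(2) m by (intro sum_nonneg) auto
    qed
    have "convex (\<sigma> w)" unfolding b(2) by (rule convex_convex_cone_hull)
    then have face: "(\<sigma> w \<inter> {x. m \<bullet> x = 0}) face_of \<sigma> w"
      by (rule face_of_Int_supporting_hyperplane_ge) (rule nonneg)
    have "\<sigma> w \<inter> {x. m \<bullet> x = 0} = convex_cone hull {v}"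
    proof (intro equalityI subsetI)
      fix x assume x: "x \<in> \<sigma> w \<inter> {x. m \<bullet> x = 0}"
      obtain c where c: "x = (\<Sum>v\<in>b. c v *\<^sub>R v)" "\<forall>v\<in>b. 0 \<le> c v"
        using x unfolding b(2) by (auto simp: convex_cone_hull_finite[OF finb])
      have "(\<Sum>y\<in>b. c y * (m \<bullet> y)) = 0" using x c(1) by (simp add: inner_sum_right)
      moreover have "\<forall>y\<in>b. 0 \<le> c y * (m \<bullet> y)" using c(2) m by auto
      ultimately have zero: "\<forall>y\<in>b. c y * (m \<bullet> y) = 0" using finb by (simp add: sum_nonneg_eq_0_iff)
      have "c y = 0" if "y \<in> b - {v}" for y
        using zero m[of y] that by auto
      then have "x = c v *\<^sub>R v" unfolding c(1) using finb v by (simp add: sum.remove)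
      then show "x \<in> convex_cone hull {v}" using c(2) v by (auto simp: convex_cone_hull_singleton)
    next
      fix x assume "x \<in> convex_cone hull {v}"
      moreover have "v \<in> \<sigma> w" unfolding b(2) using v by (rule hull_inc)
      ultimately show "x \<in> \<sigma> w \<inter> {x. m \<bullet> x = 0}"
        using m[OF v] by (auto simp: convex_cone_hull_singleton \<sigma>_def mult_left_mono)
    qed
    with face have "(convex_cone hull {v}) face_of \<sigma> w" by simp
    then have "convex_cone hull {v} \<in> fan X"
      by (rule fan_face[OF \<sigma>_in_fan[OF w]]) (rule convex_cone_hull_nonempty)
    moreover have "v \<noteq> 0" using b(1) v dependent_zero by (auto simp: lattice_basis_def)
    moreover have "span (convex_cone hull {v}) = span {v}"
    proof
      show "span (convex_cone hull {v}) \<subseteq> span {v}"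
        by (rule span_minimal[OF convex_cone_hull_subset_span subspace_span]) simp
      show "span {v} \<subseteq> span (convex_cone hull {v})" by (rule span_mono) (rule hull_subset)
    qed
    then have "dim (convex_cone hull {v}) = dim {v}" by (metis dim_span)
    ultimately have "convex_cone hull {v} \<in> rays (fan X)" by (simp add: rays_def)
    then obtain \<rho> where \<rho>: "ray X \<rho> = convex_cone hull {v}" using ray_bij by (metis bij_betw_def imageE)
    then have "u \<rho> = v" using ray_generator_eq[OF b(1) v] by simp
    moreover have "u \<rho> \<in> \<sigma> w" unfolding \<open>u \<rho> = v\<close> b(2) using v by (rule hull_inc)
    then have "\<rho> \<in> R w" unfolding mem_R_iff \<sigma>_iff .
    ultimately show "v \<in> u ` R w" by blast
  qed
  moreover have "u ` R w \<subseteq> b"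
  proof clarify
    fix \<rho> assume "\<rho> \<in> R w"
    then have sub: "ray X \<rho> \<subseteq> \<sigma> w" by (simp add: R_def)
    then have mem: "u \<rho> \<in> \<sigma> w" using ray_eq[of \<rho>] hull_inc[of "u \<rho>" "{u \<rho>}" convex_cone] by auto
    then obtain c where c: "u \<rho> = (\<Sum>v\<in>b. c v *\<^sub>R v)" "\<forall>v\<in>b. 0 \<le> c v"
      unfolding b(2) by (auto simp: convex_cone_hull_finite[OF finb])
    have "\<exists>v\<in>b. c v \<noteq> 0"
    proof (rule ccontr)
      assume "\<not> ?thesis"
      then have "u \<rho> = 0" unfolding c(1) by simp
      then show False using u_nonzero by blast
    qed
    then obtain v where v: "v \<in> b" "0 < c v" using c(2) by (metis less_eq_real_def)
    have "ray X \<rho> \<in> fan X" using ray_bij by (auto simp: bij_betw_def rays_def)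
    then have "(\<sigma> w \<inter> ray X \<rho>) face_of \<sigma> w" by (rule fan_inter[OF \<sigma>_in_fan[OF w]])
    then have face: "ray X \<rho> face_of \<sigma> w" using sub by (simp add: Int_absorb1)
    \<comment> \<open>The factor 2 makes \<open>u \<rho>\<close> the midpoint of \<open>x\<close>
      and \<open>y\<close>, both in the cone; the face property then puts \<open>x\<close>, a
      positive multiple of \<open>v\<close>, on the ray of \<open>\<rho>\<close>.\<close>
    define x where "x = (2 * c v) *\<^sub>R v"
    define y where "y = (\<Sum>v'\<in>b - {v}. (2 * c v') *\<^sub>R v')"
    have "v \<in> \<sigma> w" unfolding b(2) using v(1) by (rule hull_inc)
    then have x: "x \<in> \<sigma> w"
      using v(2) unfolding x_def b(2) by (intro convex_cone_hull_mul) auto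
    have "(\<Sum>v'\<in>b. (if v' = v then 0 else 2 * c v') *\<^sub>R v') \<in> \<sigma> w"
      unfolding b(2) convex_cone_hull_finite[OF finb] using c(2)
      by (intro CollectI exI[of _ "\<lambda>v'. if v' = v then 0 else 2 * c v'"]) auto
    also have "(\<Sum>v'\<in>b. (if v' = v then 0 else 2 * c v') *\<^sub>R v') = y"
      unfolding y_def using finb v(1) by (subst sum.remove[of b v]) (auto intro!: sum.cong)
    finally have y: "y \<in> \<sigma> w" .
    have mid: "u \<rho> = midpoint x y"
      unfolding c(1) midpoint_def x_def y_def scaleR_sum_right scaleR_add_right using finb v(1)
      by (subst sum.remove[of b v]) (auto intro!: sum.cong simp: scaleR_sum_right)
    have u_ray: "u \<rho> \<in> ray X \<rho>"
      using ray_eq[of \<rho>] hull_inc[of "u \<rho>" "{u \<rho>}" convex_cone] by auto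
    have "x \<in> ray X \<rho>"
    proof (cases "x = y")
      case True
      then show ?thesis using mid u_ray by simp
    next
      case False
      then have "u \<rho> \<in> open_segment x y" unfolding mid by simp
      then show ?thesis using face x y u_ray unfolding face_of_def by blast
    qed
    then obtain t where t: "x = t *\<^sub>R u \<rho>" "0 \<le> t"
      by (subst (asm) ray_eq) (auto simp: convex_cone_hull_singleton)
    have "x \<noteq> 0" using v b(1) dependent_zero unfolding x_def by (auto simp: lattice_basis_def)
    then have tpos: "0 < t" using t by (cases "t = 0") auto
    have "ray X \<rho> = convex_cone hull {v}"
    proof -
      have 1: "v = (1 / (2 * c v)) *\<^sub>R x" using v(2) by (simp add: x_def)
      have 2: "u \<rho> = (1 / t) *\<^sub>R x" using tpos by (simp add: t(1))
      have "(t / (2 * c v)) *\<^sub>R u \<rho> = (1 / (2 * c v)) *\<^sub>R x" by (simp add: t(1))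
      moreover have "(2 * c v / t) *\<^sub>R v = (1 / t) *\<^sub>R x" by (simp add: x_def)
      ultimately have eq: "(t / (2 * c v)) *\<^sub>R u \<rho> = v" "(2 * c v / t) *\<^sub>R v = u \<rho>"
        unfolding 1[symmetric] 2[symmetric] .
      have "(t / (2 * c v)) *\<^sub>R u \<rho> \<in> convex_cone hull {u \<rho>}"
        "(2 * c v / t) *\<^sub>R v \<in> convex_cone hull {v}"
        using tpos v(2) by (intro convex_cone_hull_mul hull_inc; simp)+
      then have "v \<in> convex_cone hull {u \<rho>}" "u \<rho> \<in> convex_cone hull {v}"
        unfolding eq .
      then show ?thesis
        by (subst ray_eq) (intro equalityI hull_minimal convex_cone_convex_cone_hull; simp)
    qed
    then have "u \<rho> = v" using ray_generator_eq[OF b(1) v(1)] by simp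
    then show "u \<rho> \<in> b" using v by simp
  qed
  ultimately have "b = u ` R w" by blast
  then show "lattice_basis (u ` R w)" "\<sigma> w = convex_cone hull (u ` R w)" using b by auto
qed

section \<open>Divisors of characters and the ample class\<close>

definition principal :: "real^'n \<Rightarrow> 'r \<Rightarrow> int"
  where "principal m \<rho> = \<lfloor>m \<bullet> u \<rho>\<rfloor>"

lemma principal: "m \<in> lattice \<Longrightarrow> real_of_int (principal m \<rho>) = m \<bullet> u \<rho>"
  using lattice_inner[OF _ u_lattice, of m \<rho>] by (simp add: principal_def)

lemma cls_principal: "m \<in> lattice \<Longrightarrow> cls X (principal m) = 0"
  unfolding cls_zero_iff using principal by blast

lemma cls_diff: "cls X (\<lambda>\<rho>. D \<rho> - E \<rho>) = cls X D - cls X E"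
  using cls_add[of "\<lambda>\<rho>. D \<rho> - E \<rho>" E] by simp

lemma dual_vector:
  assumes "w \<in> W"
  obtains m where "m \<in> lattice" "\<And>\<rho>. \<rho> \<in> R w \<Longrightarrow> m \<bullet> u \<rho> = of_int (g \<rho>)"
proof -
  obtain m where m: "m \<in> lattice" "\<And>v. v \<in> u ` R w \<Longrightarrow> m \<bullet> v = of_int (g (inv u v))"
    using lattice_basis_dual[OF R_basis(1)[OF assms], of "\<lambda>v. g (inv u v)"] by blast
  have "m \<bullet> u \<rho> = of_int (g \<rho>)" if "\<rho> \<in> R w" for \<rho>
    using m(2)[of "u \<rho>"] that inv_f_f[OF inj_u] by simp
  with m(1) show thesis by (rule that)
qed

lemma orthogonal_R: "w \<in> W \<Longrightarrow> (\<And>\<rho>. \<rho> \<in> R w \<Longrightarrow> m \<bullet> u \<rho> = 0) \<Longrightarrow> m = 0"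
  by (rule lattice_basis_orthogonal[OF R_basis(1)]) blast+

text \<open>Since the ray generators of a maximal cone form a lattice basis, exactly one character
  cancels the coefficients of a given divisor on these rays.\<close>

lemma representative_unique_exists:
  assumes w: "w \<in> W"
  shows "\<exists>!D. cls X D = a \<and> (\<forall>\<rho>\<in>R w. D \<rho> = 0)"
proof (rule ex_ex1I)
  obtain D where D: "cls X D = a" using cls_surj by (metis surj_def)
  obtain m where m: "m \<in> lattice" "\<And>\<rho>. \<rho> \<in> R w \<Longrightarrow> m \<bullet> u \<rho> = of_int (D \<rho>)"
    using dual_vector[OF w, of D] by blast
  have "D \<rho> - principal m \<rho> = 0" if "\<rho> \<in> R w" for \<rho>
    using principal[OF m(1), of \<rho>] m(2)[OF that] by simp
  moreover have "cls X (\<lambda>\<rho>. D \<rho> - principal m \<rho>) = a"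
    using D cls_principal[OF m(1)] by (simp add: cls_diff)
  ultimately show "\<exists>D. cls X D = a \<and> (\<forall>\<rho>\<in>R w. D \<rho> = 0)" by blast
next
  fix D E assume *: "cls X D = a \<and> (\<forall>\<rho>\<in>R w. D \<rho> = 0)" "cls X E = a \<and> (\<forall>\<rho>\<in>R w. E \<rho> = 0)"
  then have "cls X (\<lambda>\<rho>. D \<rho> - E \<rho>) = 0" by (simp add: cls_diff)
  then obtain m where m: "m \<in> lattice" "\<And>\<rho>. real_of_int (D \<rho> - E \<rho>) = m \<bullet> u \<rho>"
    unfolding cls_zero_iff by blast
  have "m = 0" using w
  proof (rule orthogonal_R)
    fix \<rho> assume "\<rho> \<in> R w"
    then show "m \<bullet> u \<rho> = 0" using m(2)[of \<rho>] * by simp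
  qed
  then show "D = E" using m(2) by (auto simp: fun_eq_iff)
qed

text \<open>The ample divisor attached to the polytope. Adding the divisor of the character of a
  vertex \<open>w\<close> gives an effective divisor that is zero exactly on the rays of the cone of
  \<open>w\<close>, see \<open>ample_nonneg\<close> and \<open>ample_zero_iff\<close>.\<close>

definition support_divisor :: "'r \<Rightarrow> int"
  where "support_divisor \<rho> = - \<lfloor>Min ((\<lambda>w. w \<bullet> u \<rho>) ` W)\<rfloor>"

lemma support_divisor:
  shows "- real_of_int (support_divisor \<rho>) = Min ((\<lambda>w. w \<bullet> u \<rho>) ` W)"
proof -
  have "Min ((\<lambda>w. w \<bullet> u \<rho>) ` W) \<in> (\<lambda>w. w \<bullet> u \<rho>) ` W"
    using finite_W W_nonempty by (intro Min_in) auto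
  then have "Min ((\<lambda>w. w \<bullet> u \<rho>) ` W) \<in> \<int>"
    using lattice_inner[OF W_lattice u_lattice] by auto
  then show ?thesis by (simp add: support_divisor_def)
qed

lemma ample_nonneg: "w \<in> W \<Longrightarrow> 0 \<le> support_divisor \<rho> + principal w \<rho>"
proof -
  assume w: "w \<in> W"
  have "Min ((\<lambda>w. w \<bullet> u \<rho>) ` W) \<le> w \<bullet> u \<rho>" using finite_W w by simp
  then show ?thesis using support_divisor[of \<rho>] principal[OF W_lattice[OF w], of \<rho>] by linarith
qed

lemma ample_zero_iff:
  assumes w: "w \<in> W"
  shows "support_divisor \<rho> + principal w \<rho> = 0 \<longleftrightarrow> \<rho> \<in> R w"
proof -
  have "\<rho> \<in> R w \<longleftrightarrow> Min ((\<lambda>w. w \<bullet> u \<rho>) ` W) = w \<bullet> u \<rho>"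
  proof
    assume "\<rho> \<in> R w"
    then show "Min ((\<lambda>w. w \<bullet> u \<rho>) ` W) = w \<bullet> u \<rho>"
      using w finite_W by (intro Min_eqI) (auto simp: mem_R_iff inner_commute)
  next
    assume "Min ((\<lambda>w. w \<bullet> u \<rho>) ` W) = w \<bullet> u \<rho>"
    then have "\<forall>y\<in>W. w \<bullet> u \<rho> \<le> y \<bullet> u \<rho>" using finite_W by (metis Min_le finite_imageI imageI)
    then show "\<rho> \<in> R w" by (simp add: mem_R_iff inner_commute)
  qed
  also have "\<dots> \<longleftrightarrow> support_divisor \<rho> + principal w \<rho> = 0"
    using support_divisor[of \<rho>] principal[OF W_lattice[OF w], of \<rho>] by linarith
  finally show ?thesis by simp
qed

section \<open>Edges of the polytope and adjacent vertices\<close>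

lemma inner_R: "w \<in> W \<Longrightarrow> y \<in> W \<Longrightarrow> \<rho> \<in> R w \<Longrightarrow> w \<bullet> u \<rho> \<le> y \<bullet> u \<rho>"
  by (metis mem_R_iff inner_commute)

lemma mem_R_if_minimal:
  assumes "w \<in> W" "y \<in> W" "\<rho> \<in> R w" "y \<bullet> u \<rho> = w \<bullet> u \<rho>"
  shows "\<rho> \<in> R y"
proof -
  have "u \<rho> \<bullet> y = u \<rho> \<bullet> w" using assms(4) by (simp only: inner_commute[of "u \<rho>"])
  then show ?thesis using assms(3) by (simp only: mem_R_iff)
qed

lemma inner_R_less: "w \<in> W \<Longrightarrow> y \<in> W \<Longrightarrow> \<rho> \<in> R w \<Longrightarrow> \<rho> \<notin> R y \<Longrightarrow> w \<bullet> u \<rho> < y \<bullet> u \<rho>"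
  by (metis inner_R mem_R_if_minimal order_le_less)

text \<open>The dual basis vector of \<open>u i\<close> is the direction of the edge at
  \<open>w\<close> that leaves the facet of \<open>i\<close> and stays in the other facets through
  \<open>w\<close>.\<close>

lemma edge_vector:
  assumes w: "w \<in> W" and i: "i \<in> R w"
  obtains e where "e \<in> lattice" "e \<bullet> u i = 1" "\<And>j. j \<in> R w - {i} \<Longrightarrow> e \<bullet> u j = 0"
proof -
  obtain e where "e \<in> lattice" "\<And>\<rho>. \<rho> \<in> R w \<Longrightarrow> e \<bullet> u \<rho> = of_int (if \<rho> = i then 1 else 0)"
    using dual_vector[OF w, of "\<lambda>\<rho>. if \<rho> = i then 1 else 0"] by blast
  then show thesis using i by (intro that[of e]) auto
qed

lemma on_edge:
  assumes w: "w \<in> W" and i: "i \<in> R w" and e: "e \<bullet> u i = 1" "\<And>j. j \<in> R w - {i} \<Longrightarrow> e \<bullet> u j = 0"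
    and y: "y \<in> W" "\<And>j. j \<in> R w - {i} \<Longrightarrow> y \<bullet> u j = w \<bullet> u j"
  shows "\<exists>s\<ge>0. y = w + s *\<^sub>R e"
proof -
  define s where "s = (y - w) \<bullet> u i"
  have "0 \<le> s" unfolding s_def using inner_R[OF w y(1) i] by (simp add: inner_diff_left)
  moreover have "y - w - s *\<^sub>R e = 0" using w
  proof (rule orthogonal_R)
    fix j assume j: "j \<in> R w"
    show "(y - w - s *\<^sub>R e) \<bullet> u j = 0"
    proof (cases "j = i")
      case True
      then show ?thesis using e(1) s_def by (simp add: inner_diff_left)
    next
      case False
      then show ?thesis using e(2)[of j] y(2)[of j] j by (simp add: inner_diff_left)
    qed
  qed
  ultimately show ?thesis by (intro exI[of _ s]) (auto simp: algebra_simps)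
qed

text \<open>If \<open>w\<close> were the only vertex on this edge line, the sum \<open>v\<close> of
  the other ray generators would be strictly minimal at \<open>w\<close>. Then
  \<open>v - \<epsilon> *\<^sub>R u i\<close> would still lie in the cone of \<open>w\<close>,
  although \<open>e\<close> is nonnegative on that cone and takes the value
  \<open>- \<epsilon>\<close> there.\<close>

lemma edge_other_end:
  assumes w: "w \<in> W" and i: "i \<in> R w" and e: "e \<in> lattice" "e \<bullet> u i = 1" "\<And>j. j \<in> R w - {i} \<Longrightarrow> e \<bullet> u j = 0"
  obtains w' s where "w' \<in> W" "0 < s" "w' = w + s *\<^sub>R e"
proof -
  have "\<exists>y\<in>W - {w}. \<forall>j\<in>R w - {i}. y \<bullet> u j = w \<bullet> u j"
  proof (rule ccontr)
    assume "\<not> ?thesis"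
    then have neq: "\<exists>j\<in>R w - {i}. w \<bullet> u j \<noteq> y \<bullet> u j" if "y \<in> W - {w}" for y using that by metis
    define v where "v = (\<Sum>j\<in>R w - {i}. u j)"
    have pos: "0 < (y - w) \<bullet> v" if y: "y \<in> W - {w}" for y
    proof -
      obtain j where j: "j \<in> R w - {i}" "w \<bullet> u j \<noteq> y \<bullet> u j" using neq[OF y] by blast
      have "0 < (\<Sum>j\<in>R w - {i}. (y - w) \<bullet> u j)"
        using j inner_R[OF w, of y] y by (intro sum_pos2[of _ j]) (force simp: inner_diff_left)+
      then show ?thesis by (simp add: v_def inner_sum_right)
    qed
    obtain \<epsilon> where \<epsilon>: "\<epsilon> > 0" "\<forall>y\<in>W - {w}. \<epsilon> * ((y - w) \<bullet> u i) \<le> (y - w) \<bullet> v"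
      using pos_scale_bound[of "W - {w}" "\<lambda>y. (y - w) \<bullet> v" "\<lambda>y. (y - w) \<bullet> u i"] finite_W pos by auto
    have "v - \<epsilon> *\<^sub>R u i \<in> \<sigma> w"
      unfolding \<sigma>_iff
    proof
      fix y assume "y \<in> W"
      then show "(v - \<epsilon> *\<^sub>R u i) \<bullet> w \<le> (v - \<epsilon> *\<^sub>R u i) \<bullet> y"
        using \<epsilon>(2) by (cases "y = w") (auto simp: inner_diff_left inner_diff_right inner_commute algebra_simps)
    qed
    then obtain c where c: "v - \<epsilon> *\<^sub>R u i = (\<Sum>x\<in>u ` R w. c x *\<^sub>R x)" "\<forall>x\<in>u ` R w. 0 \<le> c x"
      unfolding R_basis(2)[OF w] by (auto simp: convex_cone_hull_finite)
    have "0 \<le> e \<bullet> (v - \<epsilon> *\<^sub>R u i)"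
      unfolding c(1) inner_sum_right
    proof (rule sum_nonneg)
      fix x assume "x \<in> u ` R w"
      then obtain j where j: "j \<in> R w" "x = u j" by blast
      then have "0 \<le> e \<bullet> x" using e(2) e(3)[of j] by (cases "j = i") auto
      moreover have "0 \<le> c x" using c(2) \<open>x \<in> u ` R w\<close> by blast
      ultimately show "0 \<le> e \<bullet> (c x *\<^sub>R x)" by simp
    qed
    moreover have "e \<bullet> v = 0" unfolding v_def inner_sum_right using e(3) by (intro sum.neutral) auto
    ultimately show False using e(2) \<epsilon>(1) by (simp add: inner_diff_right)
  qed
  then obtain y where y: "y \<in> W" "y \<noteq> w" "\<And>j. j \<in> R w - {i} \<Longrightarrow> y \<bullet> u j = w \<bullet> u j" by blast
  obtain s where s: "0 \<le> s" "y = w + s *\<^sub>R e" using on_edge[OF w i e(2,3) y(1,3)] by blast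
  with y(2) have "s \<noteq> 0" by auto
  with s y(1) show thesis by (intro that[of y s]) auto
qed

lemma no_third_vertex:
  assumes "w \<in> W" "w + s *\<^sub>R e \<in> W" "w + t *\<^sub>R e \<in> W" "0 < s" "s < t" "e \<noteq> 0"
  shows False
proof -
  have "w + t *\<^sub>R e \<noteq> w"
  proof
    assume "w + t *\<^sub>R e = w"
    then have "e = 0" using assms by simp
    then show False using assms(6) by simp
  qed
  moreover have "w + s *\<^sub>R e = (1 - s / t) *\<^sub>R w + (s / t) *\<^sub>R (w + t *\<^sub>R e)"
    using assms(4,5) by (simp add: algebra_simps)
  ultimately have "w + s *\<^sub>R e \<in> open_segment w (w + t *\<^sub>R e)"
    using assms(4,5) unfolding in_segment by (intro conjI exI[of _ "s / t"]) auto
  moreover have "w \<in> convex hull V" "w + t *\<^sub>R e \<in> convex hull V"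
    using assms(1,3) by (simp_all add: W_def extreme_point_of_def)
  ultimately show False using assms(2) unfolding W_def extreme_point_of_def by blast
qed

lemma card_R: "w \<in> W \<Longrightarrow> card (R w) = CARD('n)"
  using lattice_basis_card[OF R_basis(1)] card_image[OF inj_on_subset[OF inj_u]] by fastforce

text \<open>\<open>w'\<close> is the other end of the edge in direction \<open>e\<close>, and
  \<open>E\<close> is the divisor of the character \<open>e\<close>. Its coefficient at the new ray
  is a unit because the rays at \<open>w'\<close> form a lattice basis too.\<close>

lemma adjacent_vertex:
  assumes w: "w \<in> W" and i: "i \<in> R w"
  shows "\<exists>w'\<in>W. \<exists>i' E. i' \<notin> R w \<and> R w' = insert i' (R w - {i}) \<and> cls X E = 0 \<and>
    (\<forall>j\<in>R w - {i}. E j = 0) \<and> E i = 1 \<and> E i' = -1 \<and> (\<forall>y\<in>W. R w - {i} \<subseteq> R y \<longrightarrow> y = w \<or> y = w')"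
proof -
  obtain e where e: "e \<in> lattice" "e \<bullet> u i = 1" "\<And>j. j \<in> R w - {i} \<Longrightarrow> e \<bullet> u j = 0"
    using edge_vector[OF w i] by blast
  obtain w' s where w': "w' \<in> W" "0 < s" "w' = w + s *\<^sub>R e"
    using edge_other_end[OF w i e] by blast
  have w'_u: "w' \<bullet> u \<rho> = w \<bullet> u \<rho> + s * (e \<bullet> u \<rho>)" for \<rho>
    by (simp add: w'(3) inner_add_left)
  have sub: "R w - {i} \<subseteq> R w'"
  proof
    fix j assume j: "j \<in> R w - {i}"
    then show "j \<in> R w'" using w'_u[of j] e(3)[OF j] by (intro mem_R_if_minimal[OF w w'(1)]) auto
  qed
  have i_notin: "i \<notin> R w'"
    using inner_R[OF w'(1) w, of i] w'_u[of i] e(2) w'(2) by auto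
  have "card (R w' - (R w - {i})) = 1"
    using card_R[OF w] card_R[OF w'(1)] i sub by (simp add: card_Diff_subset)
  then obtain i' where i': "R w' - (R w - {i}) = {i'}" by (auto simp: card_1_singleton_iff)
  then have R_w': "R w' = insert i' (R w - {i})" and i'_notin: "i' \<notin> R w" using sub i_notin by auto
  have "e \<bullet> u i' < 0"
    using inner_R_less[OF w'(1) w _ i'_notin] R_w' w'_u[of i'] w'(2) by (simp add: mult_less_0_iff)
  \<comment> \<open>In the expansion of \<open>u i\<close> in the basis at \<open>w'\<close>,
    pairing with \<open>e\<close> leaves the term of \<open>i'\<close> alone; so
    \<open>e \<bullet> u i'\<close> divides 1, and being negative it is -1.\<close>
  moreover have "\<exists>k::int. 1 = real_of_int k * (e \<bullet> u i')"
  proof -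
    have "u i \<in> range (\<lambda>c. \<Sum>v\<in>u ` R w'. real_of_int (c v) *\<^sub>R v)"
      using R_basis(1)[OF w'(1)] u_lattice by (simp add: lattice_basis_def)
    then obtain c where c: "u i = (\<Sum>v\<in>u ` R w'. real_of_int (c v) *\<^sub>R v)" by auto
    have "1 = (\<Sum>j\<in>R w'. real_of_int (c (u j)) * (e \<bullet> u j))"
      using e(2) unfolding c inner_sum_right by (simp add: sum.reindex inj_on_subset[OF inj_u])
    also have "\<dots> = real_of_int (c (u i')) * (e \<bullet> u i')"
      using i'_notin e(3) by (simp add: R_w')
    finally show ?thesis by blast
  qed
  ultimately have E_i': "principal e i' = -1"
  proof -
    assume neg: "e \<bullet> u i' < 0" and "\<exists>k::int. 1 = real_of_int k * (e \<bullet> u i')"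
    then obtain k :: int where k: "1 = real_of_int k * real_of_int (principal e i')"
      using principal[OF e(1)] by auto
    then have "k * principal e i' = 1" by (simp flip: of_int_mult)
    moreover have "principal e i' < 0" using neg principal[OF e(1), of i'] by linarith
    ultimately show ?thesis by (auto simp: zmult_eq_1_iff)
  qed
  have third: "y = w \<or> y = w'" if y: "y \<in> W" "R w - {i} \<subseteq> R y" for y
  proof -
    have "y \<bullet> u j = w \<bullet> u j" if "j \<in> R w - {i}" for j
      using inner_R[OF w y(1), of j] inner_R[OF y(1) w, of j] y(2) that by force
    then obtain t where t: "0 \<le> t" "y = w + t *\<^sub>R e"
      using on_edge[OF w i e(2,3) y(1)] by blast
    have "e \<noteq> 0" using e(2) by auto
    then have "t = 0 \<or> t = s"
      using no_third_vertex[OF w, of s e t] no_third_vertex[OF w, of t e s] y(1) w' t by fastforce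
    then show ?thesis using t(2) w'(3) by auto
  qed
  show ?thesis
  proof (intro bexI[of _ w'] exI[of _ i'] exI[of _ "principal e"] conjI ballI impI)
    show "principal e j = 0" if "j \<in> R w - {i}" for j
      using principal[OF e(1), of j] e(3)[OF that] by simp
    show "principal e i = 1" using principal[OF e(1), of i] e(2) by simp
    show "w' \<in> W" "i' \<notin> R w" "R w' = insert i' (R w - {i})" "cls X (principal e) = 0" "principal e i' = -1"
      by (fact w'(1) i'_notin R_w' cls_principal[OF e(1)] E_i')+
    show "y = w \<or> y = w'" if "y \<in> W" "R w - {i} \<subseteq> R y" for y
      using that by (rule third)
  qed
qed

text \<open>A ray outside the cone has a negative coordinate in the basis of the cone, and pairing
  with the dual vector \<open>e\<close> reads off this coordinate.\<close>

lemma decreasing_edge: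
  assumes w: "w \<in> W" and \<rho>: "\<rho> \<notin> R w"
  shows "\<exists>i\<in>R w. \<exists>E. cls X E = 0 \<and> (\<forall>j\<in>R w - {i}. E j = 0) \<and> E i = 1 \<and> E \<rho> < 0"
proof -
  obtain c where c: "u \<rho> = (\<Sum>v\<in>u ` R w. c v *\<^sub>R v)" using lattice_basis_expand[OF R_basis(1)[OF w]] .
  have "\<not> (\<forall>v\<in>u ` R w. 0 \<le> c v)"
  proof
    assume "\<forall>v\<in>u ` R w. 0 \<le> c v"
    then have "u \<rho> \<in> \<sigma> w"
      unfolding R_basis(2)[OF w] by (auto simp: convex_cone_hull_finite c)
    then show False using \<rho> by (simp add: mem_R_iff \<sigma>_iff)
  qed
  then obtain i where i: "i \<in> R w" "c (u i) < 0" by force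
  obtain e where e: "e \<in> lattice" "e \<bullet> u i = 1" "\<And>j. j \<in> R w - {i} \<Longrightarrow> e \<bullet> u j = 0"
    using edge_vector[OF w i(1)] by blast
  have "e \<bullet> u \<rho> = (\<Sum>j\<in>R w. c (u j) * (e \<bullet> u j))"
    unfolding c inner_sum_right by (simp add: sum.reindex inj_on_subset[OF inj_u])
  also have "\<dots> = c (u i)"
    using i(1) e(2,3) by (subst sum.remove[of _ i]) auto
  finally have "principal e \<rho> < 0" using principal[OF e(1), of \<rho>] i(2) by linarith
  moreover have "principal e j = 0" if "j \<in> R w - {i}" for j
    using principal[OF e(1), of j] e(3)[OF that] by simp
  moreover have "principal e i = 1" using principal[OF e(1), of i] e(2) by simp
  ultimately show ?thesis using i(1) cls_principal[OF e(1)] by blast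
qed

lemma fan_cone_in_R: "\<kappa> \<in> fan X \<Longrightarrow> \<exists>w\<in>W. {\<rho>. ray X \<rho> \<subseteq> \<kappa>} \<subseteq> R w"
  by (rule cone_subset_\<sigma>) (auto simp: R_def)

end

section \<open>Ideals and orders of polynomials in one variable\<close>

lemma poly_ideal_generator:
  fixes I :: "'k::field poly set"
  assumes zero: "0 \<in> I" and diff: "\<And>x y. x \<in> I \<Longrightarrow> y \<in> I \<Longrightarrow> x - y \<in> I"
    and mult: "\<And>r x. x \<in> I \<Longrightarrow> r * x \<in> I"
  obtains g where "I = {x. g dvd x}"
proof (cases "I = {0}")
  case True
  then show thesis by (intro that[of 0]) auto
next
  case False
  then obtain x\<^sub>0 where x0: "x\<^sub>0 \<in> I \<and> x\<^sub>0 \<noteq> 0" using zero by blast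
  define g where "g = arg_min degree (\<lambda>x. x \<in> I \<and> x \<noteq> 0)"
  have g: "g \<in> I" "g \<noteq> 0" and least: "\<And>x. x \<in> I \<Longrightarrow> x \<noteq> 0 \<Longrightarrow> degree g \<le> degree x"
    unfolding g_def using arg_min_nat_lemma[of "\<lambda>x. x \<in> I \<and> x \<noteq> 0", OF x0] by auto
  have "g dvd x" if x: "x \<in> I" for x
  proof (rule ccontr)
    assume "\<not> g dvd x"
    then have neq: "x mod g \<noteq> 0" by (simp add: dvd_eq_mod_eq_0)
    have "x mod g = x - (x div g) * g" by (simp add: minus_div_mult_eq_mod)
    then have "x mod g \<in> I" using diff[OF x mult[OF g(1)]] by simp
    moreover have "degree (x mod g) < degree g" using degree_mod_less[OF g(2), of x] neq by blast
    ultimately show False using least[of "x mod g"] neq by simp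
  qed
  moreover have "x \<in> I" if "g dvd x" for x
    using that mult[OF g(1)] by (auto simp: dvd_def mult.commute)
  ultimately show thesis by (intro that[of g]) blast
qed

lemma irreducible_poly_bezout:
  fixes \<pi> g :: "'k::field poly"
  assumes "irreducible \<pi>" "\<not> \<pi> dvd g"
  shows "\<exists>v. \<pi> dvd 1 - v * g"
proof -
  define I where "I = {u * \<pi> + v * g | u v. True}"
  obtain h where h: "I = {x. h dvd x}"
  proof (rule poly_ideal_generator[of I])
    show "0 \<in> I" unfolding I_def by (auto intro!: exI[of _ 0])
    show "x - y \<in> I" if xy: "x \<in> I" "y \<in> I" for x y
    proof -
      obtain u v u' v' where "x = u * \<pi> + v * g" "y = u' * \<pi> + v' * g" using xy by (auto simp: I_def)
      then have "x - y = (u - u') * \<pi> + (v - v') * g" by (simp add: algebra_simps)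
      then show ?thesis unfolding I_def by blast
    qed
    show "r * x \<in> I" if x: "x \<in> I" for r x
    proof -
      obtain u v where "x = u * \<pi> + v * g" using x by (auto simp: I_def)
      then have "r * x = (r * u) * \<pi> + (r * v) * g" by (simp add: algebra_simps)
      then show ?thesis unfolding I_def by blast
    qed
  qed
  have "\<pi> = 1 * \<pi> + 0 * g" "g = 0 * \<pi> + 1 * g" by simp_all
  then have "\<pi> \<in> I" "g \<in> I" unfolding I_def by blast+
  then have "h dvd \<pi>" "h dvd g" using h by auto
  moreover have "\<not> \<pi> dvd h" using \<open>h dvd g\<close> assms(2) dvd_trans by blast
  ultimately have "h dvd 1" using assms(1) by (meson irreducibleD')
  then have "1 \<in> I" using h by simp
  then obtain u v where "1 = u * \<pi> + v * g" unfolding I_def by blast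
  then have "1 - v * g = \<pi> * u" by (simp add: algebra_simps)
  then show ?thesis by (metis dvd_triv_left)
qed

lemma irreducible_poly_imp_prime_elem:
  fixes \<pi> :: "'k::field poly"
  assumes "irreducible \<pi>"
  shows "prime_elem \<pi>"
proof (rule prime_elemI)
  show "\<pi> \<noteq> 0" "\<not> \<pi> dvd 1" using assms by (auto simp: irreducible_def)
  fix a b assume ab: "\<pi> dvd a * b"
  show "\<pi> dvd a \<or> \<pi> dvd b"
  proof (rule disjCI)
    assume "\<not> \<pi> dvd b"
    then obtain v where v: "\<pi> dvd 1 - v * b" using irreducible_poly_bezout[OF assms] by blast
    have "a = a * (1 - v * b) + v * (a * b)" by (simp add: algebra_simps)
    then show "\<pi> dvd a" using v ab by (metis dvd_add dvd_mult)
  qed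
qed

text \<open>An inverse modulo \<open>\<pi>\<close> and one modulo \<open>\<pi> ^ e\<close> combine,
  since a product of two elements of the form \<open>1 - v * g\<close> has this form again.\<close>

lemma inverse_mod_prime_power:
  fixes \<pi> g :: "'k::field poly"
  assumes "prime_elem \<pi>" "\<not> \<pi> dvd g"
  shows "\<exists>v. \<pi> ^ e dvd 1 - v * g"
proof (induction e)
  case 0
  show ?case by simp
next
  case (Suc e)
  then obtain v where v: "\<pi> ^ e dvd 1 - v * g" by blast
  obtain w where w: "\<pi> dvd 1 - w * g"
    using irreducible_poly_bezout[OF prime_elem_imp_irreducible[OF assms(1)] assms(2)] by blast
  have "(1 - w * g) * (1 - v * g) = 1 - (v + w - v * w * g) * g" by (simp add: algebra_simps)
  then have "\<pi> ^ Suc e dvd 1 - (v + w - v * w * g) * g"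
    using mult_dvd_mono[OF w v] by simp
  then show ?case by blast
qed

lemma prime_power_dvd_cancel:
  fixes \<pi> g x :: "'k::field poly"
  assumes "prime_elem \<pi>" "\<not> \<pi> dvd g" "\<pi> ^ e dvd x * g"
  shows "\<pi> ^ e dvd x"
proof -
  obtain v where v: "\<pi> ^ e dvd 1 - v * g" using inverse_mod_prime_power[OF assms(1,2)] by blast
  have "x = x * (1 - v * g) + v * (x * g)" by (simp add: algebra_simps)
  then show ?thesis using v assms(3) by (metis dvd_add dvd_mult)
qed

section \<open>Orders at the closed points of the affine line\<close>

definition monic_primes :: "'k::field poly set"
  where "monic_primes = {\<pi>. prime_elem \<pi> \<and> lead_coeff \<pi> = 1}"

lemma monic_dvd_antisym:
  fixes p q :: "'k::field poly"
  assumes "p dvd q" "q dvd p" "lead_coeff p = 1" "lead_coeff q = 1"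
  shows "p = q"
proof -
  obtain r where r: "q = p * r" using assms(1) by (auto simp: dvd_def)
  have nz: "p \<noteq> 0" "q \<noteq> 0" using assms(3,4) by auto
  have "degree p = degree q" using dvd_imp_degree_le[OF assms(1)] dvd_imp_degree_le[OF assms(2)] nz by simp
  moreover have "r \<noteq> 0" using r nz by auto
  ultimately have "degree r = 0" using r nz degree_mult_eq[of p r] by simp
  then obtain c where c: "r = [:c:]" by (rule degree_eq_zeroE)
  have "lead_coeff q = lead_coeff p * lead_coeff r" unfolding r by (rule lead_coeff_mult)
  then have "c = 1" using assms(3,4) c by simp
  then show ?thesis using r c by simp
qed

lemma normalize_prime:
  fixes \<pi> :: "'k::field poly"
  assumes "prime_elem \<pi>"
  obtains \<pi>' where "\<pi>' \<in> monic_primes" "\<And>x. \<pi>' dvd x \<longleftrightarrow> \<pi> dvd x"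
proof -
  have nz: "lead_coeff \<pi> \<noteq> 0" using assms by auto
  let ?p = "smult (inverse (lead_coeff \<pi>)) \<pi>"
  have dvd: "?p dvd x \<longleftrightarrow> \<pi> dvd x" for x using nz by (simp add: smult_dvd_iff)
  have dvd': "x dvd ?p \<longleftrightarrow> x dvd \<pi>" for x using nz by (simp add: dvd_smult_iff)
  have "prime_elem ?p"
    using assms nz unfolding prime_elem_def dvd by simp
  moreover have "lead_coeff ?p = 1" using nz by simp
  ultimately show thesis using dvd by (intro that[of ?p]) (auto simp: monic_primes_def)
qed

lemma exists_prime_factor:
  fixes F :: "'k::field poly"
  assumes "degree F > 0"
  obtains \<pi> where "\<pi> \<in> monic_primes" "\<pi> dvd F"
proof -
  define p where "p = arg_min degree (\<lambda>x. x dvd F \<and> degree x > 0)"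
  have p: "p dvd F" "degree p > 0" and least: "\<And>x. x dvd F \<Longrightarrow> degree x > 0 \<Longrightarrow> degree p \<le> degree x"
    unfolding p_def using arg_min_nat_lemma[of "\<lambda>x. x dvd F \<and> degree x > 0" F] assms by auto
  have "irreducible p"
  proof (rule irreducibleI)
    show "p \<noteq> 0" using p(2) by auto
    show "\<not> p dvd 1" using p(2) is_unit_iff_degree[of p] by (cases "p = 0") auto
    fix a b assume ab: "p = a * b"
    have nz: "a \<noteq> 0" "b \<noteq> 0" using ab p(2) by auto
    then have deg: "degree p = degree a + degree b" using ab degree_mult_eq by blast
    show "a dvd 1 \<or> b dvd 1"
    proof (rule ccontr)
      assume "\<not> (a dvd 1 \<or> b dvd 1)"
      then have pos: "degree a > 0" "degree b > 0" using nz by (auto simp: is_unit_iff_degree)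
      moreover have "a dvd F" using ab p(1) by (metis dvd_trans dvd_triv_left)
      ultimately show False using least[of a] deg by simp
    qed
  qed
  then obtain \<pi> where "\<pi> \<in> monic_primes" "\<And>x. \<pi> dvd x \<longleftrightarrow> p dvd x"
    using normalize_prime[OF irreducible_poly_imp_prime_elem] by blast
  then show thesis using p(1) that by blast
qed

definition order_at :: "'k::field poly \<Rightarrow> 'k poly \<Rightarrow> nat"
  where "order_at \<pi> F = (THE e. \<exists>\<psi>. F = \<pi> ^ e * \<psi> \<and> \<not> \<pi> dvd \<psi>)"

lemma order_at_eqI:
  assumes "\<pi> \<noteq> 0" "F = \<pi> ^ e * \<psi>" "\<not> \<pi> dvd \<psi>"
  shows "order_at \<pi> F = e"
  unfolding order_at_def
proof (rule the_equality)
  fix e' assume "\<exists>\<psi>'. F = \<pi> ^ e' * \<psi>' \<and> \<not> \<pi> dvd \<psi>'"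
  then obtain \<psi>' where \<psi>': "F = \<pi> ^ e' * \<psi>'" "\<not> \<pi> dvd \<psi>'" by blast
  have False if le: "a < b" and eq: "\<pi> ^ a * x = \<pi> ^ b * y" "\<not> \<pi> dvd x" for a b :: nat and x y
  proof -
    obtain c where "b = a + Suc c" using less_imp_Suc_add[OF le] by auto
    then have "\<pi> ^ a * x = \<pi> ^ a * (\<pi> * \<pi> ^ c * y)" using eq(1) by (simp add: power_add mult.assoc)
    then have "x = \<pi> * (\<pi> ^ c * y)" using assms(1) by (simp add: mult.assoc)
    then show False using eq(2) by (metis dvd_triv_left)
  qed
  then show "e' = e" using assms \<psi>' by (metis nat_neq_iff)
qed (use assms in blast)

lemma order_at_decompose:
  fixes F :: "'k::field poly"
  assumes "F \<noteq> 0" "prime_elem \<pi>"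
  obtains \<psi> where "F = \<pi> ^ order_at \<pi> F * \<psi>" "\<not> \<pi> dvd \<psi>"
proof -
  have deg: "0 < degree \<pi>" using assms(2) by (metis is_unit_iff_degree neq0_conv prime_elem_not_unit prime_elem_not_zeroI)
  have "\<exists>e \<psi>. F = \<pi> ^ e * \<psi> \<and> \<not> \<pi> dvd \<psi>"
    using assms(1)
  proof (induction "degree F" arbitrary: F rule: less_induct)
    case less
    show ?case
    proof (cases "\<pi> dvd F")
      case False
      then show ?thesis by (intro exI[of _ 0] exI[of _ F]) simp
    next
      case True
      then obtain G where G: "F = \<pi> * G" by (auto simp: dvd_def)
      then have "G \<noteq> 0" "\<pi> \<noteq> 0" using less.prems by auto
      then obtain e \<psi> where "G = \<pi> ^ e * \<psi>" "\<not> \<pi> dvd \<psi>"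
        using less.hyps[of G] G deg by (auto simp: degree_mult_eq)
      then show ?thesis using G by (intro exI[of _ "Suc e"] exI[of _ \<psi>]) (simp add: mult.assoc)
    qed
  qed
  then obtain e \<psi> where *: "F = \<pi> ^ e * \<psi>" "\<not> \<pi> dvd \<psi>" by blast
  moreover have "order_at \<pi> F = e" using order_at_eqI[OF _ *] assms(2) by auto
  ultimately show thesis by (intro that[of \<psi>]) simp_all
qed

lemma order_at_mult:
  fixes F G :: "'k::field poly"
  assumes "F \<noteq> 0" "G \<noteq> 0" "prime_elem \<pi>"
  shows "order_at \<pi> (F * G) = order_at \<pi> F + order_at \<pi> G"
proof -
  obtain \<psi> where F: "F = \<pi> ^ order_at \<pi> F * \<psi>" "\<not> \<pi> dvd \<psi>"
    using order_at_decompose[OF assms(1,3)] .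
  obtain \<theta> where G: "G = \<pi> ^ order_at \<pi> G * \<theta>" "\<not> \<pi> dvd \<theta>"
    using order_at_decompose[OF assms(2,3)] .
  have "F * G = \<pi> ^ (order_at \<pi> F + order_at \<pi> G) * (\<psi> * \<theta>)"
    by (subst F(1), subst G(1)) (simp add: power_add)
  moreover have "\<not> \<pi> dvd \<psi> * \<theta>" using F(2) G(2) assms(3) by (simp add: prime_elem_dvd_mult_iff)
  ultimately show ?thesis using assms(3) by (intro order_at_eqI) auto
qed

text \<open>Splitting off one prime factor at a time. The formula is stated for all finite
  \<open>T\<close> above a threshold \<open>T\<^sub>0\<close>, so that it can be compared with the
  finite partial sums in \<open>zeros_degree\<close>.\<close>

lemma sum_order_degree:
  fixes F :: "'k::field poly"
  assumes "F \<noteq> 0"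
  shows "\<exists>T\<^sub>0\<subseteq>monic_primes. finite T\<^sub>0 \<and> (\<forall>T\<subseteq>monic_primes. finite T \<longrightarrow> T\<^sub>0 \<subseteq> T \<longrightarrow>
    (\<Sum>\<pi>\<in>T. order_at \<pi> F * degree \<pi>) = degree F)"
  using assms
proof (induction "degree F" arbitrary: F rule: less_induct)
  case less
  show ?case
  proof (cases "degree F = 0")
    case True
    then have unit: "F dvd 1" using less.prems by (simp add: is_unit_iff_degree)
    have "order_at \<pi> F = 0" if "\<pi> \<in> monic_primes" for \<pi>
    proof (rule order_at_eqI)
      show "\<not> \<pi> dvd F" using that unit dvd_trans by (auto simp: monic_primes_def prime_elem_def)
    qed (use that in \<open>auto simp: monic_primes_def\<close>)
    then have "(\<Sum>\<pi>\<in>T. order_at \<pi> F * degree \<pi>) = degree F" if "T \<subseteq> monic_primes" for T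
      using True that by (simp add: subset_iff)
    then show ?thesis by (intro exI[of _ "{}"]) simp
  next
    case False
    then obtain \<pi> where \<pi>: "\<pi> \<in> monic_primes" "\<pi> dvd F" using exists_prime_factor[of F] by auto
    then obtain G where G: "F = \<pi> * G" by (auto simp: dvd_def)
    have pr: "prime_elem \<pi>" "lead_coeff \<pi> = 1" using \<pi>(1) by (auto simp: monic_primes_def)
    have nz: "G \<noteq> 0" "\<pi> \<noteq> 0" using less.prems G by auto
    have deg_\<pi>: "0 < degree \<pi>" using pr(1) nz by (metis is_unit_iff_degree neq0_conv prime_elem_not_unit)
    have deg: "degree F = degree \<pi> + degree G" using G nz by (simp add: degree_mult_eq)
    have "\<exists>T\<^sub>0\<subseteq>monic_primes. finite T\<^sub>0 \<and> (\<forall>T\<subseteq>monic_primes. finite T \<longrightarrow> T\<^sub>0 \<subseteq> T \<longrightarrow>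
        (\<Sum>\<pi>\<in>T. order_at \<pi> G * degree \<pi>) = degree G)"
      using deg deg_\<pi> nz(1) by (intro less.hyps) auto
    then obtain T\<^sub>0 where T0: "T\<^sub>0 \<subseteq> monic_primes" "finite T\<^sub>0"
        "\<forall>T\<subseteq>monic_primes. finite T \<longrightarrow> T\<^sub>0 \<subseteq> T \<longrightarrow> (\<Sum>\<pi>\<in>T. order_at \<pi> G * degree \<pi>) = degree G"
      by (elim exE conjE)
    have order: "order_at \<pi>' F = (if \<pi>' = \<pi> then 1 else 0) + order_at \<pi>' G" if "\<pi>' \<in> monic_primes" for \<pi>'
    proof -
      have pr': "prime_elem \<pi>'" "lead_coeff \<pi>' = 1" using that by (auto simp: monic_primes_def)
      have "order_at \<pi>' \<pi> = (if \<pi>' = \<pi> then 1 else 0)"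
      proof (cases "\<pi>' = \<pi>")
        case True
        then show ?thesis using pr(1) nz(2) by (simp add: order_at_eqI[of _ _ 1 1] prime_elem_not_unit)
      next
        case False
        have "\<not> \<pi>' dvd \<pi>"
        proof
          assume *: "\<pi>' dvd \<pi>"
          then have "\<pi> dvd \<pi>'"
            using prime_elem_imp_irreducible[OF pr(1)] pr'(1) by (meson irreducibleD' prime_elem_not_unit)
          then show False using monic_dvd_antisym[OF * _ pr'(2) pr(2)] False by blast
        qed
        then show ?thesis using False pr'(1) by (auto simp: order_at_eqI[of _ _ 0 \<pi>])
      qed
      then show ?thesis unfolding G using pr'(1) nz by (simp add: order_at_mult)
    qed
    show ?thesis
    proof (intro exI[of _ "insert \<pi> T\<^sub>0"] conjI allI impI)
      fix T assume T: "T \<subseteq> monic_primes" "finite T" "insert \<pi> T\<^sub>0 \<subseteq> T"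
      have "(\<Sum>\<pi>'\<in>T. order_at \<pi>' F * degree \<pi>')
          = (\<Sum>\<pi>'\<in>T. (if \<pi>' = \<pi> then degree \<pi>' else 0) + order_at \<pi>' G * degree \<pi>')"
        using T(1) order by (intro sum.cong) (auto simp: algebra_simps)
      also have "\<dots> = degree \<pi> + degree G"
        using T T0(3) by (simp add: sum.distrib)
      finally show "(\<Sum>\<pi>'\<in>T. order_at \<pi>' F * degree \<pi>') = degree F" using deg by simp
    qed (use T0 \<pi> in auto)
  qed
qed

section \<open>Dimension of a quotient\<close>

lemma vector_space_smult: "vector_space (smult :: 'k::field \<Rightarrow> 'k poly \<Rightarrow> 'k poly)"
  by unfold_locales (simp_all add: smult_add_left smult_add_right)

lemma linear_relation_exists:
  fixes r :: "nat \<Rightarrow> 'k::field poly"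
  assumes deg: "\<And>i j. i < l \<Longrightarrow> j \<ge> d \<Longrightarrow> coeff (r i) j = 0" and "d < l"
  obtains c where "(\<Sum>i<l. smult (c i) (r i)) = 0" "\<exists>i<l. c i \<noteq> 0"
proof -
  interpret vs: vector_space "smult :: 'k \<Rightarrow> 'k poly \<Rightarrow> 'k poly" by (rule vector_space_smult)
  show thesis
  proof (cases "inj_on r {..<l}")
    \<comment> \<open>Families instead of sets: a repeated entry already gives a relation with
      coefficients 1 and -1.\<close>
    case False
    then obtain i j where ij: "i < l" "j < l" "i \<noteq> j" "r i = r j" by (auto simp: inj_on_def)
    define c where "c k = (if k = i then 1 else if k = j then -1 else 0 :: 'k)" for k
    have "(\<Sum>k<l. smult (c k) (r k)) = (\<Sum>k\<in>{i, j}. smult (c k) (r k))"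
      using ij by (intro sum.mono_neutral_right) (auto simp: c_def)
    also have "\<dots> = 0" using ij by (simp add: c_def)
    finally show thesis using ij(1) by (intro that[of c]) (auto simp: c_def intro!: exI[of _ i])
  next
    case True
    have span: "r ` {..<l} \<subseteq> vs.span ((\<lambda>j. monom 1 j) ` {..<d})"
    proof clarify
      fix i assume i: "i < l"
      have "r i = (\<Sum>j<d. smult (coeff (r i) j) (monom 1 j))"
        using deg[OF i] by (intro poly_eqI) (simp add: coeff_sum coeff_monom if_distrib not_less cong: if_cong)
      also have "\<dots> \<in> vs.span ((\<lambda>j. monom 1 j) ` {..<d})"
        by (intro vs.span_sum vs.span_scale vs.span_base) auto
      finally show "r i \<in> vs.span ((\<lambda>j. monom 1 j) ` {..<d})" .
    qed
    have "card ((\<lambda>j. monom 1 j :: 'k poly) ` {..<d}) \<le> d" using card_image_le[of "{..<d}"] by simp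
    moreover have "card (r ` {..<l}) = l" using True by (simp add: card_image)
    ultimately have "vs.dependent (r ` {..<l})"
      using vs.independent_span_bound[OF _ _ span] \<open>d < l\<close> by fastforce
    then obtain u where u: "\<exists>v\<in>r ` {..<l}. u v \<noteq> 0" "(\<Sum>v\<in>r ` {..<l}. smult (u v) v) = 0"
      by (auto simp: vs.dependent_finite)
    have "(\<Sum>i<l. smult (u (r i)) (r i)) = 0" using u(2) True by (simp add: sum.reindex)
    then show thesis using u(1) by (intro that[of "\<lambda>i. u (r i)"]) auto
  qed
qed

text \<open>
  \<open>rel\<close> is the graph, modulo \<open>m\<close>, of a surjection \<open>A \<rightarrow> K[t] / (m)\<close> with kernel \<open>J\<close>.
\<close>

lemma quotient_dim_eq_degree:
  fixes A J :: "('r::{finite,linorder}, 'k::field) cox fract set" and m :: "'k poly"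
  defines "sc c x \<equiv> Fract (Poly_Mapping.single 0 c) 1 * x"
  assumes m: "m \<noteq> 0"
    and total: "\<And>x. x \<in> A \<Longrightarrow> \<exists>r. rel x r"
    and unique: "\<And>x r r'. rel x r \<Longrightarrow> rel x r' \<Longrightarrow> m dvd r - r'"
    and zero: "rel 0 0"
    and add: "\<And>x y r q. rel x r \<Longrightarrow> rel y q \<Longrightarrow> rel (x + y) (r + q)"
    and scale: "\<And>c x r. rel x r \<Longrightarrow> rel (sc c x) (smult c r)"
    and reduce: "\<And>x r. rel x r \<Longrightarrow> rel x (r mod m)"
    and kernel: "\<And>x r. rel x r \<Longrightarrow> x \<in> J \<longleftrightarrow> rel x 0"
    and onto: "\<And>r. \<exists>x\<in>A. rel x r"
  shows "quotient_dim A J = enat (degree m)"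
proof -
  have rel_sum: "rel (\<Sum>i<l. sc (c i) (xs i)) (\<Sum>i<l. smult (c i) (r i))"
    if "\<And>i. i < l \<Longrightarrow> rel (xs i) (r i)" for l :: nat and c xs r
    using that by (induction l) (auto intro!: zero add scale)
  have mem_J: "x \<in> J \<longleftrightarrow> m dvd r" if "rel x r" for x r
  proof
    assume "x \<in> J"
    then show "m dvd r" using unique[OF that, of 0] kernel[OF that] by simp
  next
    assume "m dvd r"
    then have "rel x 0" using reduce[OF that] by (simp add: dvd_eq_mod_eq_0)
    then show "x \<in> J" using kernel[OF that] by simp
  qed
  let ?ind = "\<lambda>xs. \<forall>c :: nat \<Rightarrow> 'k. (\<Sum>i<length xs. sc (c i) (xs ! i)) \<in> J \<longrightarrow> (\<forall>i<length xs. c i = 0)"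
  have upper: "length xs \<le> degree m" if xs: "set xs \<subseteq> A" "?ind xs" for xs
  proof (rule ccontr)
    assume "\<not> length xs \<le> degree m"
    then have less: "degree m < length xs" by simp
    \<comment> \<open>Remainders modulo \<open>m\<close> live in a space of dimension
      \<open>degree m\<close>, so a longer list has a linear relation among its images.\<close>
    have "\<exists>r. rel (xs ! i) (r mod m)" if "i < length xs" for i
      using total[of "xs ! i"] reduce xs(1) that nth_mem by blast
    then obtain r where r: "\<And>i. i < length xs \<Longrightarrow> rel (xs ! i) (r i mod m)" by metis
    have coeff0: "coeff (r i mod m) j = 0" if "j \<ge> degree m" for i j
      using degree_mod_less[OF m, of "r i"] that by (auto intro: coeff_eq_0)
    then obtain c where c: "(\<Sum>i<length xs. smult (c i) (r i mod m)) = 0" "\<exists>i<length xs. c i \<noteq> 0"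
      by (rule linear_relation_exists[OF _ less, of "\<lambda>i. r i mod m"]) (simp add: coeff0)
    have "rel (\<Sum>i<length xs. sc (c i) (xs ! i)) (\<Sum>i<length xs. smult (c i) (r i mod m))"
      by (rule rel_sum) (rule r)
    then have "(\<Sum>i<length xs. sc (c i) (xs ! i)) \<in> J"
      using mem_J unfolding c(1) by blast
    then show False using xs(2) c(2) by blast
  qed
  have "\<forall>j. \<exists>x. x \<in> A \<and> rel x (monom 1 j)" using onto by blast
  then have "\<exists>x. \<forall>j. x j \<in> A \<and> rel (x j) (monom 1 j)" by (rule choice)
  then obtain x where x: "\<And>j. x j \<in> A" "\<And>j. rel (x j) (monom 1 j)" by blast
  \<comment> \<open>Preimages of \<open>1, t, ..., t^(degree m - 1)\<close>, a basis of
    \<open>K[t] / (m)\<close>.\<close>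
  let ?xs = "map x [0..<degree m]"
  have ind: "?ind ?xs"
  proof (intro allI impI)
    fix c :: "nat \<Rightarrow> 'k" and i
    assume J: "(\<Sum>i<length ?xs. sc (c i) (?xs ! i)) \<in> J" and i: "i < length ?xs"
    let ?s = "\<Sum>j<degree m. smult (c j) (monom 1 j)"
    have "(\<Sum>j<degree m. sc (c j) (x j)) \<in> J" using J by simp
    moreover have "rel (\<Sum>j<degree m. sc (c j) (x j)) ?s" by (rule rel_sum) (rule x(2))
    ultimately have "m dvd ?s" using mem_J by blast
    moreover have coeff: "coeff ?s j = (if j < degree m then c j else 0)" for j
      by (simp add: coeff_sum coeff_monom if_distrib cong: if_cong)
    ultimately have "?s = 0"
      using dvd_imp_degree_le[of m ?s] coeff_eq_0 leading_coeff_0_iff by (metis not_less)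
    then show "c i = 0" using coeff[of i] i by simp
  qed
  show ?thesis
    unfolding quotient_dim_def sc_def[symmetric]
  proof (rule antisym)
    show "(SUP xs\<in>{xs. set xs \<subseteq> A \<and> ?ind xs}. enat (length xs)) \<le> enat (degree m)"
      using upper by (intro SUP_least) auto
    have "?xs \<in> {xs. set xs \<subseteq> A \<and> ?ind xs}" using ind x(1) by auto
    then have "enat (length ?xs) \<le> (SUP xs\<in>{xs. set xs \<subseteq> A \<and> ?ind xs}. enat (length xs))"
      by (rule SUP_upper)
    then show "enat (degree m) \<le> (SUP xs\<in>{xs. set xs \<subseteq> A \<and> ?ind xs}. enat (length xs))" by simp
  qed
qed

section \<open>Basepoint free classes\<close>

lemma poly_mapping_sum_single: "p = (\<Sum>m\<in>Poly_Mapping.keys p. Poly_Mapping.single m (Poly_Mapping.lookup p m))"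
  by (rule poly_mapping_eqI) (simp add: lookup_sum lookup_single when_def in_keys_iff)

lemma cox_var_power: "(cox_var \<rho> :: ('r::{finite,linorder}, 'k::field) cox) ^ n = Poly_Mapping.single (Poly_Mapping.single \<rho> n) 1"
proof (induction n)
  case (Suc n)
  then show ?case by (simp add: cox_var_def mult_single flip: single_add)
qed simp

lemma monomial_eq_prod:
  "Poly_Mapping.single m (1::'k::field) = (\<Prod>\<rho>\<in>UNIV. (cox_var \<rho> :: ('r::{finite,linorder}, 'k) cox) ^ Poly_Mapping.lookup m \<rho>)"
proof -
  have "(\<Prod>\<rho>\<in>S. (cox_var \<rho> :: ('r, 'k) cox) ^ Poly_Mapping.lookup m \<rho>)
      = Poly_Mapping.single (\<Sum>\<rho>\<in>S. Poly_Mapping.single \<rho> (Poly_Mapping.lookup m \<rho>)) 1" if "finite S" for S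
    using that by (induction S rule: finite_induct) (simp_all add: cox_var_power mult_single)
  moreover have "(\<Sum>\<rho>\<in>UNIV. Poly_Mapping.single \<rho> (Poly_Mapping.lookup m \<rho>)) = m"
    by (rule poly_mapping_eqI) (simp add: lookup_sum lookup_single when_def)
  ultimately show ?thesis by simp
qed

text \<open>\<open>nat\<close> truncates negative coefficients, so this monomial has the class of
  \<open>D\<close> for effective \<open>D\<close>, as in
  \<open>monomial_in_cox_part\<close>.\<close>

definition exponents :: "('r::finite \<Rightarrow> int) \<Rightarrow> 'r \<Rightarrow>\<^sub>0 nat"
  where "exponents D = Poly_Mapping.Abs_poly_mapping (\<lambda>\<rho>. nat (D \<rho>))"

lemma lookup_exponents [simp]: "Poly_Mapping.lookup (exponents D) \<rho> = nat (D \<rho>)"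
  by (simp add: exponents_def)

lemma module_cox: "module ((*) :: 'a::comm_ring_1 \<Rightarrow> 'a \<Rightarrow> 'a)"
  by unfold_locales (simp_all add: algebra_simps)

section \<open>Homogeneous components\<close>

context cls_additive
begin

lemma cls_diff: "cls X (\<lambda>\<rho>. D \<rho> - E \<rho>) = cls X D - cls X E"
  using cls_add[of "\<lambda>\<rho>. D \<rho> - E \<rho>" E] by simp

lemma cls_scale_nat: "cls X (\<lambda>\<rho>. int n * D \<rho>) = nmul n (cls X D)"
proof (induction n)
  case 0
  then show ?case by (simp add: cls_zero)
next
  case (Suc n)
  then show ?case using cls_add[of "\<lambda>\<rho>. int n * D \<rho>" D] by (simp add: algebra_simps)
qed

lemma cls_scale_principal: "cls X E = 0 \<Longrightarrow> cls X (\<lambda>\<rho>. k * E \<rho>) = 0"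
  using cls_scale_nat[of "nat \<bar>k\<bar>" E] cls_diff[of "\<lambda>\<rho>. 0" "\<lambda>\<rho>. int (nat \<bar>k\<bar>) * E \<rho>"]
  by (cases "0 \<le> k") (simp_all add: cls_zero nmul_def)

lemma monomial_in_cox_part:
  assumes "\<And>\<rho>. 0 \<le> D \<rho>"
  shows "Poly_Mapping.single (exponents D) c \<in> cox_part X (cls X D)"
  using assms by (simp add: cox_part_def monomial_degree_def)

definition component :: "'p \<Rightarrow> ('r, 'k::field) cox \<Rightarrow> ('r, 'k) cox"
  where "component a p = (\<Sum>m | m \<in> Poly_Mapping.keys p \<and> monomial_degree X m = a.
    Poly_Mapping.single m (Poly_Mapping.lookup p m))"

lemma lookup_component:
  "Poly_Mapping.lookup (component a p) m = (if monomial_degree X m = a then Poly_Mapping.lookup p m else 0)"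
proof -
  have "finite {m \<in> Poly_Mapping.keys p. monomial_degree X m = a}" by simp
  then show ?thesis
    by (simp add: component_def lookup_sum lookup_single when_def in_keys_iff)
qed

lemma component_in_cox_part: "component a p \<in> cox_part X a"
  by (auto simp: cox_part_def in_keys_iff lookup_component split: if_splits)

lemma component_homogeneous: "p \<in> cox_part X b \<Longrightarrow> component a p = (if a = b then p else 0)"
  by (rule poly_mapping_eqI) (auto simp: cox_part_def lookup_component in_keys_iff)

lemma component_add: "component a (p + q) = component a p + component a q"
  and component_zero [simp]: "component a 0 = 0"
  by (rule poly_mapping_eqI, simp add: lookup_component lookup_add)+

lemma component_sum: "component a (sum f I) = (\<Sum>i\<in>I. component a (f i))"
  by (induction I rule: infinite_finite_induct) (simp_all add: component_add)

definition degrees :: "('r, 'k::field) cox \<Rightarrow> 'p set"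
  where "degrees p = monomial_degree X ` Poly_Mapping.keys p"

lemma finite_degrees: "finite (degrees p)"
  by (simp add: degrees_def)

lemma component_nonzero_degree: "component a p \<noteq> 0 \<Longrightarrow> a \<in> degrees p"
proof (rule ccontr)
  assume "a \<notin> degrees p"
  then have "component a p = 0"
    by (intro poly_mapping_eqI) (auto simp: lookup_component degrees_def in_keys_iff)
  then show "component a p \<noteq> 0 \<Longrightarrow> False" by simp
qed

lemma sum_components: "p = (\<Sum>a\<in>degrees p. component a p)"
  by (rule poly_mapping_eqI)
    (auto simp: lookup_sum lookup_component degrees_def in_keys_iff intro: finite_subset[OF _ finite_degrees])

lemma component_mult_homogeneous:
  assumes "q \<in> cox_part X b"
  shows "component c (p * q) = component (c - b) p * q"
proof -
  have "component c (p * q) = (\<Sum>a\<in>degrees p. component c (component a p * q))"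
    by (subst sum_components[of p]) (simp add: sum_distrib_right component_sum)
  also have "\<dots> = (\<Sum>a\<in>degrees p. if a = c - b then component a p * q else 0)"
    using component_homogeneous[OF cox_part_mult[OF component_in_cox_part assms]]
    by (intro sum.cong) auto
  also have "\<dots> = component (c - b) p * q"
    using component_nonzero_degree[of "c - b" p] by (auto simp: finite_degrees)
  finally show ?thesis .
qed

lemma component_mult:
  "component c (p * q) = (\<Sum>a\<in>degrees p. component a p * component (c - a) q)"
proof -
  have "component c (p * q) = (\<Sum>a\<in>degrees p. component c (component a p * q))"
    by (subst sum_components[of p]) (simp add: sum_distrib_right component_sum)
  also have "\<dots> = (\<Sum>a\<in>degrees p. component c (q * component a p))"
    by (simp add: mult.commute)
  also have "\<dots> = (\<Sum>a\<in>degrees p. component a p * component (c - a) q)"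
    using component_mult_homogeneous[OF component_in_cox_part] by (intro sum.cong) (auto simp: mult.commute)
  finally show ?thesis .
qed

text \<open>The elements all of whose components lie in \<open>P\<close> form an ideal that contains
  the homogeneous generators of \<open>P\<close>.\<close>

lemma homogeneous_ideal_component:
  assumes P: "module.subspace (*) P" "P = module.span (*) {p \<in> P. \<exists>a. p \<in> cox_part X a}" and p: "p \<in> P"
  shows "component a p \<in> (P :: ('r, 'k::field) cox set)"
proof -
  interpret S: module "(*) :: ('r, 'k) cox \<Rightarrow> _" by (rule module_cox)
  let ?T = "{p. \<forall>a. component a p \<in> P}"
  have "S.subspace ?T"
  proof (rule S.subspaceI)
    show "0 \<in> ?T" using S.subspace_0[OF P(1)] by simp
    show "x + y \<in> ?T" if "x \<in> ?T" "y \<in> ?T" for x y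
      using that S.subspace_add[OF P(1)] by (simp add: component_add)
    show "c * x \<in> ?T" if "x \<in> ?T" for c x
      unfolding mem_Collect_eq component_mult using that
      by (intro allI S.subspace_sum[OF P(1)] S.subspace_scale[OF P(1)]) simp
  qed
  moreover have "{p \<in> P. \<exists>a. p \<in> cox_part X a} \<subseteq> ?T"
  proof clarify
    fix x a b assume "x \<in> P" "x \<in> cox_part X b"
    then show "component a x \<in> P"
      using component_homogeneous[of x b a] S.subspace_0[OF P(1)] by (cases "a = b") auto
  qed
  ultimately have "S.span {p \<in> P. \<exists>a. p \<in> cox_part X a} \<subseteq> ?T" by (rule S.span_minimal[rotated])
  then show ?thesis using p P(2) by blast
qed

end

text \<open>
  \<open>\<M>\<close> is the set of maximal cones, given by their rays, \<open>H\<close> an ample class, and the divisors \<open>E\<close> are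
  those of characters. In \<open>adjacent\<close> the cone crosses a wall; in \<open>decreasing\<close> the wall is one
  that separates the cone from the ray \<open>\<rho>\<close>.
\<close>

locale maximal_cones = cls_additive X
  for X :: "('n::finite, 'r::{finite,linorder}, 'p::ab_group_add) toric" +
  fixes \<M> :: "'r set set" and H :: 'p
  assumes cls_surj: "surj (cls X)"
    and fan_finite: "finite (fan X)"
    and \<M>_nonempty: "\<M> \<noteq> {}"
    and representative: "A \<in> \<M> \<Longrightarrow> \<exists>!D. cls X D = a \<and> (\<forall>\<rho>\<in>A. D \<rho> = 0)"
    and ample: "A \<in> \<M> \<Longrightarrow> \<exists>D. cls X D = H \<and> (\<forall>\<rho>\<in>A. D \<rho> = 0) \<and> (\<forall>\<rho>. \<rho> \<notin> A \<longrightarrow> 0 < D \<rho>)"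
    and adjacent: "A \<in> \<M> \<Longrightarrow> i \<in> A \<Longrightarrow> \<exists>i' E. i' \<notin> A \<and> insert i' (A - {i}) \<in> \<M> \<and> cls X E = 0 \<and>
      (\<forall>j\<in>A - {i}. E j = 0) \<and> E i = 1 \<and> E i' = -1 \<and>
      (\<forall>B\<in>\<M>. A - {i} \<subseteq> B \<longrightarrow> B = A \<or> B = insert i' (A - {i}))"
    and decreasing: "A \<in> \<M> \<Longrightarrow> \<rho> \<notin> A \<Longrightarrow>
      \<exists>i\<in>A. \<exists>E. cls X E = 0 \<and> (\<forall>j\<in>A - {i}. E j = 0) \<and> E i = 1 \<and> E \<rho> < 0"
    and cone_subset: "\<kappa> \<in> fan X \<Longrightarrow> \<exists>A\<in>\<M>. {\<rho>. ray X \<rho> \<subseteq> \<kappa>} \<subseteq> A"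
    and maximal_cone: "A \<in> \<M> \<Longrightarrow> \<exists>\<kappa>\<in>fan X. {\<rho>. ray X \<rho> \<subseteq> \<kappa>} = A"
begin

text \<open>The divisor of the rational monomial that trivializes the class \<open>a\<close> on the
  chart of \<open>A\<close>; it is effective iff that monomial is a section.\<close>

definition rep :: "'r set \<Rightarrow> 'p \<Rightarrow> 'r \<Rightarrow> int"
  where "rep A a = (THE D. cls X D = a \<and> (\<forall>\<rho>\<in>A. D \<rho> = 0))"

lemma cls_rep: "A \<in> \<M> \<Longrightarrow> cls X (rep A a) = a"
  and rep_zero_on: "A \<in> \<M> \<Longrightarrow> \<rho> \<in> A \<Longrightarrow> rep A a \<rho> = 0"
  using theI'[OF representative, of A a] by (auto simp: rep_def)

lemma rep_eqI: "A \<in> \<M> \<Longrightarrow> cls X D = a \<Longrightarrow> (\<And>\<rho>. \<rho> \<in> A \<Longrightarrow> D \<rho> = 0) \<Longrightarrow> rep A a = D"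
  unfolding rep_def by (rule the1_equality[OF representative]) auto

lemma rep_add: "A \<in> \<M> \<Longrightarrow> rep A (a + b) = (\<lambda>\<rho>. rep A a \<rho> + rep A b \<rho>)"
  by (rule rep_eqI) (simp_all add: cls_add cls_rep rep_zero_on)

lemma rep_nmul: "A \<in> \<M> \<Longrightarrow> rep A (nmul n a) = (\<lambda>\<rho>. int n * rep A a \<rho>)"
  by (rule rep_eqI) (simp_all add: cls_scale_nat cls_rep rep_zero_on)

lemma rep_H_pos: "A \<in> \<M> \<Longrightarrow> \<rho> \<notin> A \<Longrightarrow> 0 < rep A H \<rho>"
proof -
  assume A: "A \<in> \<M>" "\<rho> \<notin> A"
  obtain D where D: "cls X D = H" "\<forall>\<rho>\<in>A. D \<rho> = 0" "\<forall>\<rho>. \<rho> \<notin> A \<longrightarrow> 0 < D \<rho>" using ample[OF A(1)] by blast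
  have "rep A H = D" using D by (intro rep_eqI A) auto
  then show ?thesis using D(3) A(2) by simp
qed

lemma rep_principal: "A \<in> \<M> \<Longrightarrow> cls X E = 0 \<Longrightarrow> (\<And>\<rho>. \<rho> \<in> A \<Longrightarrow> E \<rho> = 0) \<Longrightarrow> E = (\<lambda>\<rho>. 0)"
  using rep_eqI[of A E 0] rep_eqI[of A "\<lambda>\<rho>. 0" 0] by (auto simp: cls_zero)

lemma rep_inj: "A \<in> \<M> \<Longrightarrow> (\<And>\<rho>. rep A a \<rho> = 0) \<Longrightarrow> a = 0"
  using cls_rep[of A a] cls_zero by (metis ext)

text \<open>Off \<open>A\<close> the integers \<open>rep A H \<rho>\<close> are at least 1, so the
  sum of all absolute values \<open>\<bar>b i A \<rho>\<bar>\<close> is a uniform bound for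
  \<open>n\<close>.\<close>

lemma rep_H_bound:
  assumes "finite F"
  obtains n\<^sub>0 where "\<And>n A \<rho> i. n \<ge> n\<^sub>0 \<Longrightarrow> A \<in> \<M> \<Longrightarrow> \<rho> \<notin> A \<Longrightarrow> i \<in> F \<Longrightarrow> (b i A \<rho> :: int) \<le> int n * rep A H \<rho>"
proof -
  define n\<^sub>0 where "n\<^sub>0 = (\<Sum>(i, A, \<rho>)\<in>F \<times> UNIV \<times> UNIV. nat \<bar>b i A \<rho>\<bar>)"
  have "b i A \<rho> \<le> int n * rep A H \<rho>" if "n \<ge> n\<^sub>0" "A \<in> \<M>" "\<rho> \<notin> A" "i \<in> F" for n A \<rho> i
  proof -
    have "nat \<bar>b i A \<rho>\<bar> \<le> n\<^sub>0"
      unfolding n\<^sub>0_def using assms that member_le_sum[of "(i, A, \<rho>)" "F \<times> UNIV \<times> UNIV" "\<lambda>(i, A, \<rho>). nat \<bar>b i A \<rho>\<bar>"]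
      by simp
    then have "b i A \<rho> \<le> int n * 1" using that(1) by linarith
    also have "\<dots> \<le> int n * rep A H \<rho>" using rep_H_pos[OF that(2,3)] by (intro mult_left_mono) auto
    finally show ?thesis .
  qed
  then show thesis using that by blast
qed

definition basepoint_free :: "'p set"
  where "basepoint_free = {a. \<forall>A\<in>\<M>. \<forall>\<rho>. 0 \<le> rep A a \<rho>}"

text \<open>
  The choice of a cone for \<open>A \<notin> \<M>\<close> only serves to make the functions additive for all indices.
\<close>

sublocale bpf: saturated_monoid "\<lambda>a (A, \<rho>). rep (if A \<in> \<M> then A else (SOME A. A \<in> \<M>)) a \<rho>" "\<M> \<times> UNIV"
proof
  have some: "(SOME A. A \<in> \<M>) \<in> \<M>" using \<M>_nonempty by (simp add: some_in_eq)
  show "finite (\<M> \<times> (UNIV :: 'r set))" by simp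
  show "(case i of (A, \<rho>) \<Rightarrow> rep (if A \<in> \<M> then A else SOME A. A \<in> \<M>) (a + b) \<rho>) =
      (case i of (A, \<rho>) \<Rightarrow> rep (if A \<in> \<M> then A else SOME A. A \<in> \<M>) a \<rho>) +
      (case i of (A, \<rho>) \<Rightarrow> rep (if A \<in> \<M> then A else SOME A. A \<in> \<M>) b \<rho>)" for a b i
    using some by (cases i) (simp add: rep_add)
  show "a = 0" if "\<And>i. i \<in> \<M> \<times> UNIV \<Longrightarrow> (case i of (A, \<rho>) \<Rightarrow> rep (if A \<in> \<M> then A else SOME A. A \<in> \<M>) a \<rho>) = 0" for a
    using some that[of "(SOME A. A \<in> \<M>, _)"] by (intro rep_inj[OF some]) auto
qed

lemma bpf_monoid: "bpf.monoid = basepoint_free"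
  by (auto simp: bpf.monoid_def basepoint_free_def)

lemma eventually_basepoint_free:
  obtains n\<^sub>0 where "\<And>n. n \<ge> n\<^sub>0 \<Longrightarrow> a + nmul n H \<in> basepoint_free"
proof -
  obtain n\<^sub>0 where n0: "\<And>n A \<rho> i. n \<ge> n\<^sub>0 \<Longrightarrow> A \<in> \<M> \<Longrightarrow> \<rho> \<notin> A \<Longrightarrow> i \<in> {()} \<Longrightarrow> - rep A a \<rho> \<le> int n * rep A H \<rho>"
    using rep_H_bound[of "{()}" "\<lambda>_ A \<rho>. - rep A a \<rho>"] by auto
  have "a + nmul n H \<in> basepoint_free" if n: "n \<ge> n\<^sub>0" for n
    unfolding basepoint_free_def
  proof (intro CollectI ballI allI)
    fix A \<rho> assume A: "A \<in> \<M>"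
    show "0 \<le> rep A (a + nmul n H) \<rho>"
    proof (cases "\<rho> \<in> A")
      case True
      then show ?thesis using A by (simp add: rep_zero_on)
    next
      case False
      then show ?thesis using n0[OF n A False] A by (simp add: rep_add rep_nmul)
    qed
  qed
  then show thesis by (rule that)
qed

text \<open>A prime that does not contain the irrelevant ideal misses some
  \<open>xhat X \<kappa>\<close>, hence every variable dividing it; enlarging
  \<open>\<kappa>\<close> to a maximal cone leaves fewer variables to avoid.\<close>

lemma toric_point_misses_cone:
  assumes "Q \<in> (toric_points X :: ('r, 'k::field) cox set set)"
  obtains A where "A \<in> \<M>" "\<And>\<rho>. \<rho> \<notin> A \<Longrightarrow> cox_var \<rho> \<notin> Q"
proof -
  interpret S: module "(*) :: ('r, 'k) cox \<Rightarrow> _" by (rule module_cox)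
  have Q: "S.subspace Q" "\<not> irrelevant_ideal X \<subseteq> Q" using assms by (auto simp: toric_points_def)
  then obtain \<kappa> where \<kappa>: "\<kappa> \<in> fan X" "xhat X \<kappa> \<notin> Q"
    unfolding irrelevant_ideal_def using S.span_minimal[OF _ Q(1)] by blast
  obtain A where A: "A \<in> \<M>" "{\<rho>. ray X \<rho> \<subseteq> \<kappa>} \<subseteq> A" using cone_subset[OF \<kappa>(1)] by blast
  have "cox_var \<rho> \<notin> Q" if "\<rho> \<notin> A" for \<rho>
  proof
    assume Q\<rho>: "cox_var \<rho> \<in> Q"
    have "(xhat X \<kappa> :: ('r, 'k) cox) = (\<Prod>\<rho>' \<in> {\<rho>'. \<not> ray X \<rho>' \<subseteq> \<kappa>} - {\<rho>}. cox_var \<rho>') * cox_var \<rho>"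
      unfolding xhat_def using that A(2) by (subst mult.commute, intro prod.remove) auto
    moreover have "(\<Prod>\<rho>' \<in> {\<rho>'. \<not> ray X \<rho>' \<subseteq> \<kappa>} - {\<rho>}. cox_var \<rho>') * cox_var \<rho> \<in> Q"
      by (rule S.subspace_scale[OF Q(1) Q\<rho>])
    ultimately have "xhat X \<kappa> \<in> Q" by simp
    then show False using \<kappa>(2) by simp
  qed
  then show thesis using A(1) that by blast
qed

lemma prime_power_mem:
  assumes "\<And>p q :: 'a::comm_ring_1. p * q \<in> Q \<Longrightarrow> p \<in> Q \<or> q \<in> Q" "1 \<notin> Q"
  shows "p ^ n \<in> Q \<Longrightarrow> p \<in> Q"
  using assms by (induction n) auto

lemma prime_prod_mem:
  assumes "\<And>p q :: 'a::comm_ring_1. p * q \<in> Q \<Longrightarrow> p \<in> Q \<or> q \<in> Q" "1 \<notin> Q" "finite S"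
  shows "prod f S \<in> Q \<Longrightarrow> \<exists>i\<in>S. f i \<in> Q"
  using assms(3) by (induction S rule: finite_induct) (use assms(1,2) in auto)

lemma monomial_notin_point:
  assumes Q: "Q \<in> (toric_points X :: ('r, 'k::field) cox set set)"
    and A: "\<And>\<rho>. \<rho> \<notin> A \<Longrightarrow> cox_var \<rho> \<notin> Q" "\<And>\<rho>. \<rho> \<in> A \<Longrightarrow> Poly_Mapping.lookup m \<rho> = 0"
  shows "Poly_Mapping.single m 1 \<notin> Q"
proof
  have pr: "\<And>p q. p * q \<in> Q \<Longrightarrow> p \<in> Q \<or> q \<in> Q" "1 \<notin> Q" using Q by (auto simp: toric_points_def)
  assume "Poly_Mapping.single m 1 \<in> Q"
  then have "(\<Prod>\<rho>\<in>UNIV. cox_var \<rho> ^ Poly_Mapping.lookup m \<rho>) \<in> Q" by (simp only: monomial_eq_prod)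
  then obtain \<rho> where \<rho>: "cox_var \<rho> ^ Poly_Mapping.lookup m \<rho> \<in> Q"
    using prime_prod_mem[of Q UNIV "\<lambda>\<rho>. cox_var \<rho> ^ Poly_Mapping.lookup m \<rho>"] pr by auto
  then have "cox_var \<rho> \<in> Q" using prime_power_mem[of Q "cox_var \<rho>"] pr by auto
  moreover have "Poly_Mapping.lookup m \<rho> \<noteq> 0" using \<rho> pr(2) by (metis power_0)
  ultimately show False using A(1)[of \<rho>] A(2)[of \<rho>] by (cases "\<rho> \<in> A") auto
qed

text \<open>The ideal generated by \<open>1\<close> is the whole ring, so every local quotient is 0:
  a nonempty list is dependent modulo the whole stalk, with coefficients
  \<open>1, 0, 0, ...\<close>.\<close>

lemma zeros_degree_one: "zeros_degree X (P :: ('r, 'k::field) cox set) 1 = 0"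
proof -
  interpret S: module "(*) :: ('r, 'k) cox \<Rightarrow> _" by (rule module_cox)
  have "1 \<in> S.span (insert 1 P)" by (simp add: S.span_base)
  then have "x \<in> S.span (insert 1 P)" for x using S.span_scale[of 1 "insert 1 P" x] by simp
  then have univ: "S.span (insert 1 P) = UNIV" by blast
  have "quotient_dim (stalk X Q UNIV) (stalk X Q UNIV) = 0" for Q :: "('r, 'k) cox set"
    unfolding quotient_dim_def
  proof (rule antisym[OF SUP_least])
    fix xs assume "xs \<in> {xs. set xs \<subseteq> stalk X Q UNIV \<and> (\<forall>c. (\<Sum>i<length xs. Fract (Poly_Mapping.single 0 (c i)) 1 * xs ! i)
        \<in> stalk X Q UNIV \<longrightarrow> (\<forall>i<length xs. c i = (0 :: 'k)))}"
    then have xs: "set xs \<subseteq> stalk X Q UNIV"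
      and ind: "\<And>c :: nat \<Rightarrow> 'k. (\<Sum>i<length xs. Fract (Poly_Mapping.single 0 (c i)) 1 * xs ! i) \<in> stalk X Q UNIV \<Longrightarrow>
        (\<forall>i<length xs. c i = 0)" by auto
    have "xs = []"
    proof (rule ccontr)
      assume "xs \<noteq> []"
      then have "0 < length xs" by simp
      define c :: "nat \<Rightarrow> 'k" where "c i = (if i = 0 then 1 else 0)" for i
      have "(\<Sum>i<length xs. Fract (Poly_Mapping.single 0 (c i)) 1 * xs ! i)
          = (\<Sum>i<length xs. if i = 0 then xs ! 0 else 0)"
        by (intro sum.cong refl) (simp add: c_def fract_collapse flip: One_fract_def)
      also have "\<dots> = xs ! 0" using \<open>0 < length xs\<close> by simp
      finally have eq: "(\<Sum>i<length xs. Fract (Poly_Mapping.single 0 (c i)) 1 * xs ! i) = xs ! 0" .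
      have "xs ! 0 \<in> stalk X Q UNIV" using xs \<open>0 < length xs\<close> nth_mem by blast
      then have "c 0 = 0" using ind[of c] \<open>0 < length xs\<close> unfolding eq by blast
      then show False by (simp add: c_def)
    qed
    then show "enat (length xs) \<le> 0" by (simp add: zero_enat_def)
  qed simp
  then have "quotient_dim (stalk X Q UNIV) (stalk X Q (S.span (insert 1 P))) = 0" for Q :: "('r, 'k) cox set"
    by (simp add: univ)
  then have "zeros_degree X P 1 \<le> 0"
    unfolding zeros_degree_def by (intro SUP_least) simp
  then show ?thesis by simp
qed

text \<open>The witness is the monomial section of a chart that meets the curve, compared with the
  section \<open>1\<close> of the class 0, which has no zeros.\<close>

lemma basepoint_free_nonneg_on_curve:
  assumes a: "a \<in> basepoint_free" and P: "P \<in> (toric_points X :: ('r, 'k::field) cox set set)"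
  shows "nonneg_on_curve X P a"
proof -
  obtain A where A: "A \<in> \<M>" "\<And>\<rho>. \<rho> \<notin> A \<Longrightarrow> cox_var \<rho> \<notin> P" using toric_point_misses_cone[OF P] by blast
  let ?f = "Poly_Mapping.single (exponents (rep A a)) 1 :: ('r, 'k) cox"
  have "?f \<in> cox_part X (cls X (rep A a))"
    using a A(1) by (intro monomial_in_cox_part) (simp add: basepoint_free_def)
  then have "?f \<in> cox_part X (a + 0)" using cls_rep[OF A(1)] by simp
  moreover have "?f \<notin> P" 
  proof (rule monomial_notin_point[OF P A(2)])
    fix \<rho> assume "\<rho> \<in> A"
    then have "rep A a \<rho> = 0" by (rule rep_zero_on[OF A(1)])
    then show "Poly_Mapping.lookup (exponents (rep A a)) \<rho> = 0" by simp
  qed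
  moreover have "1 \<in> cox_part X 0 - P" using P cox_part_one by (auto simp: toric_points_def)
  moreover have "zeros_degree X P 1 \<le> zeros_degree X P ?f" by (simp add: zeros_degree_one)
  ultimately show ?thesis unfolding nonneg_on_curve_def by blast
qed

end

section \<open>Curves of walls\<close>

text \<open>\<open>\<tau>\<close> holds the rays of the wall, \<open>i\<close> and \<open>i'\<close>
  are the rays on its two sides. \<open>E\<close> is the divisor of a character that restricts to
  the coordinate of the toric curve, with a simple zero along \<open>i\<close> and a simple pole
  along \<open>i'\<close>.\<close>

locale wall = maximal_cones X \<M> H
  for X :: "('n::finite, 'r::{finite,linorder}, 'p::ab_group_add) toric" and \<M> H +
  fixes \<tau> :: "'r set" and i i' :: 'r and E :: "'r \<Rightarrow> int"
  assumes i: "i \<notin> \<tau>" and i': "i' \<notin> \<tau>" and neq: "i \<noteq> i'"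
    and cones: "insert i \<tau> \<in> \<M>" "insert i' \<tau> \<in> \<M>"
    and only_cones: "B \<in> \<M> \<Longrightarrow> \<tau> \<subseteq> B \<Longrightarrow> B = insert i \<tau> \<or> B = insert i' \<tau>"
    and E: "cls X E = 0" "\<And>\<rho>. \<rho> \<in> \<tau> \<Longrightarrow> E \<rho> = 0" "E i = 1" "E i' = -1"
begin

text \<open>Exchanging the two sides replaces the coordinate by its inverse; every statement about
  the chart of \<open>i\<close> thus also holds on the opposite chart.\<close>

lemma wall_swap: "wall X \<M> H \<tau> i' i (\<lambda>\<rho>. - E \<rho>)"
proof
  show "cls X (\<lambda>\<rho>. - E \<rho>) = 0" using cls_scale_principal[OF E(1), of "-1"] by simp
qed (use i i' neq cones only_cones E in auto)

text \<open>The variables of the wall vanish on the curve, \<open>i\<close> becomes the coordinate,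
  and the other variables are set to 1.\<close>

definition theta_term :: "('r \<Rightarrow>\<^sub>0 nat) \<Rightarrow> 'k::field \<Rightarrow> 'k poly"
  where "theta_term m c = (if \<forall>\<rho>\<in>\<tau>. Poly_Mapping.lookup m \<rho> = 0 then monom c (Poly_Mapping.lookup m i) else 0)"

text \<open>
  Restriction of homogeneous elements to the toric curve of the wall \<open>\<tau>\<close>, in the affine
  coordinate \<open>t\<close> of the chart on which all variables outside \<open>\<tau> \<union> {i}\<close> are invertible.
\<close>

definition theta :: "('r, 'k::field) cox \<Rightarrow> 'k poly"
  where "theta p = (\<Sum>m\<in>Poly_Mapping.keys p. theta_term m (Poly_Mapping.lookup p m))"

lemma theta_term_zero [simp]: "theta_term m 0 = 0"
  and theta_term_add: "theta_term m (c + d) = theta_term m c + theta_term m d"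
  and theta_term_mult: "theta_term (m + m') (c * c') = theta_term m c * theta_term m' c'"
  by (auto simp: theta_term_def add_monom mult_monom lookup_add)

lemma theta_superset:
  assumes "finite B" "Poly_Mapping.keys p \<subseteq> B"
  shows "theta p = (\<Sum>m\<in>B. theta_term m (Poly_Mapping.lookup p m))"
  unfolding theta_def using assms by (intro sum.mono_neutral_left) (auto simp: in_keys_iff)

lemma theta_add: "theta (p + q) = theta p + theta q"
proof -
  let ?B = "Poly_Mapping.keys p \<union> Poly_Mapping.keys q"
  have "theta (p + q) = (\<Sum>m\<in>?B. theta_term m (Poly_Mapping.lookup (p + q) m))"
    using Poly_Mapping.keys_add[of p q] by (intro theta_superset) auto
  also have "\<dots> = (\<Sum>m\<in>?B. theta_term m (Poly_Mapping.lookup p m)) + (\<Sum>m\<in>?B. theta_term m (Poly_Mapping.lookup q m))"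
    by (simp add: lookup_add theta_term_add sum.distrib)
  also have "\<dots> = theta p + theta q"
    using theta_superset[of ?B p] theta_superset[of ?B q] by simp
  finally show ?thesis .
qed

lemma theta_zero [simp]: "theta 0 = 0"
  by (simp add: theta_def)

lemma theta_diff: "theta (p - q) = theta p - theta q"
  using theta_add[of "p - q" q] by simp

lemma theta_sum: "theta (sum f I) = (\<Sum>x\<in>I. theta (f x))"
  by (induction I rule: infinite_finite_induct) (simp_all add: theta_add)

lemma theta_single: "theta (Poly_Mapping.single m c) = theta_term m c"
  by (cases "c = 0") (simp_all add: theta_def)

lemma theta_mult: "theta (p * q) = theta p * theta q"
proof -
  let ?s = "\<lambda>p m. Poly_Mapping.single m (Poly_Mapping.lookup p m)"
  have "p * q = (\<Sum>m\<in>Poly_Mapping.keys p. \<Sum>m'\<in>Poly_Mapping.keys q. ?s p m * ?s q m')"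
    by (subst poly_mapping_sum_single[of p], subst poly_mapping_sum_single[of q]) (rule sum_product)
  then have "theta (p * q) = (\<Sum>m\<in>Poly_Mapping.keys p. \<Sum>m'\<in>Poly_Mapping.keys q.
      theta_term m (Poly_Mapping.lookup p m) * theta_term m' (Poly_Mapping.lookup q m'))"
    by (simp add: theta_sum theta_single mult_single theta_term_mult)
  also have "\<dots> = theta p * theta q"
    unfolding theta_def by (rule sum_product[symmetric])
  finally show ?thesis .
qed

lemma theta_scalar: "theta (Poly_Mapping.single 0 c) = [:c:]"
  by (simp add: theta_single theta_term_def monom_0)

lemma theta_one [simp]: "theta 1 = 1"
  using theta_scalar[of 1] by (simp add: one_pCons)

lemma theta_monomial_off: "(\<And>\<rho>. \<rho> \<in> insert i \<tau> \<Longrightarrow> Poly_Mapping.lookup m \<rho> = 0) \<Longrightarrow> theta (Poly_Mapping.single m 1) = 1"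
  by (simp add: theta_single theta_term_def monom_0 one_pCons)

lemma theta_cox_var: "theta (cox_var \<rho> :: ('r, 'k::field) cox) = (if \<rho> \<in> \<tau> then 0 else if \<rho> = i then [:0, 1:] else 1)"
  using i by (auto simp: cox_var_def theta_single theta_term_def lookup_single when_def monom_altdef one_pCons)

text \<open>The trivializing monomial of \<open>a + nmul n H\<close>, multiplied by the
  \<open>k\<close>-th power of the character of \<open>E\<close>, restricts to \<open>t^k\<close>.
  Its exponents are nonnegative for \<open>n\<close> large, uniformly in
  \<open>k \<le> L\<close>.\<close>

lemma lift:
  obtains n\<^sub>0 where "\<And>n (r :: 'k::field poly). n \<ge> n\<^sub>0 \<Longrightarrow> degree r \<le> L \<Longrightarrow> \<exists>s\<in>cox_part X (a + nmul n H). theta s = r"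
proof -
  let ?A = "insert i \<tau>"
  obtain n\<^sub>0 where n0: "\<And>n A \<rho> k. n \<ge> n\<^sub>0 \<Longrightarrow> A \<in> \<M> \<Longrightarrow> \<rho> \<notin> A \<Longrightarrow> k \<in> {..L} \<Longrightarrow>
      - rep A a \<rho> - int k * E \<rho> \<le> int n * rep A H \<rho>"
    using rep_H_bound[of "{..L}" "\<lambda>k A \<rho>. - rep A a \<rho> - int k * E \<rho>"] by auto
  have "\<exists>s\<in>cox_part X (a + nmul n H). theta s = r" if n: "n \<ge> n\<^sub>0" and r: "degree r \<le> L" for n and r :: "'k poly"
  proof -
    define D where "D k \<rho> = rep ?A a \<rho> + int n * rep ?A H \<rho> + int k * E \<rho>" for k \<rho>
    have D_zero: "D k \<rho> = (if \<rho> = i then int k else 0)" if "\<rho> \<in> ?A" for k \<rho>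
      using that i rep_zero_on[OF cones(1), of \<rho>] E(2)[of \<rho>] E(3) by (auto simp: D_def)
    have D_nonneg: "0 \<le> D k \<rho>" if "k \<le> L" for k \<rho>
    proof (cases "\<rho> \<in> ?A")
      case True
      then show ?thesis by (simp add: D_zero)
    next
      case False
      then show ?thesis using n0[OF n cones(1) False, of k] that by (simp add: D_def)
    qed
    have cls_D: "cls X (D k) = a + nmul n H" for k
      unfolding D_def
      by (simp add: cls_add cls_rep[OF cones(1)] cls_scale_nat E(1))
    define s where "s = (\<Sum>k\<le>L. Poly_Mapping.single (exponents (D k)) (coeff r k))"
    have "s \<in> cox_part X (a + nmul n H)"
      unfolding s_def
    proof (rule cox_part_sum)
      fix k assume "k \<in> {..L}"
      then show "Poly_Mapping.single (exponents (D k)) (coeff r k) \<in> cox_part X (a + nmul n H)"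
        using monomial_in_cox_part[of "D k" "coeff r k"] D_nonneg cls_D by simp
    qed
    moreover have "theta s = (\<Sum>k\<le>L. monom (coeff r k) k)"
      unfolding s_def theta_sum theta_single theta_term_def using i
      by (intro sum.cong refl) (auto simp: D_zero)
    then have "theta s = r" using poly_as_sum_of_monoms'[OF r] by simp
    ultimately show ?thesis by blast
  qed
  then show thesis by (rule that)
qed

text \<open>These monomials restrict to 1 and are units on the chart; multiplication by them brings
  elements of different degrees into a common degree.\<close>

lemma off_monomial:
  obtains n\<^sub>0 where "\<And>n. n \<ge> n\<^sub>0 \<Longrightarrow> \<exists>m. Poly_Mapping.single m (1::'k::field) \<in> cox_part X (a + nmul n H) \<and>
    (\<forall>\<rho>\<in>insert i \<tau>. Poly_Mapping.lookup m \<rho> = 0)"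
proof -
  let ?A = "insert i \<tau>"
  obtain n\<^sub>0 where n0: "\<And>n A \<rho> k. n \<ge> n\<^sub>0 \<Longrightarrow> A \<in> \<M> \<Longrightarrow> \<rho> \<notin> A \<Longrightarrow> k \<in> {()} \<Longrightarrow> - rep A a \<rho> \<le> int n * rep A H \<rho>"
    using rep_H_bound[of "{()}" "\<lambda>k A \<rho>. - rep A a \<rho>"] by auto
  have "\<exists>m. Poly_Mapping.single m (1::'k) \<in> cox_part X (a + nmul n H) \<and> (\<forall>\<rho>\<in>?A. Poly_Mapping.lookup m \<rho> = 0)"
    if n: "n \<ge> n\<^sub>0" for n
  proof -
    define D where "D \<rho> = rep ?A a \<rho> + int n * rep ?A H \<rho>" for \<rho>
    have zero: "D \<rho> = 0" if "\<rho> \<in> ?A" for \<rho>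
      using rep_zero_on[OF cones(1) that] by (simp add: D_def)
    have nonneg: "0 \<le> D \<rho>" for \<rho>
    proof (cases "\<rho> \<in> ?A")
      case True
      then show ?thesis by (simp add: zero)
    next
      case False
      then show ?thesis using n0[OF n cones(1) False, of "()"] by (simp add: D_def)
    qed
    have "cls X D = a + nmul n H"
      unfolding D_def by (simp add: cls_add cls_rep[OF cones(1)] cls_scale_nat)
    then have "Poly_Mapping.single (exponents D) (1::'k) \<in> cox_part X (a + nmul n H)"
      using monomial_in_cox_part[of D "1::'k"] nonneg by simp
    then show ?thesis using zero by (intro exI[of _ "exponents D"]) auto
  qed
  then show thesis by (rule that)
qed

text \<open>
  The homogeneous prime of the closed point \<open>\<pi> = 0\<close> of the chart; the zero polynomial gives the
  ideal of the whole curve.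
\<close>

definition point :: "'k::field poly \<Rightarrow> ('r, 'k) cox set"
  where "point \<pi> = {s. \<forall>a. \<pi> dvd theta (component a s)}"

lemma mem_point_homogeneous: "s \<in> cox_part X a \<Longrightarrow> s \<in> point \<pi> \<longleftrightarrow> \<pi> dvd theta s"
  by (auto simp: point_def component_homogeneous)

lemma theta_component_mult:
  "theta (component c (p * q)) = (\<Sum>a\<in>degrees p. theta (component a p) * theta (component (c - a) q))"
  by (simp add: component_mult theta_sum theta_mult)

text \<open>A leading term argument: take the largest degrees in which \<open>p\<close> and
  \<open>q\<close> have components outside the ideal. In the sum of these degrees all other products
  of components are divisible by \<open>\<pi>\<close>, so the product of the two leading ones would
  be too.\<close>

lemma point_prime:
  fixes \<pi> :: "'k::field poly"
  assumes \<pi>: "\<pi> = 0 \<or> prime_elem \<pi>" and pq: "p * q \<in> point \<pi>"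
  shows "p \<in> point \<pi> \<or> q \<in> point \<pi>"
proof (rule ccontr)
  assume "\<not> ?thesis"
  then have notin: "p \<notin> point \<pi>" "q \<notin> point \<pi>" by auto
  \<comment> \<open>\<open>rep\<close> embeds \<open>Pic X\<close> into integral vectors, whose
    linear order as \<open>\<Rightarrow>\<^sub>0\<close> functions is compatible with addition; this
    orders the degrees.\<close>
  define \<psi> :: "'p \<Rightarrow> 'r \<Rightarrow>\<^sub>0 int" where "\<psi> a = Poly_Mapping.Abs_poly_mapping (rep (insert i \<tau>) a)" for a
  have lookup_\<psi>: "Poly_Mapping.lookup (\<psi> a) = rep (insert i \<tau>) a" for a
    by (simp add: \<psi>_def)
  have \<psi>_add: "\<psi> (a + b) = \<psi> a + \<psi> b" for a b
    by (rule poly_mapping_eqI) (simp add: lookup_\<psi> lookup_add rep_add[OF cones(1)])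
  have \<psi>_inj: "a = b" if "\<psi> a = \<psi> b" for a b
    using cls_rep[OF cones(1), of a] cls_rep[OF cones(1), of b] lookup_\<psi>[of a] lookup_\<psi>[of b] that by simp
  define S where "S p = {a. \<not> \<pi> dvd theta (component a p)}" for p
  have S_sub: "S p \<subseteq> degrees p" for p
  proof
    fix a assume "a \<in> S p"
    then have "component a p \<noteq> 0" by (auto simp: S_def)
    then show "a \<in> degrees p" by (rule component_nonzero_degree)
  qed
  then have S_fin: "finite (S p)" for p using finite_degrees finite_subset by blast
  have max: "\<exists>a\<in>S p. \<forall>a'\<in>S p. \<psi> a' \<le> \<psi> a" if "p \<notin> point \<pi>" for p
  proof -
    have "S p \<noteq> {}" using that by (auto simp: S_def point_def)
    then have "Max (\<psi> ` S p) \<in> \<psi> ` S p" using S_fin by (intro Max_in) auto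
    then show ?thesis using S_fin by (metis (no_types, lifting) Max_ge finite_imageI imageE imageI)
  qed
  obtain a where a: "a \<in> S p" "\<And>a'. a' \<in> S p \<Longrightarrow> \<psi> a' \<le> \<psi> a" using max[OF notin(1)] by blast
  obtain b where b: "b \<in> S q" "\<And>b'. b' \<in> S q \<Longrightarrow> \<psi> b' \<le> \<psi> b" using max[OF notin(2)] by blast
  let ?t = "\<lambda>a'. theta (component a' p) * theta (component (a + b - a') q)"
  have other: "\<pi> dvd ?t a'" if "a' \<noteq> a" for a'
  proof (rule ccontr)
    assume "\<not> \<pi> dvd ?t a'"
    then have "a' \<in> S p" "a + b - a' \<in> S q" by (auto simp: S_def)
    then have le: "\<psi> a' \<le> \<psi> a" "\<psi> (a + b - a') \<le> \<psi> b" using a(2) b(2) by auto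
    have "\<psi> (a + b - a') + \<psi> a' = \<psi> a + \<psi> b" by (simp flip: \<psi>_add)
    also have "\<dots> \<ge> \<psi> a + \<psi> (a + b - a')" using le(2) by (rule add_left_mono)
    finally have "\<psi> a \<le> \<psi> a'" by (simp add: add.commute)
    then have "\<psi> a' = \<psi> a" using le(1) by simp
    then show False using \<psi>_inj that by blast
  qed
  have "theta (component (a + b) (p * q)) = ?t a + (\<Sum>a'\<in>degrees p - {a}. ?t a')"
    unfolding theta_component_mult using S_sub a(1) finite_degrees by (intro sum.remove) auto
  moreover have "\<pi> dvd (\<Sum>a'\<in>degrees p - {a}. ?t a')" by (rule dvd_sum) (use other in auto)
  moreover have "\<pi> dvd theta (component (a + b) (p * q))" using pq by (simp add: point_def)
  ultimately have "\<pi> dvd ?t a" by (simp add: dvd_add_left_iff)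
  then have "\<pi> dvd theta (component a p) \<or> \<pi> dvd theta (component b q)"
    using \<pi> by (auto simp: prime_elem_dvd_mult_iff)
  then show False using a(1) b(1) by (auto simp: S_def)
qed

lemma point_subspace: "module.subspace (*) (point \<pi>)"
proof -
  interpret S: module "(*) :: ('r, 'k::field) cox \<Rightarrow> _" by (rule module_cox)
  show ?thesis
  proof (rule S.subspaceI)
    show "0 \<in> point \<pi>" by (simp add: point_def)
    show "x + y \<in> point \<pi>" if "x \<in> point \<pi>" "y \<in> point \<pi>" for x y
      using that by (simp add: point_def component_add theta_add)
    show "c * x \<in> point \<pi>" if "x \<in> point \<pi>" for c x
      using that by (auto simp: point_def theta_component_mult intro!: dvd_sum dvd_mult)
  qed
qed

lemma point_toric:
  fixes \<pi> :: "'k::field poly"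
  assumes \<pi>: "\<pi> = 0 \<or> prime_elem \<pi>"
  shows "point \<pi> \<in> toric_points X"
proof -
  interpret S: module "(*) :: ('r, 'k) cox \<Rightarrow> _" by (rule module_cox)
  have unit: "\<not> \<pi> dvd 1" using \<pi> by (auto simp: prime_elem_def)
  have "1 \<notin> point \<pi>" using unit mem_point_homogeneous[OF cox_part_one, where \<pi> = \<pi>] by simp
  moreover have "point \<pi> = S.span {p \<in> point \<pi>. \<exists>a. p \<in> cox_part X a}"
  proof
    show "S.span {p \<in> point \<pi>. \<exists>a. p \<in> cox_part X a} \<subseteq> point \<pi>"
      by (rule S.span_minimal[OF _ point_subspace]) auto
    show "point \<pi> \<subseteq> S.span {p \<in> point \<pi>. \<exists>a. p \<in> cox_part X a}"
    proof
      fix p assume p: "p \<in> point \<pi>"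
      have "component a p \<in> {p \<in> point \<pi>. \<exists>a. p \<in> cox_part X a}" for a
        using p component_in_cox_part[of a p] mem_point_homogeneous[OF component_in_cox_part[of a p], of \<pi>]
        by (auto simp: point_def)
      then have "(\<Sum>a\<in>degrees p. component a p) \<in> S.span {p \<in> point \<pi>. \<exists>a. p \<in> cox_part X a}"
        by (intro S.span_sum S.span_base)
      then show "p \<in> S.span {p \<in> point \<pi>. \<exists>a. p \<in> cox_part X a}" using sum_components[of p] by simp
    qed
  qed
  moreover have "\<not> irrelevant_ideal X \<subseteq> point \<pi>"
  proof -
    obtain \<kappa> where \<kappa>: "\<kappa> \<in> fan X" "{\<rho>. ray X \<rho> \<subseteq> \<kappa>} = insert i \<tau>" using maximal_cone[OF cones(1)] by blast
    have "theta (xhat X \<kappa> :: ('r, 'k) cox) = 1"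
    proof -
      have prod: "theta (\<Prod>\<rho>\<in>B. cox_var \<rho> :: ('r, 'k) cox) = 1" if "finite B" "B \<inter> insert i \<tau> = {}" for B
        using that by (induction B rule: finite_induct) (auto simp: theta_mult theta_cox_var)
      have "{\<rho>. \<not> ray X \<rho> \<subseteq> \<kappa>} \<inter> insert i \<tau> = {}" using \<kappa>(2) by blast
      then show ?thesis unfolding xhat_def by (intro prod) auto
    qed
    then have "(xhat X \<kappa> :: ('r, 'k) cox) \<notin> point \<pi>" using unit mem_point_homogeneous[OF xhat_in_cox_part, where \<pi> = \<pi>] by simp
    moreover have "(xhat X \<kappa> :: ('r, 'k) cox) \<in> irrelevant_ideal X"
      unfolding irrelevant_ideal_def using \<kappa>(1) by (intro S.span_base) simp
    ultimately show ?thesis by blast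
  qed
  ultimately show ?thesis
    unfolding toric_points_def using point_subspace point_prime[OF \<pi>] by blast
qed

abbreviation curve :: "('r, 'k::field) cox set" where "curve \<equiv> point 0"

lemma curve_subset_point: "curve \<subseteq> point \<pi>"
  by (auto simp: point_def)

lemma mem_curve_homogeneous: "s \<in> cox_part X a \<Longrightarrow> s \<in> curve \<longleftrightarrow> theta s = 0"
  by (simp add: mem_point_homogeneous)

text \<open>The inclusion is tested on one homogeneous element that restricts to
  \<open>\<pi>\<close>, provided by \<open>lift\<close>.\<close>

lemma point_dvd:
  assumes "point \<pi> \<subseteq> point (\<pi>' :: 'k::field poly)"
  shows "\<pi>' dvd \<pi>"
proof -
  obtain n\<^sub>0 where "\<And>n (r :: 'k poly). n \<ge> n\<^sub>0 \<Longrightarrow> degree r \<le> degree \<pi> \<Longrightarrow> \<exists>s\<in>cox_part X (0 + nmul n H). theta s = r"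
    using lift[where ?'k = 'k and a = 0 and L = "degree \<pi>"] by blast
  then obtain s where s: "s \<in> cox_part X (0 + nmul n\<^sub>0 H)" "theta s = \<pi>" by blast
  then show ?thesis using assms mem_point_homogeneous[OF s(1), of \<pi>] mem_point_homogeneous[OF s(1), of \<pi>'] by auto
qed

lemma cox_var_notin_point: "\<rho> \<notin> insert i \<tau> \<Longrightarrow> \<not> \<pi> dvd 1 \<Longrightarrow> cox_var \<rho> \<notin> point \<pi>"
  using mem_point_homogeneous[OF cox_var_in_cox_part, of \<rho> \<pi>] by (simp add: theta_cox_var)

text \<open>The variables of the wall lie in \<open>Q\<close>, so a maximal cone whose complementary
  variables avoid \<open>Q\<close> contains the wall; there are just two such cones.\<close>

lemma point_above_curve:
  assumes Q: "Q \<in> (toric_points X :: ('r, 'k::field) cox set set)" and sub: "curve \<subseteq> Q"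
  shows "(\<forall>\<rho>. \<rho> \<notin> insert i \<tau> \<longrightarrow> cox_var \<rho> \<notin> Q) \<or> (\<forall>\<rho>. \<rho> \<notin> insert i' \<tau> \<longrightarrow> cox_var \<rho> \<notin> Q)"
proof -
  obtain A where A: "A \<in> \<M>" "\<And>\<rho>. \<rho> \<notin> A \<Longrightarrow> cox_var \<rho> \<notin> Q" using toric_point_misses_cone[OF Q] by blast
  have "cox_var \<rho> \<in> Q" if "\<rho> \<in> \<tau>" for \<rho>
    using sub mem_curve_homogeneous[OF cox_var_in_cox_part, of \<rho>] that by (auto simp: theta_cox_var)
  then have "\<tau> \<subseteq> A" using A(2) by blast
  then show ?thesis using only_cones[OF A(1)] A(2) by blast
qed

text \<open>On this chart membership in \<open>Q\<close> depends only on the restriction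
  \<open>theta\<close>. So \<open>Q\<close> is given by an ideal of \<open>K[t]\<close>, which is
  principal and is zero or prime.\<close>

lemma chart_point_generator:
  fixes Q :: "('r, 'k::field) cox set"
  assumes Q: "Q \<in> toric_points X" and sub: "curve \<subseteq> Q" and vars: "\<And>\<rho>. \<rho> \<notin> insert i \<tau> \<Longrightarrow> cox_var \<rho> \<notin> Q"
  obtains \<pi> where "Q = point \<pi>" "\<pi> = 0 \<or> \<pi> \<in> monic_primes"
proof -
  interpret S: module "(*) :: ('r, 'k) cox \<Rightarrow> _" by (rule module_cox)
  have QS: "S.subspace Q" "1 \<notin> Q" "\<And>p q. p * q \<in> Q \<Longrightarrow> p \<in> Q \<or> q \<in> Q"
      "Q = S.span {p \<in> Q. \<exists>a. p \<in> cox_part X a}"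
    using Q by (simp_all add: toric_points_def)
  have scale: "x \<in> Q \<Longrightarrow> x * y \<in> Q" for x y using S.subspace_scale[OF QS(1), of x y] by (simp add: mult.commute)
  have unit: "theta (Poly_Mapping.single m (1::'k)) = 1 \<and> Poly_Mapping.single m 1 \<notin> Q"
    if "\<forall>\<rho>\<in>insert i \<tau>. Poly_Mapping.lookup m \<rho> = 0" for m
    by (intro conjI theta_monomial_off monomial_notin_point[OF Q, of "insert i \<tau>"]) (use that vars in auto)
  have units: "\<exists>n. \<exists>\<mu>\<in>cox_part X (a' + nmul n H). \<exists>\<mu>'\<in>cox_part X (a + nmul n H). theta \<mu> = 1 \<and> \<mu> \<notin> Q \<and> theta \<mu>' = 1 \<and> \<mu>' \<notin> Q" for a a'
  proof -
    obtain n1 where n1: "\<And>n. n \<ge> n1 \<Longrightarrow> \<exists>m. Poly_Mapping.single m (1::'k) \<in> cox_part X (a + nmul n H) \<and>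
        (\<forall>\<rho>\<in>insert i \<tau>. Poly_Mapping.lookup m \<rho> = 0)" using off_monomial[where ?'k = 'k and a = a] by blast
    obtain n2 where n2: "\<And>n. n \<ge> n2 \<Longrightarrow> \<exists>m. Poly_Mapping.single m (1::'k) \<in> cox_part X (a' + nmul n H) \<and>
        (\<forall>\<rho>\<in>insert i \<tau>. Poly_Mapping.lookup m \<rho> = 0)" using off_monomial[where ?'k = 'k and a = a'] by blast
    obtain m where m: "Poly_Mapping.single m (1::'k) \<in> cox_part X (a + nmul (n1 + n2) H)"
        "\<forall>\<rho>\<in>insert i \<tau>. Poly_Mapping.lookup m \<rho> = 0" using n1[of "n1 + n2"] by auto
    obtain m' where m': "Poly_Mapping.single m' (1::'k) \<in> cox_part X (a' + nmul (n1 + n2) H)"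
        "\<forall>\<rho>\<in>insert i \<tau>. Poly_Mapping.lookup m' \<rho> = 0" using n2[of "n1 + n2"] by auto
    show ?thesis using m(1) m'(1) unit[OF m(2)] unit[OF m'(2)] by blast
  qed
  \<comment> \<open>The units \<open>\<mu>\<close> and \<open>\<mu>'\<close> equalize the degrees;
    the difference of the products then restricts to 0, so it lies in the curve ideal and in
    \<open>Q\<close>.\<close>
  have same: "s \<in> Q" if s: "s \<in> cox_part X a" "s' \<in> cox_part X a'" "theta s = theta s'" "s' \<in> Q" for s s' a a'
  proof -
    obtain n \<mu> \<mu>' where \<mu>: "\<mu> \<in> cox_part X (a' + nmul n H)" "\<mu>' \<in> cox_part X (a + nmul n H)"
        "theta \<mu> = 1" "\<mu> \<notin> Q" "theta \<mu>' = 1" "\<mu>' \<notin> Q" using units[of a' a] by blast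
    have "s * \<mu> \<in> cox_part X (a + a' + nmul n H)" "s' * \<mu>' \<in> cox_part X (a + a' + nmul n H)"
      using cox_part_mult[OF s(1) \<mu>(1)] cox_part_mult[OF s(2) \<mu>(2)] by (simp_all add: algebra_simps)
    then have "s * \<mu> - s' * \<mu>' \<in> cox_part X (a + a' + nmul n H)" by (rule cox_part_diff)
    moreover have "theta (s * \<mu> - s' * \<mu>') = 0" using s(3) \<mu> by (simp add: theta_diff theta_mult)
    ultimately have "s * \<mu> - s' * \<mu>' \<in> Q" using sub mem_curve_homogeneous by blast
    then have "s * \<mu> \<in> Q" using S.subspace_add[OF QS(1) _ scale[OF s(4), of \<mu>']] by fastforce
    then show ?thesis using QS(3) \<mu>(4) by blast
  qed
  define I where "I = {r. \<exists>a. \<exists>s\<in>Q \<inter> cox_part X a. theta s = r}"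
  have mem_I: "s \<in> Q \<longleftrightarrow> theta s \<in> I" if "s \<in> cox_part X a" for s a
  proof
    show "s \<in> Q \<Longrightarrow> theta s \<in> I" using that unfolding I_def by blast
    assume "theta s \<in> I"
    then obtain a' s' where s': "s' \<in> Q" "s' \<in> cox_part X a'" "theta s' = theta s" unfolding I_def by blast
    show "s \<in> Q" by (rule same[OF that s'(2) s'(3)[symmetric] s'(1)])
  qed
  have lift0: "\<exists>a. \<exists>s\<in>cox_part X a. theta s = r" for r :: "'k poly"
  proof -
    obtain n\<^sub>0 where "\<And>n (r' :: 'k poly). n \<ge> n\<^sub>0 \<Longrightarrow> degree r' \<le> degree r \<Longrightarrow> \<exists>s\<in>cox_part X (0 + nmul n H). theta s = r'"
      using lift[where ?'k = 'k and a = 0 and L = "degree r"] by blast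
    then show ?thesis by blast
  qed
  obtain g where g: "I = {x. g dvd x}"
  proof (rule poly_ideal_generator[of I])
    show "0 \<in> I" unfolding I_def using S.subspace_0[OF QS(1)] cox_part_zero by force
  next
    fix x y assume "x \<in> I" "y \<in> I"
    then obtain a s a' s' where s: "s \<in> Q" "s \<in> cox_part X a" "theta s = x" "s' \<in> Q" "s' \<in> cox_part X a'" "theta s' = y"
      unfolding I_def by blast
    obtain n \<mu> \<mu>' where \<mu>: "\<mu> \<in> cox_part X (a' + nmul n H)" "\<mu>' \<in> cox_part X (a + nmul n H)"
        "theta \<mu> = (1 :: 'k poly)" "theta \<mu>' = (1 :: 'k poly)" using units[of a' a] by blast
    have "s * \<mu> \<in> cox_part X (a + a' + nmul n H)" "s' * \<mu>' \<in> cox_part X (a + a' + nmul n H)"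
      using cox_part_mult[OF s(2) \<mu>(1)] cox_part_mult[OF s(5) \<mu>(2)] by (simp_all add: algebra_simps)
    then have "s * \<mu> - s' * \<mu>' \<in> cox_part X (a + a' + nmul n H)" by (rule cox_part_diff)
    moreover have "s * \<mu> - s' * \<mu>' \<in> Q" using S.subspace_diff[OF QS(1) scale[OF s(1)] scale[OF s(4)]] .
    moreover have "theta (s * \<mu> - s' * \<mu>') = x - y" using s \<mu> by (simp add: theta_diff theta_mult)
    ultimately show "x - y \<in> I" unfolding I_def by blast
  next
    fix r x :: "'k poly" assume "x \<in> I"
    then obtain a s where s: "s \<in> Q" "s \<in> cox_part X a" "theta s = x" unfolding I_def by blast
    obtain a' s' where s': "s' \<in> cox_part X a'" "theta s' = r" using lift0 by blast
    have "s * s' \<in> Q \<inter> cox_part X (a + a')" using scale[OF s(1)] cox_part_mult[OF s(2) s'(1)] by blast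
    moreover have "theta (s * s') = r * x" using s s' by (simp add: theta_mult mult.commute)
    ultimately show "r * x \<in> I" unfolding I_def by blast
  qed
  have Q_eq: "Q = point g"
  proof -
    have "p \<in> Q \<longleftrightarrow> (\<forall>a. component a p \<in> Q)" for p
    proof
      show "p \<in> Q \<Longrightarrow> \<forall>a. component a p \<in> Q" using homogeneous_ideal_component[OF QS(1,4)] by blast
      assume "\<forall>a. component a p \<in> Q"
      then have "(\<Sum>a\<in>degrees p. component a p) \<in> Q" by (intro S.subspace_sum[OF QS(1)]) blast
      then show "p \<in> Q" using sum_components[of p] by simp
    qed
    moreover have "component a p \<in> Q \<longleftrightarrow> g dvd theta (component a p)" for a p
      using mem_I[OF component_in_cox_part] g by blast
    ultimately show ?thesis by (auto simp: point_def)
  qed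
  show thesis
  proof (cases "g = 0")
    case True
    then show thesis using Q_eq that by blast
  next
    case False
    have "prime_elem g"
    proof (rule prime_elemI[OF False])
      show "\<not> g dvd 1" using mem_I[OF cox_part_one] QS(2) g by auto
      fix x y assume "g dvd x * y"
      then have xy: "x * y \<in> I" using g by blast
      obtain a s a' s' where s: "s \<in> cox_part X a" "theta s = x" "s' \<in> cox_part X a'" "theta s' = y"
        using lift0[of x] lift0[of y] by blast
      then have "s * s' \<in> Q" using xy mem_I[OF cox_part_mult[OF s(1,3)]] by (simp add: theta_mult)
      then have "s \<in> Q \<or> s' \<in> Q" by (rule QS(3))
      then show "g dvd x \<or> g dvd y" using mem_I[OF s(1)] mem_I[OF s(3)] s g by auto
    qed
    then obtain \<pi> where \<pi>: "\<pi> \<in> monic_primes" "\<And>x. \<pi> dvd x \<longleftrightarrow> g dvd x"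
      using normalize_prime[of g] by blast
    then have "Q = point \<pi>" using Q_eq by (simp add: point_def)
    then show thesis using \<pi>(1) that by blast
  qed
qed

end

lemma monic_prime_linear:
  fixes F :: "'k::field poly"
  assumes "degree F = 1" "lead_coeff F = 1"
  shows "F \<in> monic_primes" and "\<And>\<pi>. \<pi> \<in> monic_primes \<Longrightarrow> \<pi> dvd F \<Longrightarrow> \<pi> = F"
proof -
  have eq: "\<pi> = F" if \<pi>: "\<pi> \<in> monic_primes" "\<pi> dvd F" for \<pi>
  proof -
    have pr: "prime_elem \<pi>" "lead_coeff \<pi> = 1" using \<pi>(1) by (auto simp: monic_primes_def)
    obtain r where r: "F = \<pi> * r" using \<pi>(2) by (auto simp: dvd_def)
    have nz: "\<pi> \<noteq> 0" "r \<noteq> 0" using r assms(1) by auto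
    have "degree \<pi> \<noteq> 0" using pr(1) nz by (metis is_unit_iff_degree prime_elem_not_unit)
    then have "degree r = 0" using r assms(1) degree_mult_eq[OF nz] by simp
    then have "r dvd 1" using nz by (simp add: is_unit_iff_degree)
    then have "F dvd \<pi>" using r by (simp add: mult_unit_dvd_iff)
    then show ?thesis using monic_dvd_antisym[OF \<pi>(2)] pr(2) assms(2) by simp
  qed
  then show "\<And>\<pi>. \<pi> \<in> monic_primes \<Longrightarrow> \<pi> dvd F \<Longrightarrow> \<pi> = F" .
  obtain \<pi> where "\<pi> \<in> monic_primes" "\<pi> dvd F" using exists_prime_factor[of F] assms(1) by auto
  with eq show "F \<in> monic_primes" by blast
qed

section \<open>Local degrees and the degree formula on the projective line\<close>

context wall
begin

text \<open>The quotient of the local ring by the equation of \<open>f\<close> is identified with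
  \<open>K[t] / (\<pi> ^ e)\<close>, where \<open>e\<close> is the order of \<open>theta f\<close>
  at \<open>\<pi>\<close>; its dimension is \<open>e * degree \<pi>\<close>.\<close>

lemma local_degree:
  fixes \<pi> :: "'k::field poly"
  assumes \<pi>: "prime_elem \<pi>" and f: "f \<in> cox_part X b" "f \<notin> curve"
  shows "quotient_dim (stalk X (point \<pi>) UNIV) (stalk X (point \<pi>) (module.span (*) (insert f curve)))
    = enat (order_at \<pi> (theta f) * degree \<pi>)"
proof -
  interpret S: module "(*) :: ('r, 'k) cox \<Rightarrow> _" by (rule module_cox)
  let ?Q = "point \<pi>" and ?I = "S.span (insert f curve)"
  have nz: "theta f \<noteq> 0" using f mem_curve_homogeneous by blast
  define e where "e = order_at \<pi> (theta f)"
  obtain \<psi> where \<psi>: "theta f = \<pi> ^ e * \<psi>" "\<not> \<pi> dvd \<psi>"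
    using order_at_decompose[OF nz \<pi>] unfolding e_def by blast
  define m where "m = \<pi> ^ e"
  have m_nz: "m \<noteq> 0" using \<pi> by (auto simp: m_def)
  have notQ: "s \<notin> ?Q \<longleftrightarrow> \<not> \<pi> dvd theta s" if "s \<in> cox_part X a" for s a
    using mem_point_homogeneous[OF that, of \<pi>] by simp
  have notQ_nz: "s \<noteq> 0" if "s \<notin> ?Q" for s using that S.subspace_0[OF point_subspace[of \<pi>]] by auto
  have notQ_mult: "s * t \<notin> ?Q" if "s \<notin> ?Q" "t \<notin> ?Q" for s t using point_prime[of \<pi> s t] \<pi> that by blast
  have one_notQ: "1 \<notin> ?Q" using notQ[OF cox_part_one] \<pi> by (simp add: prime_elem_def)
  \<comment> \<open>The fraction \<open>p / s\<close> is related to every \<open>r\<close> congruent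
    to \<open>theta p / theta s\<close> modulo \<open>\<pi> ^ e\<close>; writing the congruence
    without division avoids choosing an inverse of \<open>theta s\<close>.\<close>
  define rel where "rel x r \<longleftrightarrow> (\<exists>a p s. x = Fract p s \<and> p \<in> cox_part X a \<and> s \<in> cox_part X a \<and> s \<notin> ?Q \<and>
    m dvd theta p - r * theta s)" for x :: "('r, 'k) cox fract" and r
  have cancel: "m dvd x" if "m dvd x * theta s" "s \<in> cox_part X a" "s \<notin> ?Q" for x s a
    using prime_power_dvd_cancel[OF \<pi>, of "theta s" e x] that notQ[OF that(2)] by (simp add: m_def)
  have scalar: "Poly_Mapping.single 0 c \<in> cox_part X 0" for c :: 'k
    using cox_part_one by (simp add: cox_part_def monomial_degree_zero)
  have ideal: "p \<in> ?I \<longleftrightarrow> (\<exists>k. p - k * f \<in> curve)" for p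
    by (simp add: S.span_breakdown_eq S.span_eq_iff[THEN iffD2, OF point_subspace])
  have lifts: "\<exists>n. \<exists>u\<in>cox_part X (b + nmul n H). \<exists>w\<in>cox_part X (a + nmul n H). theta u = \<phi> \<and> theta w = \<omega>"
    for a and \<phi> \<omega> :: "'k poly"
  proof -
    obtain n1 where n1: "\<And>n (r :: 'k poly). n \<ge> n1 \<Longrightarrow> degree r \<le> degree \<phi> \<Longrightarrow> \<exists>s\<in>cox_part X (b + nmul n H). theta s = r"
      using lift[where ?'k = 'k and a = b and L = "degree \<phi>"] by blast
    obtain n2 where n2: "\<And>n (r :: 'k poly). n \<ge> n2 \<Longrightarrow> degree r \<le> degree \<omega> \<Longrightarrow> \<exists>s\<in>cox_part X (a + nmul n H). theta s = r"
      using lift[where ?'k = 'k and a = a and L = "degree \<omega>"] by blast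
    show ?thesis using n1[of "n1 + n2" \<phi>] n2[of "n1 + n2" \<omega>] by auto
  qed
  have "quotient_dim (stalk X ?Q UNIV) (stalk X ?Q ?I) = enat (degree m)"
  proof (rule quotient_dim_eq_degree[where rel = rel, OF m_nz])
    fix x assume "x \<in> stalk X ?Q UNIV"
    then obtain p s a where x: "x = Fract p s" "p \<in> cox_part X a" "s \<in> cox_part X a" "s \<notin> ?Q"
      unfolding stalk_def by blast
    obtain v where v: "m dvd 1 - v * theta s"
      using inverse_mod_prime_power[OF \<pi>, of "theta s" e] notQ[OF x(3)] x(4) by (auto simp: m_def)
    have "theta p - (theta p * v) * theta s = theta p * (1 - v * theta s)" by (simp add: algebra_simps)
    then have "m dvd theta p - (theta p * v) * theta s" using v by simp
    then show "\<exists>r. rel x r" using x unfolding rel_def by blast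
  next
    fix x r r' assume "rel x r" "rel x r'"
    then obtain p s a p' s' a' where
      1: "x = Fract p s" "p \<in> cox_part X a" "s \<in> cox_part X a" "s \<notin> ?Q" "m dvd theta p - r * theta s" and
      2: "x = Fract p' s'" "p' \<in> cox_part X a'" "s' \<in> cox_part X a'" "s' \<notin> ?Q" "m dvd theta p' - r' * theta s'"
      unfolding rel_def by blast
    have "p * s' = p' * s" using 1(1,4) 2(1,4) notQ_nz by (simp add: eq_fract)
    then have "theta p * theta s' = theta p' * theta s" by (metis theta_mult)
    then have "(r - r') * (theta s * theta s') = theta s * (theta p' - r' * theta s') - theta s' * (theta p - r * theta s)"
      by (simp add: algebra_simps)
    then have "m dvd (r - r') * (theta s * theta s')" using 1(5) 2(5) by simp
    then have "m dvd (r - r') * theta (s * s')" by (simp add: theta_mult)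
    then show "m dvd r - r'" by (rule cancel[OF _ cox_part_mult[OF 1(3) 2(3)] notQ_mult[OF 1(4) 2(4)]])
  next
    have "0 = Fract 0 (1 :: ('r, 'k) cox)" by (simp add: Zero_fract_def)
    then show "rel 0 0" unfolding rel_def using one_notQ cox_part_one cox_part_zero
      by (intro exI[of _ 0] exI[of _ 1]) auto
  next
    fix x y r q assume "rel x r" "rel y q"
    then obtain p s a p' s' a' where
      1: "x = Fract p s" "p \<in> cox_part X a" "s \<in> cox_part X a" "s \<notin> ?Q" "m dvd theta p - r * theta s" and
      2: "y = Fract p' s'" "p' \<in> cox_part X a'" "s' \<in> cox_part X a'" "s' \<notin> ?Q" "m dvd theta p' - q * theta s'"
      unfolding rel_def by blast
    have "x + y = Fract (p * s' + p' * s) (s * s')" using 1(1,4) 2(1,4) notQ_nz by simp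
    moreover have "p * s' + p' * s \<in> cox_part X (a + a')"
      using cox_part_add[OF cox_part_mult[OF 1(2) 2(3)]] cox_part_mult[OF 2(2) 1(3)] by (simp add: add.commute)
    moreover have "s * s' \<in> cox_part X (a + a')" by (rule cox_part_mult[OF 1(3) 2(3)])
    moreover have "theta (p * s' + p' * s) - (r + q) * theta (s * s')
        = (theta p - r * theta s) * theta s' + (theta p' - q * theta s') * theta s"
      by (simp add: theta_add theta_mult algebra_simps)
    then have "m dvd theta (p * s' + p' * s) - (r + q) * theta (s * s')" using 1(5) 2(5) by simp
    ultimately show "rel (x + y) (r + q)" unfolding rel_def using notQ_mult[OF 1(4) 2(4)] by blast
  next
    fix c x r assume "rel x r"
    then obtain p s a where 1: "x = Fract p s" "p \<in> cox_part X a" "s \<in> cox_part X a" "s \<notin> ?Q" "m dvd theta p - r * theta s"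
      unfolding rel_def by blast
    have "Fract (Poly_Mapping.single 0 c) 1 * x = Fract (Poly_Mapping.single 0 c * p) s" by (simp add: 1(1))
    moreover have "Poly_Mapping.single 0 c * p \<in> cox_part X a" using cox_part_mult[OF scalar 1(2)] by simp
    moreover have "theta (Poly_Mapping.single 0 c * p) - smult c r * theta s = [:c:] * (theta p - r * theta s)"
      by (simp add: theta_mult theta_scalar smult_diff_right)
    then have "m dvd theta (Poly_Mapping.single 0 c * p) - smult c r * theta s" using 1(5) by (metis dvd_mult)
    ultimately show "rel (Fract (Poly_Mapping.single 0 c) 1 * x) (smult c r)" unfolding rel_def using 1(3,4) by blast
  next
    fix x r assume "rel x r"
    then obtain p s a where 1: "x = Fract p s" "p \<in> cox_part X a" "s \<in> cox_part X a" "s \<notin> ?Q" "m dvd theta p - r * theta s"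
      unfolding rel_def by blast
    have eq: "theta p - (r mod m) * theta s = (theta p - r * theta s) + m * ((r div m) * theta s)"
      by (simp add: algebra_simps minus_mult_div_eq_mod[symmetric])
    have "m dvd theta p - (r mod m) * theta s" unfolding eq by (intro dvd_add 1(5) dvd_triv_left)
    then show "rel x (r mod m)" unfolding rel_def using 1 by blast
  next
    fix x r assume "rel x r"
    show "x \<in> stalk X ?Q ?I \<longleftrightarrow> rel x 0"
    proof
      assume "x \<in> stalk X ?Q ?I"
      then obtain p s a where 1: "x = Fract p s" "p \<in> ?I" "p \<in> cox_part X a" "s \<in> cox_part X a" "s \<notin> ?Q"
        unfolding stalk_def by blast
      obtain k where k: "p - k * f \<in> curve" using 1(2) ideal by blast
      \<comment> \<open>The multiplier \<open>k\<close> need not be homogeneous; comparison in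
        degree \<open>a\<close> replaces it by its component of degree \<open>a - b\<close>.\<close>
      have "p = (p - k * f) + k * f" by simp
      then have "component a p = component a (p - k * f) + component (a - b) k * f"
        by (metis component_add component_mult_homogeneous[OF f(1)])
      then have "theta (component a p) = theta (component a (p - k * f) + component (a - b) k * f)"
        by (rule arg_cong)
      then have "theta p = theta (component (a - b) k) * theta f"
        using k component_homogeneous[OF 1(3), of a] by (simp add: point_def theta_add theta_mult)
      then have "m dvd theta p" using \<psi>(1) by (simp add: m_def)
      then show "rel x 0" unfolding rel_def using 1 by auto
    next
      assume "rel x 0"
      then obtain p s a where 1: "x = Fract p s" "p \<in> cox_part X a" "s \<in> cox_part X a" "s \<notin> ?Q" "m dvd theta p"
        unfolding rel_def by auto
      obtain \<omega> where \<omega>: "theta p = m * \<omega>" using 1(5) by (auto simp: dvd_def)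
      \<comment> \<open>\<open>u\<close> lifts the cofactor \<open>\<psi>\<close> of
        \<open>theta f\<close>, a unit at the point, and \<open>w\<close> lifts the quotient of
        \<open>theta p\<close> by \<open>m\<close>. Then \<open>p * u\<close> and
        \<open>w * f\<close> have the same restriction, so \<open>p * u\<close> lies in the ideal of
        \<open>f\<close> and the curve.\<close>
      obtain n u w where uw: "u \<in> cox_part X (b + nmul n H)" "w \<in> cox_part X (a + nmul n H)" "theta u = \<psi>" "theta w = \<omega>"
        using lifts[of a \<psi> \<omega>] by blast
      have pu: "p * u \<in> cox_part X (a + b + nmul n H)" and fw: "w * f \<in> cox_part X (a + b + nmul n H)"
        and su: "s * u \<in> cox_part X (a + b + nmul n H)"
        using cox_part_mult[OF 1(2) uw(1)] cox_part_mult[OF uw(2) f(1)] cox_part_mult[OF 1(3) uw(1)]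
        by (simp_all add: algebra_simps)
      have "theta (p * u - w * f) = 0"
        using \<omega> uw \<psi>(1) by (simp add: theta_diff theta_mult m_def)
      then have "p * u - w * f \<in> curve" using mem_curve_homogeneous[OF cox_part_diff[OF pu fw]] by blast
      then have "p * u \<in> ?I" using ideal by blast
      moreover have u: "u \<notin> ?Q" using notQ[OF uw(1)] uw(3) \<psi>(2) by simp
      then have "s * u \<notin> ?Q" using notQ_mult 1(4) by blast
      moreover have "x = Fract (p * u) (s * u)"
      proof -
        have nonzero: "s \<noteq> 0" "s * u \<noteq> 0" using notQ_nz[OF 1(4)] notQ_nz[OF u] by simp_all
        have "p * (s * u) = p * u * s" by (simp only: mult.assoc mult.commute[of u s])
        then show ?thesis unfolding 1(1) eq_fract(1)[OF nonzero] .
      qed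
      ultimately show "x \<in> stalk X ?Q ?I" unfolding stalk_def using pu su by blast
    qed
  next
    fix r :: "'k poly"
    obtain n u w where uw: "u \<in> cox_part X (b + nmul n H)" "w \<in> cox_part X (b + nmul n H)" "theta u = r" "theta w = (1 :: 'k poly)"
      using lifts[of b r 1] by blast
    have "w \<notin> ?Q" using notQ[OF uw(2)] uw(4) \<pi> by (simp add: prime_elem_def)
    moreover have "m dvd theta u - r * theta w" using uw(3,4) by simp
    ultimately have "rel (Fract u w) r" unfolding rel_def using uw(1,2) by blast
    moreover have "Fract u w \<in> stalk X ?Q UNIV"
      unfolding stalk_def using uw(1,2) \<open>w \<notin> ?Q\<close> by blast
    ultimately show "\<exists>x\<in>stalk X ?Q UNIV. rel x r" by blast
  qed
  also have "degree m = e * degree \<pi>" unfolding m_def using \<pi> by (intro degree_power_eq) auto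
  finally show ?thesis by (simp add: e_def)
qed

text \<open>The intersection number of the class with the curve: in the representative that vanishes
  on the chart of \<open>i\<close>, the divisor of \<open>i'\<close> is the only one left that meets
  the curve, and it does so once.\<close>

definition curve_degree :: "'p \<Rightarrow> int"
  where "curve_degree a = rep (insert i \<tau>) a i'"

lemma curve_degree_add: "curve_degree (a + b) = curve_degree a + curve_degree b"
  by (simp add: curve_degree_def rep_add[OF cones(1)])

text \<open>Monomials that survive on the curve are binary forms in the variables \<open>i\<close>
  and \<open>i'\<close>, of total degree the intersection number; subtracting a multiple of
  \<open>E\<close> moves the whole exponent to \<open>i'\<close>.\<close>

lemma key_degree:
  assumes s: "s \<in> cox_part X a" "m \<in> Poly_Mapping.keys s" "\<forall>\<rho>\<in>\<tau>. Poly_Mapping.lookup m \<rho> = 0"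
  shows "curve_degree a = int (Poly_Mapping.lookup m i) + int (Poly_Mapping.lookup m i')"
proof -
  let ?D = "\<lambda>\<rho>. int (Poly_Mapping.lookup m \<rho>)" and ?k = "int (Poly_Mapping.lookup m i)"
  have "cls X ?D = a" using s(1,2) by (auto simp: cox_part_def monomial_degree_def)
  then have "cls X (\<lambda>\<rho>. ?D \<rho> - ?k * E \<rho>) = a"
    using cls_scale_principal[OF E(1), of ?k] by (simp add: cls_diff)
  then have "rep (insert i \<tau>) a = (\<lambda>\<rho>. ?D \<rho> - ?k * E \<rho>)"
    using s(3) E by (intro rep_eqI[OF cones(1)]) auto
  then show ?thesis using E(4) by (simp add: curve_degree_def)
qed

lemma coeff_theta:
  "coeff (theta s) k = (\<Sum>m | m \<in> Poly_Mapping.keys s \<and> (\<forall>\<rho>\<in>\<tau>. Poly_Mapping.lookup m \<rho> = 0) \<and> Poly_Mapping.lookup m i = k.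
    Poly_Mapping.lookup s m)"
proof -
  have "coeff (theta s) k = (\<Sum>m\<in>Poly_Mapping.keys s.
      if (\<forall>\<rho>\<in>\<tau>. Poly_Mapping.lookup m \<rho> = 0) \<and> Poly_Mapping.lookup m i = k then Poly_Mapping.lookup s m else 0)"
    unfolding theta_def coeff_sum by (intro sum.cong refl) (simp add: theta_term_def coeff_monom)
  then show ?thesis by (simp add: sum.inter_filter[symmetric] conj_ac)
qed

interpretation swap: wall X \<M> H \<tau> i' i "\<lambda>\<rho>. - E \<rho>" by (rule wall_swap)

text \<open>The opposite chart dehomogenizes the same binary form by the other variable, so the
  coefficients are read in reverse.\<close>

lemma coeff_theta_swap:
  assumes s: "s \<in> cox_part X a"
  shows "coeff (swap.theta s) k = (if int k \<le> curve_degree a then coeff (theta s) (nat (curve_degree a) - k) else 0)"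
proof -
  have eq: "Poly_Mapping.lookup m i' = k \<longleftrightarrow> int k \<le> curve_degree a \<and> Poly_Mapping.lookup m i = nat (curve_degree a) - k"
    if "m \<in> Poly_Mapping.keys s" "\<forall>\<rho>\<in>\<tau>. Poly_Mapping.lookup m \<rho> = 0" for m
    using key_degree[OF s that] by auto
  show ?thesis
  proof (cases "int k \<le> curve_degree a")
    case True
    have "{m. m \<in> Poly_Mapping.keys s \<and> (\<forall>\<rho>\<in>\<tau>. Poly_Mapping.lookup m \<rho> = 0) \<and> Poly_Mapping.lookup m i' = k}
        = {m. m \<in> Poly_Mapping.keys s \<and> (\<forall>\<rho>\<in>\<tau>. Poly_Mapping.lookup m \<rho> = 0) \<and> Poly_Mapping.lookup m i = nat (curve_degree a) - k}"
      using eq True by blast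
    then show ?thesis using True by (simp add: coeff_theta swap.coeff_theta)
  next
    case False
    have "{m. m \<in> Poly_Mapping.keys s \<and> (\<forall>\<rho>\<in>\<tau>. Poly_Mapping.lookup m \<rho> = 0) \<and> Poly_Mapping.lookup m i' = k} = {}"
      using eq False by blast
    then show ?thesis using False by (simp only: swap.coeff_theta) simp
  qed
qed

lemma degree_theta:
  assumes s: "s \<in> cox_part X a" "s \<notin> curve"
  shows "int (degree (theta s)) \<le> curve_degree a"
proof -
  have nz: "theta s \<noteq> 0" using s mem_curve_homogeneous by blast
  then have "coeff (theta s) (degree (theta s)) \<noteq> 0" by simp
  then obtain m where "m \<in> Poly_Mapping.keys s" "\<forall>\<rho>\<in>\<tau>. Poly_Mapping.lookup m \<rho> = 0" "Poly_Mapping.lookup m i = degree (theta s)"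
    unfolding coeff_theta by (rule sum.not_neutral_contains_not_neutral) auto
  then show ?thesis using key_degree[OF s(1)] by fastforce
qed

text \<open>Reversing coefficients turns the gap between formal and actual degree into a zero at the
  origin of the opposite chart.\<close>

lemma order_swap:
  assumes s: "s \<in> cox_part X a" "s \<notin> curve"
  shows "swap.theta s \<noteq> 0" "order_at [:0, 1:] (swap.theta s) = nat (curve_degree a) - degree (theta s)"
proof -
  have nz: "theta s \<noteq> 0" using s mem_curve_homogeneous by blast
  let ?n = "nat (curve_degree a)" and ?F = "swap.theta s"
  define e where "e = ?n - degree (theta s)"
  have le: "degree (theta s) \<le> ?n" "0 \<le> curve_degree a" using degree_theta[OF s] by auto
  have "coeff ?F e = coeff (theta s) (degree (theta s))"
    using le by (simp add: coeff_theta_swap[OF s(1)] e_def)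
  then have e_nz: "coeff ?F e \<noteq> 0" using nz by simp
  then show "?F \<noteq> 0" by auto
  have small: "coeff ?F k = 0" if "k < e" for k
    using le that by (auto simp: coeff_theta_swap[OF s(1)] e_def intro!: coeff_eq_0)
  have "monom 1 e dvd ?F" using small by (simp add: monom_1_dvd_iff')
  then obtain \<psi> where \<psi>: "?F = monom 1 e * \<psi>" by (auto simp: dvd_def)
  have "coeff \<psi> 0 \<noteq> 0" using e_nz unfolding \<psi> by (simp add: coeff_monom_mult)
  then have "\<not> [:0, 1:] dvd \<psi>" by (auto simp: dvd_def)
  moreover have "?F = [:0, 1:] ^ e * \<psi>" using \<psi> by (simp add: monom_altdef)
  ultimately show "order_at [:0, 1:] ?F = nat (curve_degree a) - degree (theta s)"
    unfolding e_def[symmetric] by (intro order_at_eqI) auto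
qed

lemma curve_swap: "(swap.curve :: ('r, 'k::field) cox set) = curve"
proof -
  have "swap.theta (component a s) = 0 \<longleftrightarrow> theta (component a s) = 0" for s :: "('r, 'k) cox" and a
  proof -
    have c: "component a s \<in> cox_part X a" by (rule component_in_cox_part)
    have "theta (component a s) = 0" if "swap.theta (component a s) = 0"
      using order_swap(1)[OF c] mem_curve_homogeneous[OF c] that by blast
    moreover have "swap.theta (component a s) = 0" if "theta (component a s) = 0"
      using that by (intro poly_eqI) (simp add: coeff_theta_swap[OF c])
    ultimately show ?thesis by blast
  qed
  then show ?thesis by (simp add: point_def swap.point_def)
qed

text \<open>
  The only point of the curve outside the chart of \<open>t\<close> is the origin of the opposite chart.
\<close>

definition infinity :: "('r, 'k::field) cox set"
  where "infinity = swap.point [:0, 1:]"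

lemma linear_monic_prime: "[:0, 1:] \<in> (monic_primes :: 'k::field poly set)"
  by (rule monic_prime_linear) simp_all

text \<open>A point outside the chart of \<open>i\<close> lies in the opposite chart and contains
  the variable \<open>i'\<close>, which is the coordinate there; so it is the origin of that
  chart.\<close>

lemma points_on_curve:
  "{Q \<in> toric_points X. (curve :: ('r, 'k::field) cox set) \<subset> Q} = insert infinity (point ` monic_primes)"
proof (intro equalityI subsetI)
  fix Q :: "('r, 'k) cox set"
  assume "Q \<in> {Q \<in> toric_points X. curve \<subset> Q}"
  then have Q: "Q \<in> toric_points X" "curve \<subseteq> Q" "Q \<noteq> curve" by auto
  show "Q \<in> insert infinity (point ` monic_primes)"
  proof (cases "\<forall>\<rho>. \<rho> \<notin> insert i \<tau> \<longrightarrow> cox_var \<rho> \<notin> Q")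
    case True
    then obtain \<pi> where "Q = point \<pi>" "\<pi> = 0 \<or> \<pi> \<in> monic_primes"
      using chart_point_generator[OF Q(1,2)] by blast
    then show ?thesis using Q(3) by blast
  next
    case False
    then have vars: "\<And>\<rho>. \<rho> \<notin> insert i' \<tau> \<Longrightarrow> cox_var \<rho> \<notin> Q" using point_above_curve[OF Q(1,2)] by blast
    obtain \<rho> where \<rho>: "\<rho> \<notin> insert i \<tau>" "cox_var \<rho> \<in> Q" using False by blast
    then have "\<rho> = i'" using vars[of \<rho>] by blast
    then have i'Q: "cox_var i' \<in> Q" using \<rho>(2) by simp
    obtain \<pi> where \<pi>: "Q = swap.point \<pi>" "\<pi> = 0 \<or> \<pi> \<in> monic_primes"
      using swap.chart_point_generator[OF Q(1)] Q(2) vars curve_swap by metis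
    have "\<pi> \<in> monic_primes" using \<pi> Q(3) curve_swap by auto
    moreover have "\<pi> dvd [:0, 1:]"
      using i'Q swap.mem_point_homogeneous[OF cox_var_in_cox_part, of i' \<pi>] i' by (simp add: \<pi>(1) swap.theta_cox_var)
    ultimately have "\<pi> = [:0, 1:]" by (intro monic_prime_linear(2)) auto
    then show ?thesis using \<pi>(1) by (simp add: infinity_def)
  qed
next
  fix Q :: "('r, 'k) cox set"
  assume "Q \<in> insert infinity (point ` monic_primes)"
  then consider "Q = swap.point [:0, 1:]" | \<pi> where "\<pi> \<in> monic_primes" "Q = point \<pi>"
    by (auto simp: infinity_def)
  then show "Q \<in> {Q \<in> toric_points X. curve \<subset> Q}"
  proof cases
    case 1
    have pr: "prime_elem [:0, 1 :: 'k:]" using linear_monic_prime by (simp add: monic_primes_def)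
    have "\<not> Q \<subseteq> swap.curve" using swap.point_dvd[of "[:0, 1 :: 'k:]" 0] 1 by auto
    then show ?thesis using 1 pr swap.point_toric[of "[:0, 1 :: 'k:]"] swap.curve_subset_point curve_swap by auto
  next
    case 2
    then have "prime_elem \<pi>" by (simp add: monic_primes_def)
    then show ?thesis using 2 point_toric[of \<pi>] curve_subset_point[of \<pi>] point_dvd[of \<pi> 0] by auto
  qed
qed

lemma infinity_notin: "infinity \<notin> point ` (monic_primes :: 'k::field poly set)"
proof
  assume "infinity \<in> point ` (monic_primes :: 'k poly set)"
  then obtain \<pi> :: "'k poly" where \<pi>: "\<pi> \<in> monic_primes" "swap.point [:0, 1:] = point \<pi>"
    by (auto simp: infinity_def)
  have "cox_var i' \<in> swap.point [:0, 1 :: 'k:]"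
    using swap.mem_point_homogeneous[OF cox_var_in_cox_part, of i' "[:0, 1 :: 'k:]"] i' by (simp add: swap.theta_cox_var)
  moreover have "cox_var i' \<notin> point \<pi>"
    using \<pi>(1) i' neq by (intro cox_var_notin_point) (auto simp: monic_primes_def prime_elem_def)
  ultimately show False using \<pi>(2) by simp
qed

lemma inj_point: "inj_on point (monic_primes :: 'k::field poly set)"
proof (rule inj_onI)
  fix \<pi> \<pi>' :: "'k poly" assume *: "\<pi> \<in> monic_primes" "\<pi>' \<in> monic_primes" "point \<pi> = point \<pi>'"
  then show "\<pi> = \<pi>'" using point_dvd[of \<pi> \<pi>'] point_dvd[of \<pi>' \<pi>]
    by (intro monic_dvd_antisym) (auto simp: monic_primes_def)
qed

lemma curve_in_curves: "(curve :: ('r, 'k::field) cox set) \<in> curves X"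
proof -
  have nested: False if Q: "Q \<in> toric_points X" "Q' \<in> toric_points X" "(curve :: ('r, 'k) cox set) \<subset> Q" "Q \<subset> Q'" for Q Q'
  proof -
    have chart: False if gen: "Q = P \<pi>" "Q' = P \<pi>'" "\<pi> \<in> monic_primes" "\<pi>' \<in> monic_primes"
      and dvd: "\<And>\<pi> \<pi>' :: 'k poly. P \<pi> \<subseteq> P \<pi>' \<Longrightarrow> \<pi>' dvd \<pi>" for P and \<pi> \<pi>' :: "'k poly"
    proof -
      have "\<pi>' dvd \<pi>" using dvd[of \<pi> \<pi>'] gen Q(4) by blast
      moreover have "prime_elem \<pi>" "prime_elem \<pi>'" using gen by (auto simp: monic_primes_def)
      ultimately have "\<pi> dvd \<pi>'"
        using prime_elem_imp_irreducible by (meson irreducibleD' prime_elem_not_unit)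
      then have "\<pi> = \<pi>'" using \<open>\<pi>' dvd \<pi>\<close> gen by (intro monic_dvd_antisym) (auto simp: monic_primes_def)
      then show False using gen Q(4) by blast
    qed
    have sub: "curve \<subseteq> Q'" using Q by blast
    \<comment> \<open>The chart is chosen for the larger prime; the variables that avoid
      \<open>Q'\<close> also avoid \<open>Q\<close>, so one chart describes both by polynomials,
      where nonzero nested primes coincide.\<close>
    from point_above_curve[OF Q(2) sub] show False
    proof
      assume vars: "\<forall>\<rho>. \<rho> \<notin> insert i \<tau> \<longrightarrow> cox_var \<rho> \<notin> Q'"
      obtain \<pi>' where \<pi>': "Q' = point \<pi>'" "\<pi>' = 0 \<or> \<pi>' \<in> monic_primes"
        using chart_point_generator[OF Q(2) sub] vars by blast
      obtain \<pi> where \<pi>: "Q = point \<pi>" "\<pi> = 0 \<or> \<pi> \<in> monic_primes"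
        using chart_point_generator[OF Q(1)] Q(3,4) vars by blast
      have "\<pi> \<noteq> 0" "\<pi>' \<noteq> 0" using \<pi>(1) \<pi>'(1) Q(3,4) by blast+
      then show False using chart[of point \<pi> \<pi>'] \<pi> \<pi>' point_dvd by blast
    next
      assume vars: "\<forall>\<rho>. \<rho> \<notin> insert i' \<tau> \<longrightarrow> cox_var \<rho> \<notin> Q'"
      have sub': "swap.curve \<subseteq> Q'" "swap.curve \<subset> Q" using sub Q(3) by (simp_all add: curve_swap)
      obtain \<pi>' where \<pi>': "Q' = swap.point \<pi>'" "\<pi>' = 0 \<or> \<pi>' \<in> monic_primes"
        using swap.chart_point_generator[OF Q(2) sub'(1)] vars by blast
      obtain \<pi> where \<pi>: "Q = swap.point \<pi>" "\<pi> = 0 \<or> \<pi> \<in> monic_primes"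
        using swap.chart_point_generator[OF Q(1)] sub' Q(4) vars by blast
      have "\<pi> \<noteq> 0" "\<pi>' \<noteq> 0" using \<pi>(1) \<pi>'(1) sub'(2) Q(4) by blast+
      then show False using chart[of swap.point \<pi> \<pi>'] \<pi> \<pi>' swap.point_dvd by blast
    qed
  qed
  have "curve \<in> (toric_points X :: ('r, 'k) cox set set)" by (rule point_toric) simp
  moreover have "\<exists>Q\<in>toric_points X. (curve :: ('r, 'k) cox set) \<subset> Q"
  proof (rule bexI)
    have "infinity \<in> {Q \<in> toric_points X. (curve :: ('r, 'k) cox set) \<subset> Q}"
      unfolding points_on_curve by (rule insertI1)
    then show "(curve :: ('r, 'k) cox set) \<subset> infinity" "infinity \<in> (toric_points X :: ('r, 'k) cox set set)"
      by blast+
  qed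
  ultimately show ?thesis unfolding curves_def using nested by blast
qed

text \<open>The finite points contribute the degree of \<open>theta f\<close>, infinity the gap up
  to \<open>curve_degree b\<close>; the total is independent of \<open>f\<close>.\<close>

lemma zeros_degree_curve:
  assumes f: "f \<in> cox_part X b" "f \<notin> (curve :: ('r, 'k::field) cox set)"
  shows "zeros_degree X curve f = enat (nat (curve_degree b))"
proof -
  let ?qd = "\<lambda>Q. quotient_dim (stalk X Q UNIV) (stalk X Q (module.span (*) (insert f curve)))"
  let ?n = "nat (curve_degree b)" and ?F = "theta f"
  have nz: "?F \<noteq> 0" using f mem_curve_homogeneous by blast
  have le: "degree ?F \<le> ?n" using degree_theta[OF f] by simp
  have qd_point: "?qd (point \<pi>) = enat (order_at \<pi> ?F * degree \<pi>)" if "\<pi> \<in> monic_primes" for \<pi>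
    using that f by (intro local_degree) (auto simp: monic_primes_def)
  have qd_infinity: "?qd infinity = enat (?n - degree ?F)"
  proof -
    have "prime_elem [:0, 1 :: 'k:]" using linear_monic_prime by (simp add: monic_primes_def)
    moreover have "f \<notin> swap.curve" using f(2) by (simp add: curve_swap)
    ultimately show ?thesis
      using swap.local_degree[of "[:0, 1 :: 'k:]" f b] f(1) order_swap(2)[OF f]
      by (simp add: curve_swap infinity_def)
  qed
  obtain T\<^sub>0 where T0: "T\<^sub>0 \<subseteq> monic_primes" "finite T\<^sub>0"
    "\<forall>T\<subseteq>monic_primes. finite T \<longrightarrow> T\<^sub>0 \<subseteq> T \<longrightarrow> (\<Sum>\<pi>\<in>T. order_at \<pi> ?F * degree \<pi>) = degree ?F"
    using sum_order_degree[OF nz] by (elim exE conjE)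
  have total: "(\<Sum>Q\<in>insert infinity (point ` T). ?qd Q) = enat ?n"
    if T: "T \<subseteq> monic_primes" "finite T" "T\<^sub>0 \<subseteq> T" for T
  proof -
    have "(\<Sum>Q\<in>point ` T. ?qd Q) = (\<Sum>\<pi>\<in>T. ?qd (point \<pi>))"
      using inj_on_subset[OF inj_point T(1)] by (simp add: sum.reindex)
    also have "\<dots> = (\<Sum>\<pi>\<in>T. enat (order_at \<pi> ?F * degree \<pi>))"
      using T(1) qd_point by (intro sum.cong) auto
    also have "\<dots> = enat (\<Sum>\<pi>\<in>T. order_at \<pi> ?F * degree \<pi>)"
      by (simp only: of_nat_eq_enat[symmetric] of_nat_sum)
    also have "\<dots> = enat (degree ?F)"
      using T0(3) T by simp
    finally have "(\<Sum>Q\<in>point ` T. ?qd Q) = enat (degree ?F)" .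
    moreover have "infinity \<notin> point ` T" using infinity_notin T(1) by blast
    ultimately show ?thesis using T(2) le by (simp add: qd_infinity)
  qed
  show ?thesis
    unfolding zeros_degree_def points_on_curve
  proof (rule antisym[OF SUP_least])
    fix T :: "('r, 'k) cox set set" assume "T \<in> {T. finite T \<and> T \<subseteq> insert infinity (point ` monic_primes)}"
    then have T: "finite T" "T \<subseteq> insert infinity (point ` monic_primes)" by auto
    then have "T - {infinity} \<subseteq> point ` monic_primes" "finite (T - {infinity})" by auto
    then obtain T1 where T1: "T1 \<subseteq> monic_primes" "finite T1" "T - {infinity} = point ` T1"
      using finite_subset_image by metis
    \<comment> \<open>A partial sum is enlarged to one that contains infinity and the threshold set,
      where the total is known exactly.\<close>
    have "(\<Sum>Q\<in>T. ?qd Q) \<le> (\<Sum>Q\<in>insert infinity (point ` (T1 \<union> T\<^sub>0)). ?qd Q)"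
      using T1 T0(2) by (intro sum_mono2) auto
    also have "\<dots> = enat ?n" using T1 T0 by (intro total) auto
    finally show "(\<Sum>Q\<in>T. ?qd Q) \<le> enat ?n" .
  next
    have "(\<Sum>Q\<in>insert infinity (point ` T\<^sub>0). ?qd Q) \<le>
        (SUP T\<in>{T. finite T \<and> T \<subseteq> insert infinity (point ` monic_primes)}. \<Sum>Q\<in>T. ?qd Q)"
      using T0(1,2) by (intro SUP_upper) auto
    then show "enat ?n \<le> (SUP T\<in>{T. finite T \<and> T \<subseteq> insert infinity (point ` monic_primes)}. \<Sum>Q\<in>T. ?qd Q)"
      using total[of T\<^sub>0] T0 by simp
  qed
qed

lemma nonneg_on_curve_degree:
  assumes "nonneg_on_curve X (curve :: ('r, 'k::field) cox set) a"
  shows "0 \<le> curve_degree a"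
proof -
  obtain b f g where fg: "f \<in> cox_part X (a + b)" "f \<notin> (curve :: ('r, 'k) cox set)" "g \<in> cox_part X b" "g \<notin> (curve :: ('r, 'k) cox set)"
    "zeros_degree X curve g \<le> zeros_degree X curve f"
    using assms unfolding nonneg_on_curve_def by blast
  have "nat (curve_degree b) \<le> nat (curve_degree (a + b))"
    using fg(5) zeros_degree_curve[OF fg(1,2)] zeros_degree_curve[OF fg(3,4)] by simp
  moreover have "0 \<le> curve_degree b" "0 \<le> curve_degree (a + b)"
    using degree_theta[OF fg(3,4)] degree_theta[OF fg(1,2)] by linarith+
  ultimately show ?thesis by (simp add: curve_degree_add)
qed

end

section \<open>Nef classes\<close>

lemma quotient_dim_antimono: "J' \<subseteq> J \<Longrightarrow> quotient_dim A J \<le> quotient_dim A J'"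
  unfolding quotient_dim_def by (intro SUP_subset_mono) auto

text \<open>The ideal of \<open>p * f\<close> is contained in that of \<open>f\<close>, so its local
  quotients are at least as large. This holds on every curve without computing a degree.\<close>

lemma zeros_degree_mult:
  "zeros_degree X (P :: ('r::{finite,linorder}, 'k::field) cox set) f \<le> zeros_degree X P (p * f)"
proof -
  interpret S: module "(*) :: ('r, 'k) cox \<Rightarrow> _" by (rule module_cox)
  have "S.span (insert (p * f) P) \<subseteq> S.span (insert f P)"
  proof (rule S.span_minimal)
    have "f \<in> S.span (insert f P)" by (simp add: S.span_base)
    then show "insert (p * f) P \<subseteq> S.span (insert f P)"
      using S.span_scale[of f "insert f P" p] S.span_superset[of "insert f P"] by auto
  qed simp
  then have "quotient_dim (stalk X Q UNIV) (stalk X Q (S.span (insert f P)))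
      \<le> quotient_dim (stalk X Q UNIV) (stalk X Q (S.span (insert (p * f) P)))" for Q
    by (intro quotient_dim_antimono) (auto simp: stalk_def)
  then show ?thesis
    unfolding zeros_degree_def by (intro SUP_mono) (auto intro!: sum_mono)
qed

context maximal_cones
begin

lemma wall_through:
  assumes A: "A \<in> \<M>" "i \<in> A"
  obtains i' E where "wall X \<M> H (A - {i}) i i' E" "i' \<notin> A" "insert i' (A - {i}) \<in> \<M>"
proof -
  obtain i' E where *: "i' \<notin> A" "insert i' (A - {i}) \<in> \<M>" "cls X E = 0" "\<forall>j\<in>A - {i}. E j = 0" "E i = 1" "E i' = -1"
      "\<forall>B\<in>\<M>. A - {i} \<subseteq> B \<longrightarrow> B = A \<or> B = insert i' (A - {i})"
    using adjacent[OF A] by blast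
  have "insert i (A - {i}) = A" using A(2) by blast
  then have "wall X \<M> H (A - {i}) i i' E"
    using * A by unfold_locales auto
  then show thesis using *(1,2) that by blast
qed

text \<open>For the hard inclusion one walks from \<open>A\<close> towards \<open>\<rho>\<close>
  across separating walls. Each crossing changes the coefficient at \<open>\<rho>\<close> by an
  intersection number times the negative integer \<open>E \<rho>\<close>. For nef \<open>a\<close>
  it cannot increase, so nonnegativity at the end of the walk, where \<open>\<rho> \<in> A\<close>,
  goes back to the start. For the ample \<open>H\<close> it drops strictly, which ends the
  walk.\<close>

lemma nef_eq: "nef TYPE('k::field) X = basepoint_free"
proof (intro equalityI subsetI)
  fix a assume "a \<in> basepoint_free"
  then show "a \<in> nef TYPE('k) X"
    unfolding nef_def using basepoint_free_nonneg_on_curve by (auto simp: curves_def)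
next
  fix a assume a: "a \<in> nef TYPE('k) X"
  have nonneg: "0 \<le> rep A a i'" if "wall X \<M> H (A - {i}) i i' E" "A \<in> \<M>" "i \<in> A" for A i i' E
  proof -
    interpret wall X \<M> H "A - {i}" i i' E by fact
    have "insert i (A - {i}) = A" using that(3) by blast
    moreover have "nonneg_on_curve X (curve :: ('r, 'k) cox set) a"
      using a curve_in_curves[where ?'k = 'k] by (simp add: nef_def)
    ultimately show ?thesis using nonneg_on_curve_degree[where ?'k = 'k, of a] by (simp add: curve_degree_def)
  qed
  have "0 \<le> rep A a \<rho>" if "A \<in> \<M>" for A \<rho>
    using that
  proof (induction "nat (rep A H \<rho>)" arbitrary: A rule: less_induct)
    case less
    show ?case
    proof (cases "\<rho> \<in> A")
      case True
      then show ?thesis using less.prems by (simp add: rep_zero_on)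
    next
      case False
      obtain i E\<^sub>0 where E0: "i \<in> A" "cls X E\<^sub>0 = 0" "\<forall>j\<in>A - {i}. E\<^sub>0 j = 0" "E\<^sub>0 i = 1" "E\<^sub>0 \<rho> < 0"
        using decreasing[OF less.prems False] by blast
      obtain i' E where w: "wall X \<M> H (A - {i}) i i' E" "i' \<notin> A" "insert i' (A - {i}) \<in> \<M>"
        using wall_through[OF less.prems E0(1)] .
      interpret wall X \<M> H "A - {i}" i i' E by (rule w(1))
      let ?A' = "insert i' (A - {i})"
      \<comment> \<open>The character that separates \<open>A\<close> from \<open>\<rho>\<close> is
        the character of the wall, as a principal divisor is determined by its values on
        \<open>A\<close>.\<close>
      have "(\<lambda>\<rho>. E \<rho> - E\<^sub>0 \<rho>) = (\<lambda>\<rho>. 0)"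
      proof (rule rep_principal[OF less.prems])
        show "cls X (\<lambda>\<rho>. E \<rho> - E\<^sub>0 \<rho>) = 0" using E(1) E0(2) by (simp add: cls_diff)
        show "E j - E\<^sub>0 j = 0" if "j \<in> A" for j using that E(2)[of j] E(3) E0(3,4) by (cases "j = i") auto
      qed
      then have "E \<rho> - E\<^sub>0 \<rho> = 0" by (rule fun_cong)
      then have neg: "E \<rho> < 0" using E0(5) by simp
      \<comment> \<open>On \<open>?A'\<close> only the coefficient at \<open>i'\<close> has to be
        cancelled, and \<open>E i' = -1\<close> fixes the multiple of \<open>E\<close> as
        \<open>rep A b i'\<close>.\<close>
      have rep': "rep ?A' b = (\<lambda>\<rho>. rep A b \<rho> + rep A b i' * E \<rho>)" for b
      proof (rule rep_eqI[OF w(3)])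
        show "cls X (\<lambda>\<rho>. rep A b \<rho> + rep A b i' * E \<rho>) = b"
          using cls_scale_principal[OF E(1)] by (simp add: cls_add cls_rep[OF less.prems])
        show "rep A b j + rep A b i' * E j = 0" if "j \<in> ?A'" for j
          using that E(2)[of j] E(4) rep_zero_on[OF less.prems, of j] by auto
      qed
      have "rep A H i' * E \<rho> < 0" using rep_H_pos[OF less.prems w(2)] neg by (simp add: mult_less_0_iff)
      moreover have "0 < rep A H \<rho>" by (rule rep_H_pos[OF less.prems False])
      ultimately have "nat (rep ?A' H \<rho>) < nat (rep A H \<rho>)" by (simp add: rep')
      then have "0 \<le> rep ?A' a \<rho>" using w(3) by (rule less.hyps)
      moreover have "rep A a i' * E \<rho> \<le> 0"
        using nonneg[OF w(1) less.prems E0(1)] neg by (simp add: mult_le_0_iff)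
      ultimately show ?thesis by (simp add: rep')
    qed
  qed
  then show "a \<in> basepoint_free" by (simp add: basepoint_free_def)
qed

lemma nef_generators_eq: "nef_generators TYPE('k::field) X = bpf.atoms"
  unfolding nef_generators_def nef_eq bpf_monoid[symmetric] by (rule bpf.minimal_generators_eq_atoms)

lemma finite_minimal_elements:
  assumes "A \<subseteq> nef TYPE('k::field) X"
  shows "finite (minimal_elements TYPE('k) X A)"
proof (rule bpf.finite_antichain_monoid)
  show "minimal_elements TYPE('k) X A \<subseteq> bpf.monoid"
    using assms by (auto simp: minimal_elements_def nef_eq bpf_monoid)
  show "a = b" if "a \<in> minimal_elements TYPE('k) X A" "b \<in> minimal_elements TYPE('k) X A" "b - a \<in> bpf.monoid" for a b
    using that by (auto simp: minimal_elements_def nef_le_def nef_eq bpf_monoid)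
qed

text \<open>If \<open>p\<close> did not vanish on the curve, then \<open>p * f\<close> and
  \<open>g\<close> would witness nonnegativity of \<open>d\<close>, with \<open>f\<close> and
  \<open>g\<close> the witnesses for \<open>a\<close>.\<close>

lemma nef_if_nonneg_factor:
  assumes a: "a \<in> nef TYPE('k::field) X" and P: "P \<in> curves X" "\<not> nonneg_on_curve X (P :: ('r, 'k) cox set) d"
    and p: "p \<in> cox_part X (d - a)"
  shows "p \<in> P"
proof (rule ccontr)
  assume "p \<notin> P"
  have pr: "\<And>x y. x * y \<in> P \<Longrightarrow> x \<in> P \<or> y \<in> P" using P(1) by (auto simp: curves_def toric_points_def)
  obtain b f g where fg: "f \<in> cox_part X (a + b)" "f \<notin> P" "g \<in> cox_part X b" "g \<notin> P" "zeros_degree X P g \<le> zeros_degree X P f"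
    using a P(1) unfolding nef_def nonneg_on_curve_def by blast
  have "p * f \<in> cox_part X (d + b)" using cox_part_mult[OF p fg(1)] by (simp add: algebra_simps)
  moreover have "p * f \<notin> P" using pr \<open>p \<notin> P\<close> fg(2) by blast
  moreover have "zeros_degree X P g \<le> zeros_degree X P (p * f)" using fg(5) zeros_degree_mult order_trans by blast
  ultimately show False using P(2) fg(3,4) unfolding nonneg_on_curve_def by blast
qed

end

section \<open>Generation in regular degrees\<close>

lemma monomial_mult:
  assumes "\<And>\<rho>. 0 \<le> D \<rho>" "\<And>\<rho>. 0 \<le> D' \<rho>"
  shows "Poly_Mapping.single (exponents D) 1 * Poly_Mapping.single (exponents D') 1
    = (Poly_Mapping.single (exponents (\<lambda>\<rho>. D \<rho> + D' \<rho>)) 1 :: ('r::{finite,linorder}, 'k::field) cox)"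
proof -
  have "exponents D + exponents D' = exponents (\<lambda>\<rho>. D \<rho> + D' \<rho>)"
    using assms by (intro poly_mapping_eqI) (simp add: lookup_add nat_add_distrib)
  then show ?thesis by (simp add: mult_single)
qed

lemma monomial_power:
  assumes "\<And>\<rho>. 0 \<le> D \<rho>"
  shows "Poly_Mapping.single (exponents D) 1 ^ n
    = (Poly_Mapping.single (exponents (\<lambda>\<rho>. int n * D \<rho>)) 1 :: ('r::{finite,linorder}, 'k::field) cox)"
proof (induction n)
  case 0
  have "exponents (\<lambda>\<rho> :: 'r. 0) = 0" by (intro poly_mapping_eqI) simp
  then show ?case by simp
next
  case (Suc n)
  then show ?case using monomial_mult[of D "\<lambda>\<rho>. int n * D \<rho>"] assms by (simp add: algebra_simps)
qed

lemma xhat_monomial: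
  "xhat X \<sigma> = (Poly_Mapping.single (exponents (\<lambda>\<rho>. if ray X \<rho> \<subseteq> \<sigma> then 0 else 1)) 1 :: ('r::{finite,linorder}, 'k::field) cox)"
proof -
  have "xhat X \<sigma> = (\<Prod>\<rho>\<in>UNIV. (cox_var \<rho> :: ('r, 'k) cox) ^ Poly_Mapping.lookup (exponents (\<lambda>\<rho>. if ray X \<rho> \<subseteq> \<sigma> then 0 else 1)) \<rho>)"
    unfolding xhat_def by (intro prod.mono_neutral_cong_left) auto
  then show ?thesis by (simp only: monomial_eq_prod)
qed

locale regular_module = maximal_cones X \<M> H + cox_module X M
  for X :: "('n::finite, 'r::{finite,linorder}, 'p::ab_group_add) toric" and \<M> H
    and M :: "('r, 'k::field, 'p, 'm::ab_group_add) gmodule"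
begin

lemma regular_add_nef:
  assumes d: "d \<in> reg X M" and n: "n \<in> nef TYPE('k) X"
  shows "d + n \<in> reg X M"
proof -
  have add: "n + n' \<in> nef TYPE('k) X" if "n' \<in> nef TYPE('k) X" for n'
    using n that bpf.monoid_add by (simp add: nef_eq bpf_monoid)
  have "local_cohomology_vanishes X M i (d + n - lincomb (nef_generators TYPE('k) X) \<mu> + n')"
    if "i > 0" "(\<Sum>c\<in>nef_generators TYPE('k) X. \<mu> c) = i - 1" "n' \<in> nef TYPE('k) X" for i \<mu> n'
  proof -
    have "local_cohomology_vanishes X M i (d - lincomb (nef_generators TYPE('k) X) \<mu> + (n + n'))"
      using d that add[OF that(3)] by (simp add: reg_def is_regular_def Let_def)
    then show ?thesis by (simp add: algebra_simps)
  qed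
  moreover have "local_cohomology_vanishes X M 0 (d + n + c + n')"
    if "c \<in> nef_generators TYPE('k) X" "n' \<in> nef TYPE('k) X" for c n'
  proof -
    have "local_cohomology_vanishes X M 0 (d + c + (n + n'))"
      using d that add[OF that(2)] by (simp add: reg_def is_regular_def Let_def)
    then show ?thesis by (simp add: algebra_simps)
  qed
  ultimately show ?thesis by (simp add: reg_def is_regular_def Let_def)
qed

lemma regular_vanishing:
  assumes d: "d \<in> reg X M" and c: "c \<in> bpf.atoms"
  shows "local_cohomology_vanishes X M (Suc q) (d - nmul q c)" "local_cohomology_vanishes X M 0 (d + c)"
proof -
  have zero: "0 \<in> nef TYPE('k) X" using bpf.monoid_zero by (simp add: nef_eq bpf_monoid)
  let ?\<mu> = "\<lambda>c'. if c' = c then q else 0"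
  have "(\<Sum>c'\<in>bpf.atoms. ?\<mu> c') = Suc q - 1" using c bpf.finite_atoms by simp
  then have "local_cohomology_vanishes X M (Suc q) (d - lincomb bpf.atoms ?\<mu> + 0)"
    using d zero unfolding reg_def is_regular_def Let_def nef_generators_eq by blast
  then show "local_cohomology_vanishes X M (Suc q) (d - nmul q c)"
    using lincomb_single[OF bpf.finite_atoms c] by simp
  have "local_cohomology_vanishes X M 0 (d + c + 0)"
    using d zero c unfolding reg_def is_regular_def Let_def nef_generators_eq by blast
  then show "local_cohomology_vanishes X M 0 (d + c)" by simp
qed

text \<open>Each listed cone, maximal or not, lies in a maximal one, whose monomial section of
  \<open>c\<close> does not involve the rays of the cone. It therefore divides a power of
  \<open>xhat\<close>, as \<open>koszul_cech\<close> requires.\<close>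

lemma generation_step:
  assumes d: "d \<in> reg X M" and c: "c \<in> bpf.atoms"
  shows "part M (d + c) \<subseteq> span (part M d)"
proof
  fix z assume z: "z \<in> part M (d + c)"
  have "\<exists>cs. distinct cs \<and> set cs = fan X" using finite_distinct_list[OF fan_finite] by blast
  then have cones: "set (cone_list X) = fan X" unfolding cone_list_def by (rule someI2_ex) blast
  let ?s = "length (cone_list X)"
  have "\<forall>j. \<exists>B. j < ?s \<longrightarrow> B \<in> \<M> \<and> {\<rho>. ray X \<rho> \<subseteq> cone_list X ! j} \<subseteq> B"
  proof
    fix j
    show "\<exists>B. j < ?s \<longrightarrow> B \<in> \<M> \<and> {\<rho>. ray X \<rho> \<subseteq> cone_list X ! j} \<subseteq> B"
      using cone_subset[of "cone_list X ! j"] nth_mem[of j "cone_list X"] unfolding cones by blast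
  qed
  then have "\<exists>A. \<forall>j. j < ?s \<longrightarrow> A j \<in> \<M> \<and> {\<rho>. ray X \<rho> \<subseteq> cone_list X ! j} \<subseteq> A j" by (rule choice)
  then obtain A where A: "\<And>j. j < ?s \<Longrightarrow> A j \<in> \<M>" "\<And>j. j < ?s \<Longrightarrow> {\<rho>. ray X \<rho> \<subseteq> cone_list X ! j} \<subseteq> A j"
    by blast
  define \<theta> :: "nat \<Rightarrow> 'r \<Rightarrow> int" where "\<theta> j \<rho> = (if ray X \<rho> \<subseteq> cone_list X ! j then 0 else 1)" for j \<rho>
  \<comment> \<open>\<open>N\<close> bounds the exponents of all sections \<open>m j\<close>, so the
    exponents \<open>D'\<close> of the cofactors are nonnegative; on the rays of the cone both terms
    of \<open>D'\<close> are 0.\<close>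
  define N where "N = (\<Sum>(j, \<rho>)\<in>{..<?s} \<times> UNIV. nat (rep (A j) c \<rho>))"
  define D' where "D' j \<rho> = int N * \<theta> j \<rho> - rep (A j) c \<rho>" for j \<rho>
  have c_nef: "0 \<le> rep (A j) c \<rho>" if "j < ?s" for j \<rho>
    using c A(1)[OF that] bpf_monoid by (auto simp: bpf.atoms_def basepoint_free_def)
  have D'_nonneg: "0 \<le> D' j \<rho>" if j: "j < ?s" for j \<rho>
  proof (cases "ray X \<rho> \<subseteq> cone_list X ! j")
    case True
    then have "\<rho> \<in> A j" using A(2)[OF j] by blast
    then show ?thesis using True by (simp add: D'_def \<theta>_def rep_zero_on[OF A(1)[OF j]])
  next
    case False
    have "nat (rep (A j) c \<rho>) \<le> N"
      unfolding N_def using j member_le_sum[of "(j, \<rho>)" "{..<?s} \<times> UNIV" "\<lambda>(j, \<rho>). nat (rep (A j) c \<rho>)"] by simp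
    then show ?thesis using False by (simp add: D'_def \<theta>_def)
  qed
  define m m' :: "nat \<Rightarrow> ('r, 'k) cox"
    where "m j = Poly_Mapping.single (exponents (rep (A j) c)) 1" and "m' j = Poly_Mapping.single (exponents (D' j)) 1" for j
  interpret koszul_cech X M m m' N c d z
  proof
    fix j assume j: "j < ?s"
    show "m j \<in> cox_part X c"
      unfolding m_def using monomial_in_cox_part[of "rep (A j) c" "1 :: 'k"] c_nef[OF j] cls_rep[OF A(1)[OF j]] by simp
    have "cls X (D' j) = nmul N (cech_degree {j}) - c"
      unfolding D'_def using cls_rep[OF A(1)[OF j]]
      by (simp add: cls_diff cls_scale_nat cech_degree_def \<theta>_def[abs_def])
    then show "m' j \<in> cox_part X (nmul N (cech_degree {j}) - c)"
      unfolding m'_def using monomial_in_cox_part[of "D' j" "1 :: 'k"] D'_nonneg[OF j] by simp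
    have "m j * m' j = Poly_Mapping.single (exponents (\<lambda>\<rho>. int N * \<theta> j \<rho>)) 1"
      unfolding m_def m'_def using c_nef[OF j] D'_nonneg[OF j] by (subst monomial_mult) (auto simp: D'_def)
    also have "\<dots> = cech_gen X j ^ N"
      unfolding cech_gen_def xhat_monomial by (subst monomial_power) (auto simp: \<theta>_def[abs_def])
    finally show "m j * m' j = cech_gen X j ^ N" .
  qed (use z regular_vanishing[OF d c] in auto)
  obtain y where y: "\<forall>j<?s. y j \<in> part M d" "z = (\<Sum>j<?s. m j *m y j)" using decomposition by blast
  show "z \<in> span (part M d)" unfolding y(2) using y(1) by (intro span_sum span_scale span_base) auto
qed

text \<open>The nef classes that work for all regular \<open>d\<close> at once form a submonoid,
  because \<open>d + x\<close> is again regular; it contains the atoms.\<close>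

lemma generation:
  assumes "d \<in> reg X M" "n \<in> nef TYPE('k) X"
  shows "part M (d + n) \<subseteq> span (part M d)"
proof -
  let ?T = "{n \<in> nef TYPE('k) X. \<forall>d\<in>reg X M. part M (d + n) \<subseteq> span (part M d)}"
  have nef: "nef TYPE('k) X = bpf.monoid" by (simp add: nef_eq bpf_monoid)
  have "submonoid_generated bpf.atoms \<subseteq> ?T"
  proof (rule submonoid_generated_minimal)
    show "bpf.atoms \<subseteq> ?T" using generation_step by (auto simp: nef bpf.atoms_def)
    show "0 \<in> ?T" using span_superset by (auto simp: nef bpf.monoid_zero)
    fix x y assume xy: "x \<in> ?T" "y \<in> ?T"
    have "part M (d + (x + y)) \<subseteq> span (part M d)" if d: "d \<in> reg X M" for d
    proof -
      have "d + x \<in> reg X M" using d xy(1) by (intro regular_add_nef) auto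
      then have "part M (d + (x + y)) \<subseteq> span (part M (d + x))" using xy(2) by (simp add: add.assoc[symmetric])
      also have "\<dots> \<subseteq> span (part M d)" using xy(1) d by (intro span_minimal) auto
      finally show ?thesis .
    qed
    then show "x + y \<in> ?T" using xy bpf.monoid_add by (simp add: nef)
  qed
  then show ?thesis using assms by (auto simp: bpf.atoms_generate nef)
qed

end

section \<open>Homogeneous generators and Nakayama's lemma\<close>

context cox_module
begin

lemma sum_components_superset:
  assumes "finite B" "degrees p \<subseteq> B"
  shows "(\<Sum>a\<in>B. component a p) = p"
proof -
  have "(\<Sum>a\<in>B. component a p) = (\<Sum>a\<in>degrees p. component a p)"
    using assms component_nonzero_degree by (intro sum.mono_neutral_right) auto
  then show ?thesis using sum_components[of p] by simp
qed

lemma decomposition_unique: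
  assumes "finite B" "finite B'" "\<And>a. c a \<in> part M a" "\<And>a. c' a \<in> part M a"
    and "\<And>a. c a \<noteq> 0 \<Longrightarrow> a \<in> B" "\<And>a. c' a \<noteq> 0 \<Longrightarrow> a \<in> B'" "(\<Sum>a\<in>B. c a) = (\<Sum>a\<in>B'. c' a)"
  shows "c = c'"
proof -
  have ex1: "\<exists>!c. finite {a. c a \<noteq> 0} \<and> (\<forall>a. c a \<in> part M a) \<and> x = (\<Sum>a | c a \<noteq> 0. c a)" for x
    using graded unfolding graded_module_def by blast
  have fin: "finite {a. c a \<noteq> 0}" "finite {a. c' a \<noteq> 0}"
    using assms finite_subset[of "{a. c a \<noteq> 0}" B] finite_subset[of "{a. c' a \<noteq> 0}" B'] by blast+
  have support: "(\<Sum>a\<in>B. f a) = (\<Sum>a | f a \<noteq> 0. f a)"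
    if "finite B" "\<And>a. f a \<noteq> 0 \<Longrightarrow> a \<in> B" for f :: "'p \<Rightarrow> 'm" and B
    using that by (intro sum.mono_neutral_right) auto
  have "(\<Sum>a\<in>B. c a) = (\<Sum>a | c a \<noteq> 0. c a)" "(\<Sum>a\<in>B. c a) = (\<Sum>a | c' a \<noteq> 0. c' a)"
    using support[OF assms(1,5)] support[OF assms(2,6)] assms(7) by simp_all
  then show ?thesis using ex1[of "\<Sum>a\<in>B. c a"] fin assms(3,4) by blast
qed

text \<open>Each coefficient may be replaced by its component of degree \<open>d - deg g\<close>; by
  uniqueness of the decomposition in \<open>M\<close> the other components contribute 0.\<close>

lemma homogeneous_combination:
  assumes G: "finite G" "\<And>g. g \<in> G \<Longrightarrow> g \<in> part M (deg g)" and x: "x \<in> part M d" "x \<in> span G"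
  shows "\<exists>p. (\<forall>g\<in>G. p g \<in> cox_part X (d - deg g)) \<and> x = (\<Sum>g\<in>G. p g *m g)"
proof -
  obtain q where q: "x = (\<Sum>g\<in>G. q g *m g)" using x(2) span_finite[OF G(1)] by auto
  define B where "B = (\<Union>g\<in>G. (\<lambda>a. a + deg g) ` degrees (q g))"
  define c where "c a = (\<Sum>g\<in>G. component (a - deg g) (q g) *m g)" for a
  have finB: "finite B" unfolding B_def using G(1) finite_degrees by blast
  have comp: "(\<Sum>a\<in>B. component (a - deg g) (q g)) = q g" if "g \<in> G" for g
  proof -
    have "(\<Sum>a\<in>B. component (a - deg g) (q g)) = (\<Sum>a\<in>(\<lambda>a. a - deg g) ` B. component a (q g))"
      by (subst sum.reindex) (auto simp: inj_on_def)
    also have "\<dots> = q g"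
    proof (rule sum_components_superset)
      show "degrees (q g) \<subseteq> (\<lambda>a. a - deg g) ` B"
        using that unfolding B_def by (force simp: image_iff)
    qed (use finB in simp)
    finally show ?thesis .
  qed
  have "(\<lambda>a. if a = d then x else 0) = c"
  proof (rule decomposition_unique[of "{d}" B])
    show "c a \<in> part M a" for a
      unfolding c_def
    proof (rule part_sum)
      fix g assume "g \<in> G"
      then show "component (a - deg g) (q g) *m g \<in> part M a"
        using part_act[OF component_in_cox_part G(2), of g "a - deg g" "q g"] by simp
    qed
    show "a \<in> B" if "c a \<noteq> 0" for a
    proof -
      obtain g where g: "g \<in> G" "component (a - deg g) (q g) *m g \<noteq> 0"
        using \<open>c a \<noteq> 0\<close> unfolding c_def by (rule sum.not_neutral_contains_not_neutral)
      then have "component (a - deg g) (q g) \<noteq> 0" by auto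
      then have "a - deg g \<in> degrees (q g)" by (rule component_nonzero_degree)
      then show ?thesis unfolding B_def using g(1) by (force simp: image_iff)
    qed
    have "(\<Sum>a\<in>B. c a) = (\<Sum>g\<in>G. (\<Sum>a\<in>B. component (a - deg g) (q g)) *m g)"
      unfolding c_def scale_sum_left by (rule sum.swap)
    also have "\<dots> = x" unfolding q using comp by (intro sum.cong) auto
    finally show "(\<Sum>a\<in>{d}. if a = d then x else 0) = (\<Sum>a\<in>B. c a)" by simp
  qed (use x(1) finB in \<open>auto split: if_splits\<close>)
  then have "(if d = d then x else 0) = c d" by (rule fun_cong)
  then have "x = c d" by simp
  then show ?thesis unfolding c_def using component_in_cox_part by (intro exI[of _ "\<lambda>g. component (d - deg g) (q g)"]) blast
qed

text \<open>Elimination with denominators outside \<open>P\<close>: since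
  \<open>p g\<^sub>0 \<in> P\<close>, the factor \<open>k = h - p g\<^sub>0\<close> stays outside
  \<open>P\<close> and expresses \<open>k *m g\<^sub>0\<close> by the other generators, which
  removes \<open>g\<^sub>0\<close> from their relations.\<close>

lemma nakayama:
  assumes P: "\<And>p q. p * q \<in> P \<Longrightarrow> p \<in> P \<or> q \<in> P" "1 \<notin> P" "module.subspace (*) P" and "finite G"
    and "\<And>g. g \<in> G \<Longrightarrow> \<exists>h p. h \<notin> P \<and> (\<forall>g'. p g' \<in> P) \<and> h *m g = (\<Sum>g'\<in>G. p g' *m g')"
  shows "\<exists>s. s \<notin> P \<and> (\<forall>g\<in>G. s *m g = 0)"
  using assms(4,5)
proof (induction G rule: finite_induct)
  case empty
  then show ?case using P(2) by blast
next
  case (insert g\<^sub>0 G)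
  interpret S: module "(*) :: ('r, 'k) cox \<Rightarrow> _" by (rule module_cox)
  obtain h p where h: "h \<notin> P" "\<forall>g'. p g' \<in> P" "h *m g\<^sub>0 = (\<Sum>g'\<in>insert g\<^sub>0 G. p g' *m g')"
    using insert.prems by blast
  define k where "k = h - p g\<^sub>0"
  have k: "k \<notin> P" using h(1,2) S.subspace_add[OF P(3), of k "p g\<^sub>0"] by (auto simp: k_def)
  have kg: "k *m g\<^sub>0 = (\<Sum>g'\<in>G. p g' *m g')"
    using h(3) insert.hyps by (simp add: k_def scale_left_diff_distrib)
  have "\<exists>s. s \<notin> P \<and> (\<forall>g\<in>G. s *m g = 0)"
  proof (rule insert.IH)
    fix g assume "g \<in> G"
    then obtain l q where l: "l \<notin> P" "\<forall>g'. q g' \<in> P" "l *m g = (\<Sum>g'\<in>insert g\<^sub>0 G. q g' *m g')"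
      using insert.prems by blast
    have "(k * l) *m g = k *m q g\<^sub>0 *m g\<^sub>0 + (\<Sum>g'\<in>G. k *m q g' *m g')"
      using l(3) insert.hyps by (simp add: scale_scale[symmetric] scale_right_distrib scale_sum_right del: scale_scale)
    also have "k *m q g\<^sub>0 *m g\<^sub>0 = q g\<^sub>0 *m k *m g\<^sub>0" by (rule scale_left_commute)
    also have "\<dots> + (\<Sum>g'\<in>G. k *m q g' *m g') = (\<Sum>g'\<in>G. (q g\<^sub>0 * p g' + k * q g') *m g')"
      unfolding kg by (simp add: scale_sum_right scale_left_distrib sum.distrib)
    finally have "(k * l) *m g = (\<Sum>g'\<in>G. (q g\<^sub>0 * p g' + k * q g') *m g')" .
    moreover have "k * l \<notin> P" using P(1) k l(1) by blast
    moreover have "\<forall>g'. q g\<^sub>0 * p g' + k * q g' \<in> P"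
      using h(2) l(2) S.subspace_add[OF P(3)] S.subspace_scale[OF P(3)] by blast
    ultimately show "\<exists>h p. h \<notin> P \<and> (\<forall>g'. p g' \<in> P) \<and> h *m g = (\<Sum>g'\<in>G. p g' *m g')"
      by (intro exI[of _ "k * l"] exI[of _ "\<lambda>g'. q g\<^sub>0 * p g' + k * q g'"]) blast
  qed
  then obtain s where s: "s \<notin> P" "\<forall>g\<in>G. s *m g = 0" by blast
  have "(s * k) *m g\<^sub>0 = (\<Sum>g'\<in>G. s *m p g' *m g')"
    using kg by (simp add: scale_scale[symmetric] scale_sum_right del: scale_scale)
  also have "\<dots> = (\<Sum>g'\<in>G. p g' *m s *m g')" by (intro sum.cong refl scale_left_commute)
  also have "\<dots> = 0" using s(2) by simp
  finally have "(s * k) *m g\<^sub>0 = 0" .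
  moreover have "(s * k) *m g = 0" if "g \<in> G" for g
    using s(2) that by (simp add: mult.commute[of s k] flip: scale_scale)
  moreover have "s * k \<notin> P" using P(1) s(1) k by blast
  ultimately show ?case by blast
qed

text \<open>The homogeneous components of finitely many generators generate, and a finite generating
  set contains a minimal one.\<close>

lemma finite_minimal_generating_set:
  assumes "finitely_generated M"
  obtains G where "finite G" "minimal_generating_set M G"
proof -
  obtain G\<^sub>0 where G0: "finite G\<^sub>0" "span G\<^sub>0 = UNIV" using assms by (auto simp: finitely_generated_def)
  have "\<exists>c. finite {a. c a \<noteq> 0} \<and> (\<forall>a. c a \<in> part M a) \<and> x = (\<Sum>a | c a \<noteq> 0. c a)" for x
    using graded unfolding graded_module_def by blast
  then obtain c where c: "\<And>x. finite {a. c x a \<noteq> 0}" "\<And>x a. c x a \<in> part M a" "\<And>x. x = (\<Sum>a | c x a \<noteq> 0. c x a)"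
    by metis
  define G\<^sub>1 where "G\<^sub>1 = (\<Union>x\<in>G\<^sub>0. c x ` {a. c x a \<noteq> 0})"
  have fin: "finite G\<^sub>1" unfolding G\<^sub>1_def using G0(1) c(1) by blast
  have hom: "\<forall>g\<in>G\<^sub>1. \<exists>a. g \<in> part M a" unfolding G\<^sub>1_def using c(2) by blast
  have "G\<^sub>0 \<subseteq> span G\<^sub>1"
  proof
    fix x assume "x \<in> G\<^sub>0"
    then have "(\<Sum>a | c x a \<noteq> 0. c x a) \<in> span G\<^sub>1" by (intro span_sum span_base) (auto simp: G\<^sub>1_def)
    then show "x \<in> span G\<^sub>1" using c(3)[of x] by simp
  qed
  then have "span G\<^sub>1 = UNIV" using span_minimal[OF _ subspace_span] G0(2) by blast
  then have "{G. G \<subseteq> G\<^sub>1 \<and> span G = UNIV} \<noteq> {}" by blast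
  moreover have "finite {G. G \<subseteq> G\<^sub>1 \<and> span G = UNIV}" using fin by simp
  ultimately obtain G where G: "G \<in> {G. G \<subseteq> G\<^sub>1 \<and> span G = UNIV}"
      "\<forall>G'\<in>{G. G \<subseteq> G\<^sub>1 \<and> span G = UNIV}. G' \<subseteq> G \<longrightarrow> G = G'"
    using finite_has_minimal[of "{G. G \<subseteq> G\<^sub>1 \<and> span G = UNIV}"] by blast
  then have sub: "G \<subseteq> G\<^sub>1" by blast
  have "minimal_generating_set M G"
    unfolding minimal_generating_set_def
  proof (intro conjI ballI allI impI notI)
    show "\<exists>a. g \<in> part M a" if "g \<in> G" for g using hom that sub by blast
    show "span G = UNIV" using G(1) by blast
    show False if "G' \<subset> G" "span G' = UNIV" for G' using G that by blast
  qed
  then show thesis using that finite_subset[OF sub fin] by blast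
qed

end

context regular_module
begin

text \<open>
  If \<open>d\<close> is negative on the curve \<open>P\<close> then, the generators having nef degrees, \<open>M\<^sub>d \<subseteq> P M\<close>;
  but \<open>M\<^sub>d\<close> generates \<open>M\<close> at the generic point of \<open>P\<close>.
\<close>

lemma reg_subset_nef:
  assumes fg: "finitely_generated M" and faithful: "annihilator M = {0}"
    and gens: "\<And>g a. minimal_generator M g \<Longrightarrow> g \<in> part M a \<Longrightarrow> a \<in> nef TYPE('k) X"
  shows "reg X M \<subseteq> nef TYPE('k) X"
proof (rule subsetI, rule ccontr)
  fix d assume d: "d \<in> reg X M" "d \<notin> nef TYPE('k) X"
  then obtain P where P: "P \<in> curves X" "\<not> nonneg_on_curve X (P :: ('r, 'k) cox set) d" by (auto simp: nef_def)
  interpret S: module "(*) :: ('r, 'k) cox \<Rightarrow> _" by (rule module_cox)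
  have PT: "P \<in> toric_points X" using P(1) by (simp add: curves_def)
  then have PS: "S.subspace P" "1 \<notin> P" "\<And>p q. p * q \<in> P \<Longrightarrow> p \<in> P \<or> q \<in> P" by (simp_all add: toric_points_def)
  obtain G where G: "finite G" "minimal_generating_set M G" using finite_minimal_generating_set[OF fg] .
  have span_G: "span G = UNIV" using G(2) by (simp add: minimal_generating_set_def)
  obtain deg where deg: "\<And>g. g \<in> G \<Longrightarrow> g \<in> part M (deg g)"
    using G(2) unfolding minimal_generating_set_def by metis
  have deg_nef: "deg g \<in> nef TYPE('k) X" if "g \<in> G" for g
    using gens[of g "deg g"] deg[OF that] G(2) that by (auto simp: minimal_generator_def)
  let ?PM = "{x. \<exists>p. (\<forall>g. p g \<in> P) \<and> x = (\<Sum>g\<in>G. p g *m g)}"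
  have "subspace ?PM"
  proof (rule subspaceI)
    show "0 \<in> ?PM" using S.subspace_0[OF PS(1)] by (auto intro!: exI[of _ "\<lambda>_. 0"])
  next
    fix x y assume "x \<in> ?PM" "y \<in> ?PM"
    then obtain p q where "\<forall>g. p g \<in> P" "x = (\<Sum>g\<in>G. p g *m g)" "\<forall>g. q g \<in> P" "y = (\<Sum>g\<in>G. q g *m g)" by blast
    then show "x + y \<in> ?PM"
      using S.subspace_add[OF PS(1)]
      by (auto intro!: exI[of _ "\<lambda>g. p g + q g"] simp: scale_left_distrib sum.distrib)
  next
    fix s x assume "x \<in> ?PM"
    then obtain p where "\<forall>g. p g \<in> P" "x = (\<Sum>g\<in>G. p g *m g)" by blast
    then show "s *m x \<in> ?PM"
      using S.subspace_scale[OF PS(1)] by (auto intro!: exI[of _ "\<lambda>g. s * p g"] simp: scale_sum_right)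
  qed
  moreover have "part M d \<subseteq> ?PM"
  proof
    fix x assume "x \<in> part M d"
    then obtain p where p: "\<forall>g\<in>G. p g \<in> cox_part X (d - deg g)" "x = (\<Sum>g\<in>G. p g *m g)"
      using homogeneous_combination[OF G(1) deg, of x d] span_G by blast
    define p' where "p' g = (if g \<in> G then p g else 0)" for g
    have "\<forall>g. p' g \<in> P"
      using nef_if_nonneg_factor[OF deg_nef P] p(1) S.subspace_0[OF PS(1)] by (auto simp: p'_def)
    moreover have "x = (\<Sum>g\<in>G. p' g *m g)" unfolding p(2) p'_def by (intro sum.cong) auto
    ultimately show "x \<in> ?PM" by blast
  qed
  ultimately have PM: "span (part M d) \<subseteq> ?PM" by (intro span_minimal)
  obtain A where A: "A \<in> \<M>" "\<And>\<rho>. \<rho> \<notin> A \<Longrightarrow> cox_var \<rho> \<notin> P" using toric_point_misses_cone[OF PT] by blast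
  have "\<exists>h p. h \<notin> P \<and> (\<forall>g'. p g' \<in> P) \<and> h *m g = (\<Sum>g'\<in>G. p g' *m g')" if g: "g \<in> G" for g
  proof -
    \<comment> \<open>Ampleness puts \<open>deg g + nmul n H\<close> into \<open>d + Nef X\<close>.
      The factor \<open>?h\<close>, the monomial of degree \<open>nmul n H\<close> that trivializes
      this class on a chart meeting \<open>P\<close>, stays outside \<open>P\<close>.\<close>
    obtain n where n: "(deg g - d) + nmul n H \<in> basepoint_free" using eventually_basepoint_free by blast
    let ?D = "rep A (nmul n H)"
    let ?h = "Poly_Mapping.single (exponents ?D) 1 :: ('r, 'k) cox"
    have "0 \<le> ?D \<rho>" for \<rho>
      using rep_H_pos[OF A(1), of \<rho>] rep_zero_on[OF A(1), of \<rho>] by (cases "\<rho> \<in> A") (simp_all add: rep_nmul[OF A(1)])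
    then have "?h \<in> cox_part X (nmul n H)"
      using monomial_in_cox_part[of ?D "1 :: 'k"] cls_rep[OF A(1)] by simp
    then have "?h *m g \<in> part M (nmul n H + deg g)" using deg[OF g] by (rule part_act)
    also have "nmul n H + deg g = d + ((deg g - d) + nmul n H)" by (simp add: algebra_simps)
    finally have "?h *m g \<in> span (part M d)" using generation[OF d(1), of "(deg g - d) + nmul n H"] n by (auto simp: nef_eq)
    then have "?h *m g \<in> ?PM" using PM by blast
    moreover have "?h \<notin> P"
    proof (rule monomial_notin_point[OF PT A(2)])
      fix \<rho> assume "\<rho> \<in> A"
      then have "?D \<rho> = 0" by (rule rep_zero_on[OF A(1)])
      then show "Poly_Mapping.lookup (exponents ?D) \<rho> = 0" by simp
    qed
    ultimately show ?thesis by blast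
  qed
  then obtain s where s: "s \<notin> P" "\<forall>g\<in>G. s *m g = 0" using nakayama[OF PS(3,2,1) G(1)] by blast
  have "s *m x = 0" for x
  proof -
    obtain q where "x = (\<Sum>g\<in>G. q g *m g)" using span_G span_finite[OF G(1)] by auto
    then have "s *m x = (\<Sum>g\<in>G. s *m q g *m g)" by (simp add: scale_sum_right del: scale_scale)
    also have "\<dots> = (\<Sum>g\<in>G. q g *m s *m g)" by (intro sum.cong refl scale_left_commute)
    also have "\<dots> = 0" using s(2) by simp
    finally show ?thesis .
  qed
  then have "s \<in> annihilator M" by (simp add: annihilator_def)
  then show False using faithful s(1) S.subspace_0[OF PS(1)] by auto
qed

end

lemma (in smooth_normal_fan) maximal_cones: "maximal_cones X (R ` W) (cls X support_divisor)"
proof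
  show "cls X (\<lambda>\<rho>. D \<rho> + E \<rho>) = cls X D + cls X E" for D E by (rule cls_add)
  show "surj (cls X)" by (rule cls_surj)
  show "finite (fan X)" using smooth_projective by (simp add: smooth_projective_toric_def is_fan_def)
  show "R ` W \<noteq> {}" using W_nonempty by simp
next
  fix A assume "A \<in> R ` W"
  then obtain w where w: "w \<in> W" "A = R w" by blast
  show "\<exists>!D. cls X D = a \<and> (\<forall>\<rho>\<in>A. D \<rho> = 0)" for a
    unfolding w(2) by (rule representative_unique_exists[OF w(1)])
  have "cls X (\<lambda>\<rho>. support_divisor \<rho> + principal w \<rho>) = cls X support_divisor"
    using cls_principal[OF W_lattice[OF w(1)]] by (simp add: cls_add)
  then show "\<exists>D. cls X D = cls X support_divisor \<and> (\<forall>\<rho>\<in>A. D \<rho> = 0) \<and> (\<forall>\<rho>. \<rho> \<notin> A \<longrightarrow> 0 < D \<rho>)"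
    using ample_zero_iff[OF w(1)] ample_nonneg[OF w(1)] unfolding w(2)
    by (intro exI[of _ "\<lambda>\<rho>. support_divisor \<rho> + principal w \<rho>"]) (simp add: order_less_le)
  show "\<exists>i' E. i' \<notin> A \<and> insert i' (A - {i}) \<in> R ` W \<and> cls X E = 0 \<and> (\<forall>j\<in>A - {i}. E j = 0) \<and> E i = 1 \<and> E i' = - 1 \<and>
      (\<forall>B\<in>R ` W. A - {i} \<subseteq> B \<longrightarrow> B = A \<or> B = insert i' (A - {i}))" if "i \<in> A" for i
  proof -
    have "i \<in> R w" using that w(2) by simp
    from adjacent_vertex[OF w(1) this] obtain w' i' E where w': "w' \<in> W" "i' \<notin> R w" "R w' = insert i' (R w - {i})" "cls X E = 0"
        "\<forall>j\<in>R w - {i}. E j = 0" "E i = 1" "E i' = -1" "\<forall>y\<in>W. R w - {i} \<subseteq> R y \<longrightarrow> y = w \<or> y = w'"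
      by (elim bexE exE conjE)
    have "\<forall>B\<in>R ` W. R w - {i} \<subseteq> B \<longrightarrow> B = R w \<or> B = insert i' (R w - {i})"
      unfolding w'(3)[symmetric] using w'(8) by blast
    moreover have "insert i' (R w - {i}) \<in> R ` W" unfolding w'(3)[symmetric] using w'(1) by (rule imageI)
    ultimately show ?thesis unfolding w(2) using w' by blast
  qed
  show "\<exists>i\<in>A. \<exists>E. cls X E = 0 \<and> (\<forall>j\<in>A - {i}. E j = 0) \<and> E i = 1 \<and> E \<rho> < 0" if "\<rho> \<notin> A" for \<rho>
    using decreasing_edge[OF w(1)] that unfolding w(2) by blast
  show "\<exists>\<kappa>\<in>fan X. {\<rho>. ray X \<rho> \<subseteq> \<kappa>} = A"
    unfolding w(2) R_def using \<sigma>_in_fan[OF w(1)] by blast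
next
  fix \<kappa> assume "\<kappa> \<in> fan X"
  then show "\<exists>A\<in>R ` W. {\<rho>. ray X \<rho> \<subseteq> \<kappa>} \<subseteq> A" using fan_cone_in_R by blast
qed

theorem theorem4p5:
  fixes X :: "('n::finite, 'r::{finite,linorder}, 'p::ab_group_add) toric"
    and M :: "('r, 'k::field, 'p, 'm::ab_group_add) gmodule"
  assumes "smooth_projective_toric X"
    and "graded_module X M"
    and "finitely_generated M"
    and "annihilator M = {0}"
    and "\<not> sheaf_is_zero X M"
    and "\<And>g a. minimal_generator M g \<Longrightarrow> g \<in> part M a \<Longrightarrow> a \<in> nef TYPE('k) X"
  shows "reg X M \<subseteq> nef TYPE('k) X \<and> finite (minimal_elements TYPE('k) X (reg X M))"
proof -
  obtain V where "finite V" "V \<subseteq> lattice" "interior (convex hull V) \<noteq> {}" "fan X = normal_fan (convex hull V)"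
    using assms(1) unfolding smooth_projective_toric_def projective_fan_def by blast
  then interpret smooth_normal_fan X V using assms(1) by unfold_locales
  interpret maximal_cones X "R ` W" "cls X support_divisor" by (rule maximal_cones)
  interpret regular_module X "R ` W" "cls X support_divisor" M using assms(2) by unfold_locales
  have "reg X M \<subseteq> nef TYPE('k) X" by (rule reg_subset_nef) (fact assms)+
  then show ?thesis using finite_minimal_elements by blast
qed

end
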